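(* Let $\mathcal{C}$ be a variety of universal algebras, let $A$ be an algebra in $\mathcal{C}$, and regard the lattice $\mathrm{Cong}(A)$ of congruences on $A$ as a complete multiplicative lattice whose multiplication $(x,y)\mapsto xy$ is the commutator of congruences. The space $\mathrm{Spec}(\mathrm{Cong}(A))$ is spectral whenever the following conditions hold: (a) there is a congruence modular variety to which $A$ belongs; (b) $A\times A$ is finitely generated as a congruence on $A$; (c) if congruences $x$ and $y$ on $A$ are finitely generated, then so is their commutator $xy$.
   Context: Commutator. A span $S$ in $\mathcal{C}$ consists of homomorphisms $S_0\xleftarrow{\pi}S_1\xrightarrow{\pi'}S_0'$ in $\mathcal{C}$. Put $S_4=\{(f_1,f_2,f_3,f_4)\in S_1^4\mid \pi f_1=\pi f_2,\ \pi' f_1=\pi' f_3,\ \pi f_3=\pi f_4,\ \pi' f_2=\pi' f_4\}$. An internal pseudogroupoid structure on $S$ is a homomorphism $m:S_4\to S_1$ such that: (i) $\pi m(f_1,f_2,f_3,f_4)=\pi f_3$ and $\pi' m(f_1,f_2,f_3,f_4)=\pi' f_3$; (ii) $m(f_1,f_2,f_3,f_4)=m(f_1,f_2,f_3',f_4)$ whenever both sides are defined; (iii) $m(f_1,f_2,f_3,f_4)=f_4$ if $f_1=f_2$; (iv) $m(f_1,f_2,f_3,f_4)=f_1$ if $f_2=f_4$; (v) $m(m(f_1,f_2,f_3,f_4),f_5,f_3',f_6)=m(f_1,f_2,f_3',m(f_4,f_5,f_3'',f_6))$ whenever both sides are defined. A morphism of spans $\varphi:S\to T$ is a triple of homomorphisms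 $\varphi_0:S_0\to T_0$, $\varphi_1:S_1\to T_1$, $\varphi_0':S_0'\to T_0'$ commuting with the span legs. For congruences $x,y$ on $A$, the commutator $xy$ is the intersection of the kernel congruences $\mathrm{Eq}(\varphi_1)=\{(a,b)\in A\times A\mid\varphi_1(a)=\varphi_1(b)\}$ over all span morphisms $\varphi:S\to T$, where $S$ is the span $A/x\leftarrow A\to A/y$ of quotient maps and $T$ ranges over all spans in $\mathcal{C}$ that admit an internal pseudogroupoid structure. It satisfies $xy\leqslant x\wedge y$. (When $\mathcal{C}$ is congruence modular, this commutator is known to coincide with the usual modular commutator.) Spectrum. A complete multiplicative lattice is a complete lattice $L$ with a binary multiplication satisfying $xy\leqslant x\wedge y$ for all $x,y$. An element $p\neq 1$ of $L$ is prime if for all $x,y\in L$, $xy\leqslant p$ implies $x\leqslant p$ or $y\leqslant p$. $\mathrm{Spec}(L)$ is the set of prime elements with the Zariski topology, whose closed sets are exactly the sets $\mathrm{V}(x)=\{p\in\mathrm{Spec}(L)\mid x\leqslant p\}$, $x\in L$. A spectral space is a compact sober topological space in which the compact open subsets form a basis of the topology that is closed under finite intersections; sober means $\mathrm{T}_0$ and every irreducible closed subset is the closure of a one-element set. A variety is congruence modular if the congruence lattice of each of its algebras is modular. *)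

theory Defs
  imports "HOL-Algebra.Complete_Lattice" "HOL-Analysis.Abstract_Topological_Spaces"
begin

section \<open>Algebras, terms and varieties\<close>

text \<open>A finitary signature is a partial map: \<^term>\<open>\<sigma> f = Some n\<close> says that \<^term>\<open>f\<close> is an
  \<^term>\<open>n\<close>-ary operation symbol, and the symbols outside the domain are not used. Hence every
  set of operation symbols occurs, the empty one included. Algebras may have an empty carrier.\<close>

type_synonym 'f signature = "'f \<Rightarrow> nat option"

record ('f, 'a) ualgebra = "'a partial_object" +
  opr :: "'f \<Rightarrow> 'a list \<Rightarrow> 'a"

definition is_algebra :: "'f signature \<Rightarrow> ('f, 'a) ualgebra \<Rightarrow> bool" where
  "is_algebra \<sigma> A \<longleftrightarrow>
     (\<forall>f xs. \<sigma> f = Some (length xs) \<and> set xs \<subseteq> carrier A \<longrightarrow> opr A f xs \<in> carrier A)"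

definition alg_hom :: "'f signature \<Rightarrow> ('f, 'a) ualgebra \<Rightarrow> ('f, 'b) ualgebra \<Rightarrow> ('a \<Rightarrow> 'b) set" where
  "alg_hom \<sigma> A B = {h. h ` carrier A \<subseteq> carrier B \<and>
     (\<forall>f xs. \<sigma> f = Some (length xs) \<and> set xs \<subseteq> carrier A \<longrightarrow>
        h (opr A f xs) = opr B f (map h xs))}"

datatype ('f, 'v) trm = Var 'v | Op 'f "('f, 'v) trm list"

fun wf_trm :: "'f signature \<Rightarrow> ('f, 'v) trm \<Rightarrow> bool" where
  "wf_trm \<sigma> (Var v) = True"
| "wf_trm \<sigma> (Op f ts) = (\<sigma> f = Some (length ts) \<and> (\<forall>t\<in>set ts. wf_trm \<sigma> t))"

fun trm_val :: "('f, 'a) ualgebra \<Rightarrow> ('v \<Rightarrow> 'a) \<Rightarrow> ('f, 'v) trm \<Rightarrow> 'a" where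
  "trm_val A \<rho> (Var v) = \<rho> v"
| "trm_val A \<rho> (Op f ts) = opr A f (map (trm_val A \<rho>) ts)"

text \<open>A variety is presented by its signature and a set of identities between terms in countably
  many variables. Since a HOL predicate lives on one type, membership in the variety is a
  polymorphic predicate on algebras.\<close>

type_synonym 'f identities = "(('f, nat) trm \<times> ('f, nat) trm) set"

definition wf_identities :: "'f signature \<Rightarrow> 'f identities \<Rightarrow> bool" where
  "wf_identities \<sigma> E \<longleftrightarrow> (\<forall>(s, t)\<in>E. wf_trm \<sigma> s \<and> wf_trm \<sigma> t)"

definition in_variety :: "'f signature \<Rightarrow> 'f identities \<Rightarrow> ('f, 'a) ualgebra \<Rightarrow> bool" where
  "in_variety \<sigma> E A \<longleftrightarrow> is_algebra \<sigma> A \<and>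
     (\<forall>(s, t)\<in>E. \<forall>\<rho>. range \<rho> \<subseteq> carrier A \<longrightarrow> trm_val A \<rho> s = trm_val A \<rho> t)"


section \<open>Congruences\<close>

definition congruence :: "'f signature \<Rightarrow> ('f, 'a) ualgebra \<Rightarrow> ('a \<times> 'a) set \<Rightarrow> bool" where
  "congruence \<sigma> A \<theta> \<longleftrightarrow> equiv (carrier A) \<theta> \<and>
     (\<forall>f xs ys. \<sigma> f = Some (length xs) \<and> list_all2 (\<lambda>a b. (a, b) \<in> \<theta>) xs ys \<longrightarrow>
        (opr A f xs, opr A f ys) \<in> \<theta>)"

definition Cong :: "'f signature \<Rightarrow> ('f, 'a) ualgebra \<Rightarrow> ('a \<times> 'a) set gorder" where
  "Cong \<sigma> A = \<lparr>carrier = {\<theta>. congruence \<sigma> A \<theta>}, eq = (=), le = (\<subseteq>)\<rparr>"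

definition cong_gen :: "'f signature \<Rightarrow> ('f, 'a) ualgebra \<Rightarrow> ('a \<times> 'a) set \<Rightarrow> ('a \<times> 'a) set" where
  "cong_gen \<sigma> A R = \<Inter>{\<theta>. congruence \<sigma> A \<theta> \<and> R \<subseteq> \<theta>}"

definition fin_gen_congruence :: "'f signature \<Rightarrow> ('f, 'a) ualgebra \<Rightarrow> ('a \<times> 'a) set \<Rightarrow> bool" where
  "fin_gen_congruence \<sigma> A \<theta> \<longleftrightarrow> congruence \<sigma> A \<theta> \<and>
     (\<exists>R. finite R \<and> R \<subseteq> carrier A \<times> carrier A \<and> \<theta> = cong_gen \<sigma> A R)"

definition modular_lattice :: "('a, 'b) gorder_scheme \<Rightarrow> bool" where
  "modular_lattice L \<longleftrightarrow> lattice L \<and>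
     (\<forall>x\<in>carrier L. \<forall>y\<in>carrier L. \<forall>z\<in>carrier L. x \<sqsubseteq>\<^bsub>L\<^esub> z \<longrightarrow>
        x \<squnion>\<^bsub>L\<^esub> (y \<sqinter>\<^bsub>L\<^esub> z) = (x \<squnion>\<^bsub>L\<^esub> y) \<sqinter>\<^bsub>L\<^esub> z)"

text \<open>All algebras of the variety should be considered here, of whatever carrier type; a
  definition has to name one type. Algebras whose elements are terms suffice: see
  \<open>congruence_modular_variety_all_types\<close> below.\<close>

definition congruence_modular_variety :: "'f signature \<Rightarrow> 'f identities \<Rightarrow> bool" where
  "congruence_modular_variety \<sigma> E \<longleftrightarrow> wf_identities \<sigma> E \<and>
     (\<forall>B :: ('f, ('f, nat) trm) ualgebra. in_variety \<sigma> E B \<longrightarrow> modular_lattice (Cong \<sigma> B))"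

definition quot_algebra :: "('f, 'a) ualgebra \<Rightarrow> ('a \<times> 'a) set \<Rightarrow> ('f, 'a set) ualgebra" where
  "quot_algebra A \<theta> = \<lparr>carrier = carrier A // \<theta>,
     opr = (\<lambda>f Xs. \<theta> `` {opr A f (map (\<lambda>X. SOME a. a \<in> X) Xs)})\<rparr>"


section \<open>Spans, pseudogroupoids and the commutator\<close>

record ('f, 'p, 'q, 'r) alg_span =
  ob0 :: "('f, 'p) ualgebra"
  ob1 :: "('f, 'q) ualgebra"
  ob0' :: "('f, 'r) ualgebra"
  leg :: "'q \<Rightarrow> 'p"
  leg' :: "'q \<Rightarrow> 'r"

definition span_in_variety ::
  "'f signature \<Rightarrow> 'f identities \<Rightarrow> ('f, 'p, 'q, 'r) alg_span \<Rightarrow> bool" where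
  "span_in_variety \<sigma> E S \<longleftrightarrow>
     in_variety \<sigma> E (ob0 S) \<and> in_variety \<sigma> E (ob1 S) \<and> in_variety \<sigma> E (ob0' S) \<and>
     leg S \<in> alg_hom \<sigma> (ob1 S) (ob0 S) \<and> leg' S \<in> alg_hom \<sigma> (ob1 S) (ob0' S)"

text \<open>The set \<open>S\<^sub>4\<close>, and the same set as a subalgebra of the fourth power of \<open>S\<^sub>1\<close>.\<close>

definition quads :: "('f, 'p, 'q, 'r) alg_span \<Rightarrow> ('q \<times> 'q \<times> 'q \<times> 'q) set" where
  "quads S = {(f1, f2, f3, f4).
     f1 \<in> carrier (ob1 S) \<and> f2 \<in> carrier (ob1 S) \<and> f3 \<in> carrier (ob1 S) \<and> f4 \<in> carrier (ob1 S) \<and>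
     leg S f1 = leg S f2 \<and> leg' S f1 = leg' S f3 \<and> leg S f3 = leg S f4 \<and> leg' S f2 = leg' S f4}"

definition quad_algebra ::
  "('f, 'p, 'q, 'r) alg_span \<Rightarrow> ('f, 'q \<times> 'q \<times> 'q \<times> 'q) ualgebra" where
  "quad_algebra S = \<lparr>carrier = quads S,
     opr = (\<lambda>f qs. (opr (ob1 S) f (map (\<lambda>(f1, f2, f3, f4). f1) qs),
                    opr (ob1 S) f (map (\<lambda>(f1, f2, f3, f4). f2) qs),
                    opr (ob1 S) f (map (\<lambda>(f1, f2, f3, f4). f3) qs),
                    opr (ob1 S) f (map (\<lambda>(f1, f2, f3, f4). f4) qs)))\<rparr>"

definition pseudogroupoid_structure ::
  "'f signature \<Rightarrow> ('f, 'p, 'q, 'r) alg_span \<Rightarrow> ('q \<times> 'q \<times> 'q \<times> 'q \<Rightarrow> 'q) \<Rightarrow> bool" where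
  "pseudogroupoid_structure \<sigma> S m \<longleftrightarrow>
     m \<in> alg_hom \<sigma> (quad_algebra S) (ob1 S) \<and>
     (\<forall>f1 f2 f3 f4. (f1, f2, f3, f4) \<in> quads S \<longrightarrow>
        leg S (m (f1, f2, f3, f4)) = leg S f3 \<and> leg' S (m (f1, f2, f3, f4)) = leg' S f3) \<and>
     (\<forall>f1 f2 f3 f3' f4. (f1, f2, f3, f4) \<in> quads S \<and> (f1, f2, f3', f4) \<in> quads S \<longrightarrow>
        m (f1, f2, f3, f4) = m (f1, f2, f3', f4)) \<and>
     (\<forall>f1 f2 f3 f4. (f1, f2, f3, f4) \<in> quads S \<and> f1 = f2 \<longrightarrow> m (f1, f2, f3, f4) = f4) \<and>
     (\<forall>f1 f2 f3 f4. (f1, f2, f3, f4) \<in> quads S \<and> f2 = f4 \<longrightarrow> m (f1, f2, f3, f4) = f1) \<and>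
     (\<forall>f1 f2 f3 f4 f5 f6 f3' f3''.
        (f1, f2, f3, f4) \<in> quads S \<and> (m (f1, f2, f3, f4), f5, f3', f6) \<in> quads S \<and>
        (f4, f5, f3'', f6) \<in> quads S \<and> (f1, f2, f3', m (f4, f5, f3'', f6)) \<in> quads S \<longrightarrow>
        m (m (f1, f2, f3, f4), f5, f3', f6) = m (f1, f2, f3', m (f4, f5, f3'', f6)))"

definition span_morphism ::
  "'f signature \<Rightarrow> ('f, 'p, 'q, 'r) alg_span \<Rightarrow> ('f, 's, 't, 'u) alg_span \<Rightarrow>
   ('p \<Rightarrow> 's) \<Rightarrow> ('q \<Rightarrow> 't) \<Rightarrow> ('r \<Rightarrow> 'u) \<Rightarrow> bool" where
  "span_morphism \<sigma> S T \<phi>0 \<phi>1 \<phi>0' \<longleftrightarrow>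
     \<phi>0 \<in> alg_hom \<sigma> (ob0 S) (ob0 T) \<and> \<phi>1 \<in> alg_hom \<sigma> (ob1 S) (ob1 T) \<and>
     \<phi>0' \<in> alg_hom \<sigma> (ob0' S) (ob0' T) \<and>
     (\<forall>a\<in>carrier (ob1 S). \<phi>0 (leg S a) = leg T (\<phi>1 a) \<and> \<phi>0' (leg' S a) = leg' T (\<phi>1 a))"

definition quot_span ::
  "('f, 'a) ualgebra \<Rightarrow> ('a \<times> 'a) set \<Rightarrow> ('a \<times> 'a) set \<Rightarrow> ('f, 'a set, 'a, 'a set) alg_span" where
  "quot_span A x y = \<lparr>ob0 = quot_algebra A x, ob1 = A, ob0' = quot_algebra A y,
     leg = (\<lambda>a. x `` {a}), leg' = (\<lambda>a. y `` {a})\<rparr>"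

text \<open>The test spans \<open>T\<close> should range over all spans of the variety; again a definition has to name
  the types of their carriers. Carriers consisting of lists over the carrier type of \<open>A\<close> suffice:
  by \<open>commutator_all_types\<close> below, a morphism to a test span with carriers of any types
  identifies every pair in the set defined here, so admitting such spans would not change the set.\<close>

definition commutator ::
  "'f signature \<Rightarrow> 'f identities \<Rightarrow> ('f, 'a) ualgebra \<Rightarrow>
   ('a \<times> 'a) set \<Rightarrow> ('a \<times> 'a) set \<Rightarrow> ('a \<times> 'a) set" where
  "commutator \<sigma> E A x y = {(a, b) \<in> carrier A \<times> carrier A.
     \<forall>(T :: ('f, 'a list, 'a list, 'a list) alg_span) \<phi>0 \<phi>1 \<phi>0'.
       span_in_variety \<sigma> E T \<and> (\<exists>m. pseudogroupoid_structure \<sigma> T m) \<and>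
       span_morphism \<sigma> (quot_span A x y) T \<phi>0 \<phi>1 \<phi>0' \<longrightarrow> \<phi>1 a = \<phi>1 b}"


section \<open>Multiplicative lattices and their spectra\<close>

record 'a mult_gorder = "'a gorder" +
  lprod :: "'a \<Rightarrow> 'a \<Rightarrow> 'a"

locale complete_multiplicative_lattice = complete_lattice L for L :: "'a mult_gorder" (structure) +
  assumes lprod_closed: "\<lbrakk>x \<in> carrier L; y \<in> carrier L\<rbrakk> \<Longrightarrow> lprod L x y \<in> carrier L"
    and lprod_le_meet: "\<lbrakk>x \<in> carrier L; y \<in> carrier L\<rbrakk> \<Longrightarrow> lprod L x y \<sqsubseteq> x \<sqinter> y"

definition prime_element :: "'a mult_gorder \<Rightarrow> 'a \<Rightarrow> bool" where
  "prime_element L p \<longleftrightarrow> p \<in> carrier L \<and> p \<noteq> \<top>\<^bsub>L\<^esub> \<and>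
     (\<forall>x\<in>carrier L. \<forall>y\<in>carrier L. lprod L x y \<sqsubseteq>\<^bsub>L\<^esub> p \<longrightarrow> x \<sqsubseteq>\<^bsub>L\<^esub> p \<or> y \<sqsubseteq>\<^bsub>L\<^esub> p)"

definition Spec :: "'a mult_gorder \<Rightarrow> 'a set" where
  "Spec L = {p. prime_element L p}"

definition zariski_closed :: "'a mult_gorder \<Rightarrow> 'a \<Rightarrow> 'a set" where
  "zariski_closed L x = {p \<in> Spec L. x \<sqsubseteq>\<^bsub>L\<^esub> p}"

definition zariski :: "'a mult_gorder \<Rightarrow> 'a topology" where
  "zariski L = topology (\<lambda>U. \<exists>x\<in>carrier L. U = Spec L - zariski_closed L x)"

definition Cong_mult ::
  "'f signature \<Rightarrow> 'f identities \<Rightarrow> ('f, 'a) ualgebra \<Rightarrow> ('a \<times> 'a) set mult_gorder" where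
  "Cong_mult \<sigma> E A = \<lparr>carrier = {\<theta>. congruence \<sigma> A \<theta>}, eq = (=), le = (\<subseteq>),
     lprod = commutator \<sigma> E A\<rparr>"


section \<open>Spectral spaces\<close>

definition irreducible_closed :: "'a topology \<Rightarrow> 'a set \<Rightarrow> bool" where
  "irreducible_closed X C \<longleftrightarrow> closedin X C \<and> C \<noteq> {} \<and>
     (\<forall>C1 C2. closedin X C1 \<and> closedin X C2 \<and> C = C1 \<union> C2 \<longrightarrow> C = C1 \<or> C = C2)"

definition sober_space :: "'a topology \<Rightarrow> bool" where
  "sober_space X \<longleftrightarrow> t0_space X \<and>
     (\<forall>C. irreducible_closed X C \<longrightarrow> (\<exists>p\<in>topspace X. C = X closure_of {p}))"

definition compact_open :: "'a topology \<Rightarrow> 'a set \<Rightarrow> bool" where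
  "compact_open X U \<longleftrightarrow> compactin X U \<and> openin X U"

definition spectral_space :: "'a topology \<Rightarrow> bool" where
  "spectral_space X \<longleftrightarrow> compact_space X \<and> sober_space X \<and>
     openin X = arbitrary union_of (compact_open X) \<and>
     (\<forall>U V. compact_open X U \<and> compact_open X V \<longrightarrow> compact_open X (U \<inter> V))"


section \<open>Independence of the carrier types\<close>

lemma alg_homD:
  assumes "h \<in> alg_hom \<sigma> A B" "\<sigma> f = Some (length xs)" "set xs \<subseteq> carrier A"
  shows "h (opr A f xs) = opr B f (map h xs)"
  using assms by (auto simp: alg_hom_def)

lemma pseudogroupoid_structureI:
  assumes "m \<in> alg_hom \<sigma> (quad_algebra S) (ob1 S)"
    "\<And>f1 f2 f3 f4. (f1, f2, f3, f4) \<in> quads S \<Longrightarrow> leg S (m (f1, f2, f3, f4)) = leg S f3"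
    "\<And>f1 f2 f3 f4. (f1, f2, f3, f4) \<in> quads S \<Longrightarrow> leg' S (m (f1, f2, f3, f4)) = leg' S f3"
    "\<And>f1 f2 f3 f3' f4. \<lbrakk>(f1, f2, f3, f4) \<in> quads S; (f1, f2, f3', f4) \<in> quads S\<rbrakk> \<Longrightarrow>
       m (f1, f2, f3, f4) = m (f1, f2, f3', f4)"
    "\<And>f1 f3 f4. (f1, f1, f3, f4) \<in> quads S \<Longrightarrow> m (f1, f1, f3, f4) = f4"
    "\<And>f1 f2 f3. (f1, f2, f3, f2) \<in> quads S \<Longrightarrow> m (f1, f2, f3, f2) = f1"
    "\<And>f1 f2 f3 f4 f5 f6 f3' f3''.
      \<lbrakk>(f1, f2, f3, f4) \<in> quads S; (m (f1, f2, f3, f4), f5, f3', f6) \<in> quads S;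
      (f4, f5, f3'', f6) \<in> quads S; (f1, f2, f3', m (f4, f5, f3'', f6)) \<in> quads S\<rbrakk> \<Longrightarrow>
       m (m (f1, f2, f3, f4), f5, f3', f6) = m (f1, f2, f3', m (f4, f5, f3'', f6))"
  shows "pseudogroupoid_structure \<sigma> S m"
  unfolding pseudogroupoid_structure_def
  apply (intro conjI allI impI)
  subgoal by (rule assms(1))
  subgoal by (rule assms(2))
  subgoal by (rule assms(3))
  subgoal for f1 f2 f3 f3' f4 using assms(4)[of f1 f2 f3 f4 f3'] by simp
  subgoal for f1 f2 f3 f4 by (elim conjE, hypsubst, rule assms(5))
  subgoal for f1 f2 f3 f4 by (elim conjE, hypsubst, rule assms(6))
  subgoal for f1 f2 f3 f4 f5 f6 f3' f3'' by (elim conjE, rule assms(7))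
  done

lemma alg_hom_carrier:
  assumes "h \<in> alg_hom \<sigma> A B" "a \<in> carrier A"
  shows "h a \<in> carrier B"
  using assms by (auto simp: alg_hom_def)

lemma is_algebraD:
  assumes "is_algebra \<sigma> A" "\<sigma> f = Some (length xs)" "set xs \<subseteq> carrier A"
  shows "opr A f xs \<in> carrier A"
  using assms by (auto simp: is_algebra_def)

lemma pseudogroupoid_structureD:
  assumes "pseudogroupoid_structure \<sigma> S m"
  shows "m \<in> alg_hom \<sigma> (quad_algebra S) (ob1 S)"
    "(f1, f2, f3, f4) \<in> quads S \<Longrightarrow> leg S (m (f1, f2, f3, f4)) = leg S f3"
    "(f1, f2, f3, f4) \<in> quads S \<Longrightarrow> leg' S (m (f1, f2, f3, f4)) = leg' S f3"
    "\<lbrakk>(f1, f2, f3, f4) \<in> quads S; (f1, f2, f3', f4) \<in> quads S\<rbrakk> \<Longrightarrow>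
       m (f1, f2, f3, f4) = m (f1, f2, f3', f4)"
    "(f1, f1, f3, f4) \<in> quads S \<Longrightarrow> m (f1, f1, f3, f4) = f4"
    "(f1, f2, f3, f2) \<in> quads S \<Longrightarrow> m (f1, f2, f3, f2) = f1"
    "\<lbrakk>(f1, f2, f3, f4) \<in> quads S; (m (f1, f2, f3, f4), f5, f3', f6) \<in> quads S;
      (f4, f5, f3'', f6) \<in> quads S; (f1, f2, f3', m (f4, f5, f3'', f6)) \<in> quads S\<rbrakk> \<Longrightarrow>
       m (m (f1, f2, f3, f4), f5, f3', f6) = m (f1, f2, f3', m (f4, f5, f3'', f6))"
proof -
  note p = assms[unfolded pseudogroupoid_structure_def]
  note p2 = p[THEN conjunct2]
  note p3 = p2[THEN conjunct2]
  note p4 = p3[THEN conjunct2]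
  note p5 = p4[THEN conjunct2]
  note p6 = p5[THEN conjunct2]
  show "m \<in> alg_hom \<sigma> (quad_algebra S) (ob1 S)" by (rule p[THEN conjunct1])
  show "(f1, f2, f3, f4) \<in> quads S \<Longrightarrow> leg S (m (f1, f2, f3, f4)) = leg S f3"
    "(f1, f2, f3, f4) \<in> quads S \<Longrightarrow> leg' S (m (f1, f2, f3, f4)) = leg' S f3"
    using p2[THEN conjunct1] by blast+
  show "\<lbrakk>(f1, f2, f3, f4) \<in> quads S; (f1, f2, f3', f4) \<in> quads S\<rbrakk> \<Longrightarrow>
       m (f1, f2, f3, f4) = m (f1, f2, f3', f4)"
    using p3[THEN conjunct1] by blast
  show "(f1, f1, f3, f4) \<in> quads S \<Longrightarrow> m (f1, f1, f3, f4) = f4"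
    using p4[THEN conjunct1] by blast
  show "(f1, f2, f3, f2) \<in> quads S \<Longrightarrow> m (f1, f2, f3, f2) = f1"
    using p5[THEN conjunct1] by blast
  show "\<lbrakk>(f1, f2, f3, f4) \<in> quads S; (m (f1, f2, f3, f4), f5, f3', f6) \<in> quads S;
      (f4, f5, f3'', f6) \<in> quads S; (f1, f2, f3', m (f4, f5, f3'', f6)) \<in> quads S\<rbrakk> \<Longrightarrow>
       m (m (f1, f2, f3, f4), f5, f3', f6) = m (f1, f2, f3', m (f4, f5, f3'', f6))"
    using p6 by blast
qed

lemma trm_val_closed:
  assumes "is_algebra \<sigma> A" "range \<rho> \<subseteq> carrier A" "wf_trm \<sigma> t"
  shows "trm_val A \<rho> t \<in> carrier A"
  using assms(3)
proof (induction t)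
  case (Op f ts)
  then have "set (map (trm_val A \<rho>) ts) \<subseteq> carrier A" by auto
  moreover have "\<sigma> f = Some (length (map (trm_val A \<rho>) ts))" using Op.prems by simp
  ultimately show ?case using assms(1) unfolding is_algebra_def by (metis trm_val.simps(2))
qed (use assms(2) in auto)

lemma trm_val_hom:
  assumes "is_algebra \<sigma> A" "h \<in> alg_hom \<sigma> A B" "range \<rho> \<subseteq> carrier A" "wf_trm \<sigma> t"
  shows "h (trm_val A \<rho> t) = trm_val B (h \<circ> \<rho>) t"
  using assms(4)
proof (induction t)
  case (Op f ts)
  then have 1: "set (map (trm_val A \<rho>) ts) \<subseteq> carrier A"
    using trm_val_closed[OF assms(1,3)] by auto
  have 2: "\<sigma> f = Some (length (map (trm_val A \<rho>) ts))" using Op.prems by simp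
  have "h (trm_val A \<rho> (Op f ts)) = opr B f (map h (map (trm_val A \<rho>) ts))"
    using assms(2) 1 2 unfolding alg_hom_def by auto
  also have "map h (map (trm_val A \<rho>) ts) = map (trm_val B (h \<circ> \<rho>)) ts"
    using Op by (auto simp: o_def)
  finally show ?case by (simp add: o_def)
qed simp

lemma in_variety_hom_image:
  assumes E: "wf_identities \<sigma> E" and A: "in_variety \<sigma> E A"
    and h: "h \<in> alg_hom \<sigma> A B" and surj: "carrier B \<subseteq> h ` carrier A"
  shows "in_variety \<sigma> E B"
proof -
  have algA: "is_algebra \<sigma> A" using A by (simp add: in_variety_def)
  let ?i = "inv_into (carrier A) h"
  have i: "?i b \<in> carrier A" "h (?i b) = b" if "b \<in> carrier B" for b
    using that surj by (auto intro: inv_into_into f_inv_into_f)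
  have "is_algebra \<sigma> B"
    unfolding is_algebra_def
  proof (intro allI impI)
    fix f xs assume *: "\<sigma> f = Some (length xs) \<and> set xs \<subseteq> carrier B"
    have s: "set (map ?i xs) \<subseteq> carrier A" using * i by auto
    have "map h (map ?i xs) = xs" using * i by (auto intro!: map_idI)
    then have "opr B f xs = h (opr A f (map ?i xs))"
      using alg_homD[OF h _ s, of f] * by simp
    moreover have "opr A f (map ?i xs) \<in> carrier A" using algA * s unfolding is_algebra_def by simp
    ultimately show "opr B f xs \<in> carrier B" using h unfolding alg_hom_def by auto
  qed
  moreover have "trm_val B \<rho> s = trm_val B \<rho> t" if st: "(s, t) \<in> E" and r: "range \<rho> \<subseteq> carrier B" for s t \<rho>
  proof -
    have w: "wf_trm \<sigma> s" "wf_trm \<sigma> t" using E st by (auto simp: wf_identities_def)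
    have r': "range (?i \<circ> \<rho>) \<subseteq> carrier A" using r i by auto
    have e: "h \<circ> (?i \<circ> \<rho>) = \<rho>" using r i by (auto simp: fun_eq_iff)
    have "trm_val A (?i \<circ> \<rho>) s = trm_val A (?i \<circ> \<rho>) t"
      using A st r' by (auto simp: in_variety_def)
    then show ?thesis
      using trm_val_hom[OF algA h r' w(1)] trm_val_hom[OF algA h r' w(2)] e by metis
  qed
  ultimately show ?thesis by (auto simp: in_variety_def)
qed

lemma trm_val_carrier_update [simp]: "trm_val (A\<lparr>carrier := U\<rparr>) \<rho> t = trm_val A \<rho> t"
proof (induction t)
  case (Op f ts)
  then have "map (trm_val (A\<lparr>carrier := U\<rparr>) \<rho>) ts = map (trm_val A \<rho>) ts" by simp
  then show ?case by (simp del: map_eq_conv)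
qed simp

lemma in_variety_subalgebra:
  assumes "in_variety \<sigma> E A" "U \<subseteq> carrier A" "is_algebra \<sigma> (A\<lparr>carrier := U\<rparr>)"
  shows "in_variety \<sigma> E (A\<lparr>carrier := U\<rparr>)"
  using assms unfolding in_variety_def by fastforce

lemma is_algebra_hom_image:
  assumes "is_algebra \<sigma> A" "h \<in> alg_hom \<sigma> A B" "U \<subseteq> carrier A" "is_algebra \<sigma> (A\<lparr>carrier := U\<rparr>)"
  shows "is_algebra \<sigma> (B\<lparr>carrier := h ` U\<rparr>)"
  unfolding is_algebra_def
proof (intro allI impI)
  fix f xs assume *: "\<sigma> f = Some (length xs) \<and> set xs \<subseteq> carrier (B\<lparr>carrier := h ` U\<rparr>)"
  let ?ys = "map (inv_into U h) xs"
  have y: "set ?ys \<subseteq> U" "map h ?ys = xs"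
    using * inv_into_into[of _ h U] f_inv_into_f[of _ h U] by (auto intro!: map_idI)
  have "opr B f xs = h (opr A f ?ys)"
    using alg_homD[OF assms(2), of f ?ys] assms(3) * y by simp
  moreover have "opr A f ?ys \<in> U" using assms(4) * y unfolding is_algebra_def by simp
  ultimately show "opr (B\<lparr>carrier := h ` U\<rparr>) f xs \<in> carrier (B\<lparr>carrier := h ` U\<rparr>)" by auto
qed

text \<open>The isomorphic copy of an algebra along a map injective on its carrier.\<close>

definition transport :: "('a \<Rightarrow> 'b) \<Rightarrow> ('f, 'a) ualgebra \<Rightarrow> ('f, 'b) ualgebra" where
  "transport g A = \<lparr>carrier = g ` carrier A,
     opr = (\<lambda>f xs. g (opr A f (map (inv_into (carrier A) g) xs)))\<rparr>"

lemma transport_hom: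
  assumes "inj_on g (carrier A)"
  shows "g \<in> alg_hom \<sigma> A (transport g A)"
  unfolding alg_hom_def
proof (intro CollectI conjI allI impI)
  fix f xs assume *: "\<sigma> f = Some (length xs) \<and> set xs \<subseteq> carrier A"
  have "map (inv_into (carrier A) g) (map g xs) = xs"
    using * assms by (auto intro!: map_idI)
  then show "g (opr A f xs) = opr (transport g A) f (map g xs)" by (simp add: transport_def)
qed (auto simp: transport_def)

lemma transport_inv_hom:
  assumes "inj_on g (carrier A)" "is_algebra \<sigma> A"
  shows "inv_into (carrier A) g \<in> alg_hom \<sigma> (transport g A) A"
  unfolding alg_hom_def
proof (intro CollectI conjI allI impI)
  let ?i = "inv_into (carrier A) g"
  fix f xs assume *: "\<sigma> f = Some (length xs) \<and> set xs \<subseteq> carrier (transport g A)"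
  then have "set (map ?i xs) \<subseteq> carrier A" by (auto simp: transport_def inv_into_into)
  then have "opr A f (map ?i xs) \<in> carrier A" using assms(2) * unfolding is_algebra_def by simp
  then show "?i (opr (transport g A) f xs) = opr A f (map ?i xs)"
    using assms(1) by (simp add: transport_def)
qed (auto simp: transport_def inv_into_into)

lemma in_variety_transport:
  assumes "wf_identities \<sigma> E" "in_variety \<sigma> E A" "inj_on g (carrier A)"
  shows "in_variety \<sigma> E (transport g A)"
  by (rule in_variety_hom_image[OF assms(1,2) transport_hom[OF assms(3)]]) (simp add: transport_def)

lemma alg_hom_comp:
  assumes "h \<in> alg_hom \<sigma> A B" "k \<in> alg_hom \<sigma> B C"
  shows "k \<circ> h \<in> alg_hom \<sigma> A C"
  unfolding alg_hom_def
proof (intro CollectI conjI allI impI)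
  fix f xs assume *: "\<sigma> f = Some (length xs) \<and> set xs \<subseteq> carrier A"
  have "set (map h xs) \<subseteq> carrier B" using alg_hom_carrier[OF assms(1)] * by auto
  then show "(k \<circ> h) (opr A f xs) = opr C f (map (k \<circ> h) xs)"
    using alg_homD[OF assms(1), of f xs] alg_homD[OF assms(2), of f "map h xs"] * by simp
qed (use alg_hom_carrier[OF assms(1)] alg_hom_carrier[OF assms(2)] in auto)

lemma alg_hom_restrict:
  assumes "h \<in> alg_hom \<sigma> A B" "U \<subseteq> carrier A" "h ` U \<subseteq> V"
  shows "h \<in> alg_hom \<sigma> (A\<lparr>carrier := U\<rparr>) (B\<lparr>carrier := V\<rparr>)"
  using assms unfolding alg_hom_def by auto

lemma alg_hom_codomain:
  assumes "h \<in> alg_hom \<sigma> A B" "h ` carrier A \<subseteq> V"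
  shows "h \<in> alg_hom \<sigma> A (B\<lparr>carrier := V\<rparr>)"
  using assms unfolding alg_hom_def by auto

lemma chain_list:
  fixes P :: "nat \<Rightarrow> 'a \<Rightarrow> bool"
  assumes "\<And>n x. P n x \<Longrightarrow> P (Suc n) x" "\<forall>x\<in>set xs. \<exists>n. P n x"
  shows "\<exists>n. \<forall>x\<in>set xs. P n x"
  using assms(2)
proof (induction xs)
  case (Cons a xs)
  then obtain n k where n: "\<forall>x\<in>set xs. P n x" and k: "P k a" by auto
  have mono: "P i x \<Longrightarrow> i \<le> j \<Longrightarrow> P j x" for i j x
    by (induction j) (auto simp: le_Suc_eq assms(1))
  have "\<forall>x\<in>set (a # xs). P (max n k) x"
    using n k mono by (metis max.cobounded1 max.cobounded2 set_ConsD)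
  then show ?case by blast
qed simp

lemma subspan_pseudogroupoid:
  assumes E: "wf_identities \<sigma> E" and T: "span_in_variety \<sigma> E T"
    and m: "pseudogroupoid_structure \<sigma> T m"
    and U: "U \<subseteq> carrier (ob1 T)" "is_algebra \<sigma> ((ob1 T)\<lparr>carrier := U\<rparr>)"
    and mU: "m ` (quads T \<inter> U \<times> U \<times> U \<times> U) \<subseteq> U"
  defines "T' \<equiv> \<lparr>ob0 = (ob0 T)\<lparr>carrier := leg T ` U\<rparr>, ob1 = (ob1 T)\<lparr>carrier := U\<rparr>,
                ob0' = (ob0' T)\<lparr>carrier := leg' T ` U\<rparr>, leg = leg T, leg' = leg' T\<rparr>"
  shows "span_in_variety \<sigma> E T'" "pseudogroupoid_structure \<sigma> T' m"
proof -
  have T1: "is_algebra \<sigma> (ob1 T)" using T by (simp add: span_in_variety_def in_variety_def)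
  have legs: "leg T \<in> alg_hom \<sigma> (ob1 T) (ob0 T)" "leg' T \<in> alg_hom \<sigma> (ob1 T) (ob0' T)"
    using T by (auto simp: span_in_variety_def)
  have sub: "leg T ` U \<subseteq> carrier (ob0 T)" "leg' T ` U \<subseteq> carrier (ob0' T)"
    using alg_hom_carrier[OF legs(1)] alg_hom_carrier[OF legs(2)] U(1) by auto
  show "span_in_variety \<sigma> E T'"
    unfolding span_in_variety_def T'_def
    using T in_variety_subalgebra[OF _ sub(1)] in_variety_subalgebra[OF _ sub(2)]
      in_variety_subalgebra[OF _ U] is_algebra_hom_image[OF T1 legs(1) U]
      is_algebra_hom_image[OF T1 legs(2) U] alg_hom_restrict[OF legs(1) U(1)]
      alg_hom_restrict[OF legs(2) U(1)]
    by (auto simp: span_in_variety_def)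
  have q: "quads T' = quads T \<inter> U \<times> U \<times> U \<times> U"
    using U(1) by (auto simp: quads_def T'_def)
  have "quad_algebra T' = (quad_algebra T)\<lparr>carrier := quads T'\<rparr>"
    by (simp add: quad_algebra_def T'_def)
  then have c1: "m \<in> alg_hom \<sigma> (quad_algebra T') (ob1 T')"
    using alg_hom_restrict[OF pseudogroupoid_structureD(1)[OF m], of "quads T'" U] mU q
    by (simp add: T'_def quad_algebra_def)
  have sub: "qq \<in> quads T" if "qq \<in> quads T'" for qq using that q by blast
  have legs': "leg T' = leg T" "leg' T' = leg' T" by (simp_all add: T'_def)
  note d = pseudogroupoid_structureD[OF m]
  show "pseudogroupoid_structure \<sigma> T' m"
    by (rule pseudogroupoid_structureI, rule c1, unfold legs', (rule d(2); erule sub),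
        (rule d(3); erule sub), (rule d(4); erule sub), (rule d(5); erule sub),
        (rule d(6); erule sub), (rule d(7); erule sub))
qed

lemma transport_span_pseudogroupoid:
  fixes T :: "('f, 'p, 'q, 'r) alg_span"
    and g0 :: "'p \<Rightarrow> 's" and g1 :: "'q \<Rightarrow> 't" and g0' :: "'r \<Rightarrow> 'u"
  assumes E: "wf_identities \<sigma> E" and T: "span_in_variety \<sigma> E T"
    and m: "pseudogroupoid_structure \<sigma> T m"
    and g: "inj_on g0 (carrier (ob0 T))" "inj_on g1 (carrier (ob1 T))" "inj_on g0' (carrier (ob0' T))"
  defines "i \<equiv> inv_into (carrier (ob1 T)) g1"
  defines "T' \<equiv> \<lparr>ob0 = transport g0 (ob0 T), ob1 = transport g1 (ob1 T),
                ob0' = transport g0' (ob0' T), leg = g0 \<circ> leg T \<circ> i, leg' = g0' \<circ> leg' T \<circ> i\<rparr>"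
  shows "span_in_variety \<sigma> E T'" "\<exists>m'. pseudogroupoid_structure \<sigma> T' m'"
    "span_morphism \<sigma> T T' g0 g1 g0'"
proof -
  have T1: "is_algebra \<sigma> (ob1 T)" using T by (simp add: span_in_variety_def in_variety_def)
  have legs: "leg T \<in> alg_hom \<sigma> (ob1 T) (ob0 T)" "leg' T \<in> alg_hom \<sigma> (ob1 T) (ob0' T)"
    using T by (auto simp: span_in_variety_def)
  have ihom: "i \<in> alg_hom \<sigma> (transport g1 (ob1 T)) (ob1 T)"
    unfolding i_def by (rule transport_inv_hom[OF g(2) T1])
  have ig [simp]: "i (g1 a) = a" if "a \<in> carrier (ob1 T)" for a
    using that g(2) by (simp add: i_def)
  show "span_in_variety \<sigma> E T'"
    unfolding span_in_variety_def T'_def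
    using T in_variety_transport[OF E _ g(1)] in_variety_transport[OF E _ g(2)]
      in_variety_transport[OF E _ g(3)]
      alg_hom_comp[OF ihom alg_hom_comp[OF legs(1) transport_hom[OF g(1)]]]
      alg_hom_comp[OF ihom alg_hom_comp[OF legs(2) transport_hom[OF g(3)]]]
    by (auto simp: span_in_variety_def comp_assoc)
  show "span_morphism \<sigma> T T' g0 g1 g0'"
    unfolding span_morphism_def T'_def by (auto simp: transport_hom g)
  define m' where "m' = (\<lambda>(f1, f2, f3, f4). g1 (m (i f1, i f2, i f3, i f4)))"
  have leg: "leg T a \<in> carrier (ob0 T)" "leg' T a \<in> carrier (ob0' T)" if "a \<in> carrier (ob1 T)" for a
    using that legs by (auto simp: alg_hom_def)
  have c1: "carrier (ob1 T') = g1 ` carrier (ob1 T)" by (simp add: T'_def transport_def)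
  have l1: "leg T' f = g0 (leg T (i f))" "leg' T' f = g0' (leg' T (i f))" for f by (simp_all add: T'_def)
  have ic: "i f \<in> carrier (ob1 T)" "g1 (i f) = f" if "f \<in> carrier (ob1 T')" for f
    using that c1 by auto
  have q: "(f1, f2, f3, f4) \<in> quads T' \<longleftrightarrow> f1 \<in> carrier (ob1 T') \<and> f2 \<in> carrier (ob1 T') \<and>
      f3 \<in> carrier (ob1 T') \<and> f4 \<in> carrier (ob1 T') \<and> (i f1, i f2, i f3, i f4) \<in> quads T"
    for f1 f2 f3 f4
    using ic(1) inj_onD[OF g(1)] inj_onD[OF g(3)] leg unfolding quads_def
    by (auto simp: l1)
  have mc: "m qq \<in> carrier (ob1 T)" if "qq \<in> quads T" for qq
    using that pseudogroupoid_structureD(1)[OF m] by (auto simp: alg_hom_def quad_algebra_def)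
  have im: "i (m' (f1, f2, f3, f4)) = m (i f1, i f2, i f3, i f4)"
     if "(f1, f2, f3, f4) \<in> quads T'" for f1 f2 f3 f4
    using that mc q by (simp add: m'_def)
  define i4 where "i4 = (\<lambda>(f1, f2, f3, f4). (i f1, i f2, i f3, i f4))"
  have i4: "i4 \<in> alg_hom \<sigma> (quad_algebra T') (quad_algebra T)"
    unfolding alg_hom_def
  proof (intro CollectI conjI allI impI)
    show "i4 ` carrier (quad_algebra T') \<subseteq> carrier (quad_algebra T)"
      using q by (auto simp: quad_algebra_def i4_def)
    fix f qs assume *: "\<sigma> f = Some (length qs) \<and> set qs \<subseteq> carrier (quad_algebra T')"
    have **: "i (opr (ob1 T') f (map c qs)) = opr (ob1 T) f (map (i \<circ> c) qs)"
      if "\<And>qq. qq \<in> quads T' \<Longrightarrow> c qq \<in> carrier (ob1 T')" for c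
    proof -
      have "set (map c qs) \<subseteq> carrier (transport g1 (ob1 T))"
        using * that by (auto simp: quad_algebra_def T'_def)
      then show ?thesis using ihom * unfolding alg_hom_def T'_def by auto
    qed
    show "i4 (opr (quad_algebra T') f qs) = opr (quad_algebra T) f (map i4 qs)"
      unfolding quad_algebra_def i4_def
      using **[of "\<lambda>(f1, f2, f3, f4). f1"] **[of "\<lambda>(f1, f2, f3, f4). f2"]
        **[of "\<lambda>(f1, f2, f3, f4). f3"] **[of "\<lambda>(f1, f2, f3, f4). f4"]
      by (simp add: q comp_def case_prod_unfold split_paired_all del: split_paired_All)
  qed
  have m'c: "m' = g1 \<circ> (m \<circ> i4)" by (auto simp: m'_def i4_def fun_eq_iff)
  have c1: "m' \<in> alg_hom \<sigma> (quad_algebra T') (ob1 T')"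
    using alg_hom_comp[OF alg_hom_comp[OF i4] transport_hom[OF g(2)], of m]
      pseudogroupoid_structureD(1)[OF m] by (simp add: m'c T'_def)
  have c2: "leg T' (m' (f1, f2, f3, f4)) = leg T' f3" and c3: "leg' T' (m' (f1, f2, f3, f4)) = leg' T' f3"
    if "(f1, f2, f3, f4) \<in> quads T'" for f1 f2 f3 f4
    using pseudogroupoid_structureD(2,3)[OF m] that q im by (simp_all add: l1)
  have c4: "m' (f1, f2, f3, f4) = m' (f1, f2, f3', f4)"
    if "(f1, f2, f3, f4) \<in> quads T'" "(f1, f2, f3', f4) \<in> quads T'" for f1 f2 f3 f3' f4
    using pseudogroupoid_structureD(4)[OF m, of "i f1" "i f2" "i f3" "i f4" "i f3'"] that q
    by (simp add: m'_def)
  have c5: "m' (f1, f2, f3, f4) = f4"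
    if "(f1, f2, f3, f4) \<in> quads T'" "f1 = f2" for f1 f2 f3 f4
    using pseudogroupoid_structureD(5)[OF m] that q ic by (simp add: m'_def)
  have c6: "m' (f1, f2, f3, f4) = f1"
    if "(f1, f2, f3, f4) \<in> quads T'" "f2 = f4" for f1 f2 f3 f4
    using pseudogroupoid_structureD(6)[OF m] that q ic by (simp add: m'_def)
  have c7: "m' (m' (f1, f2, f3, f4), f5, f3', f6) = m' (f1, f2, f3', m' (f4, f5, f3'', f6))"
    if h: "(f1, f2, f3, f4) \<in> quads T'" "(m' (f1, f2, f3, f4), f5, f3', f6) \<in> quads T'"
        "(f4, f5, f3'', f6) \<in> quads T'" "(f1, f2, f3', m' (f4, f5, f3'', f6)) \<in> quads T'"
    for f1 f2 f3 f4 f5 f6 f3' f3''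
  proof -
    have "(i f1, i f2, i f3, i f4) \<in> quads T" "(m (i f1, i f2, i f3, i f4), i f5, i f3', i f6) \<in> quads T"
      "(i f4, i f5, i f3'', i f6) \<in> quads T" "(i f1, i f2, i f3', m (i f4, i f5, i f3'', i f6)) \<in> quads T"
      using h q im by metis+
    then have "m (m (i f1, i f2, i f3, i f4), i f5, i f3', i f6) = m (i f1, i f2, i f3', m (i f4, i f5, i f3'', i f6))"
      by (rule pseudogroupoid_structureD(7)[OF m])
    then show ?thesis using im[OF h(1)] im[OF h(3)] by (simp add: m'_def)
  qed
  have "pseudogroupoid_structure \<sigma> T' m'"
    by (rule pseudogroupoid_structureI, rule c1, (rule c2; assumption), (rule c3; assumption),
        (rule c4; assumption), (rule c5; simp), (rule c6; simp), (rule c7; assumption))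
  then show "\<exists>m'. pseudogroupoid_structure \<sigma> T' m'" by blast
qed

lemma span_morphism_comp:
  assumes "span_morphism \<sigma> S T \<phi>0 \<phi>1 \<phi>0'" "span_morphism \<sigma> T R \<psi>0 \<psi>1 \<psi>0'"
  shows "span_morphism \<sigma> S R (\<psi>0 \<circ> \<phi>0) (\<psi>1 \<circ> \<phi>1) (\<psi>0' \<circ> \<phi>0')"
proof -
  have "\<phi>1 a \<in> carrier (ob1 T)" if "a \<in> carrier (ob1 S)" for a
    using assms(1) that by (auto simp: span_morphism_def alg_hom_def)
  then show ?thesis using assms by (auto simp: span_morphism_def alg_hom_comp)
qed

theorem commutator_all_types:
  fixes A :: "('f, 'a) ualgebra" and T :: "('f, 'p, 'q, 'r) alg_span"
  assumes E: "wf_identities \<sigma> E" and A: "is_algebra \<sigma> A" and T: "span_in_variety \<sigma> E T"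
    and m: "pseudogroupoid_structure \<sigma> T m"
    and \<phi>: "span_morphism \<sigma> (quot_span A x y) T \<phi>0 \<phi>1 \<phi>0'"
    and ab: "(a, b) \<in> commutator \<sigma> E A x y"
  shows "\<phi>1 a = \<phi>1 b"
proof -
  have h: "\<phi>0 \<in> alg_hom \<sigma> (quot_algebra A x) (ob0 T)" "\<phi>1 \<in> alg_hom \<sigma> A (ob1 T)"
    "\<phi>0' \<in> alg_hom \<sigma> (quot_algebra A y) (ob0' T)"
    "\<And>a. a \<in> carrier A \<Longrightarrow> \<phi>0 (x `` {a}) = leg T (\<phi>1 a) \<and> \<phi>0' (y `` {a}) = leg' T (\<phi>1 a)"
    using \<phi> by (auto simp: span_morphism_def quot_span_def)
  have T1: "is_algebra \<sigma> (ob1 T)" using T by (simp add: span_in_variety_def in_variety_def)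
  define B where "B = rec_nat (\<phi>1 ` carrier A) (\<lambda>_ X. m ` (quads T \<inter> X \<times> X \<times> X \<times> X))"
  have B0: "B 0 = \<phi>1 ` carrier A" and BS: "\<And>n. B (Suc n) = m ` (quads T \<inter> B n \<times> B n \<times> B n \<times> B n)"
    by (simp_all add: B_def)
  have mhom: "m \<in> alg_hom \<sigma> (quad_algebra T) (ob1 T)" by (rule pseudogroupoid_structureD(1)[OF m])
  have mc: "m qq \<in> carrier (ob1 T)" if "qq \<in> quads T" for qq
    using that mhom by (auto simp: alg_hom_def quad_algebra_def)
  have Bc: "B n \<subseteq> carrier (ob1 T)" for n
    using h(2) mc by (cases n) (auto simp: B0 BS alg_hom_def)
  have Bmono: "B n \<subseteq> B (Suc n)" for n
  proof
    fix u assume u: "u \<in> B n"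
    then have q: "(u, u, u, u) \<in> quads T" using Bc by (auto simp: quads_def)
    then have "m (u, u, u, u) = u" by (rule pseudogroupoid_structureD(5)[OF m])
    then have "u = m (u, u, u, u)" by simp
    then show "u \<in> B (Suc n)" unfolding BS by (rule image_eqI) (use q u in simp)
  qed
  have qalg: "is_algebra \<sigma> (quad_algebra T)"
    unfolding is_algebra_def
  proof (intro allI impI)
    fix f qs assume *: "\<sigma> f = Some (length qs) \<and> set qs \<subseteq> carrier (quad_algebra T)"
    have legs: "leg T \<in> alg_hom \<sigma> (ob1 T) (ob0 T)" "leg' T \<in> alg_hom \<sigma> (ob1 T) (ob0' T)"
      using T by (auto simp: span_in_variety_def)
    have c: "opr (ob1 T) f (map c qs) \<in> carrier (ob1 T)"
        "leg T (opr (ob1 T) f (map c qs)) = opr (ob0 T) f (map (leg T \<circ> c) qs)"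
        "leg' T (opr (ob1 T) f (map c qs)) = opr (ob0' T) f (map (leg' T \<circ> c) qs)"
      if "\<And>qq. qq \<in> quads T \<Longrightarrow> c qq \<in> carrier (ob1 T)" for c
    proof -
      have s: "set (map c qs) \<subseteq> carrier (ob1 T)" "\<sigma> f = Some (length (map c qs))"
        using * that by (auto simp: quad_algebra_def)
      show "opr (ob1 T) f (map c qs) \<in> carrier (ob1 T)"
        using s T1 unfolding is_algebra_def by blast
      show "leg T (opr (ob1 T) f (map c qs)) = opr (ob0 T) f (map (leg T \<circ> c) qs)"
        "leg' T (opr (ob1 T) f (map c qs)) = opr (ob0' T) f (map (leg' T \<circ> c) qs)"
        using s legs unfolding alg_hom_def by auto
    qed
    have qs: "qq \<in> quads T" if "qq \<in> set qs" for qq using that * by (auto simp: quad_algebra_def)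
    have p1: "(case qq of (f1, f2, f3, f4) \<Rightarrow> f1) \<in> carrier (ob1 T)" if "qq \<in> quads T" for qq
      using that by (auto simp: quads_def)
    have p2: "(case qq of (f1, f2, f3, f4) \<Rightarrow> f2) \<in> carrier (ob1 T)" if "qq \<in> quads T" for qq
      using that by (auto simp: quads_def)
    have p3: "(case qq of (f1, f2, f3, f4) \<Rightarrow> f3) \<in> carrier (ob1 T)" if "qq \<in> quads T" for qq
      using that by (auto simp: quads_def)
    have p4: "(case qq of (f1, f2, f3, f4) \<Rightarrow> f4) \<in> carrier (ob1 T)" if "qq \<in> quads T" for qq
      using that by (auto simp: quads_def)
    show "opr (quad_algebra T) f qs \<in> carrier (quad_algebra T)"
      unfolding quad_algebra_def
      apply (simp add: quads_def[of T])
      using c[of "\<lambda>(f1, f2, f3, f4). f1", OF p1] c[of "\<lambda>(f1, f2, f3, f4). f2", OF p2] c[of "\<lambda>(f1, f2, f3, f4). f3", OF p3] c[of "\<lambda>(f1, f2, f3, f4). f4", OF p4]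
      apply simp
      apply (intro conjI; rule arg_cong[where f = "opr _ f"]; rule map_cong[OF refl])
         apply (drule qs; auto simp: quads_def)+
      done
  qed
  have Balg: "is_algebra \<sigma> ((ob1 T)\<lparr>carrier := B n\<rparr>)" for n
  proof (induction n)
    case 0
    show ?case unfolding B0
      by (rule is_algebra_hom_image[OF A h(2)]) (use A in auto)
  next
    case (Suc n)
    have "is_algebra \<sigma> ((quad_algebra T)\<lparr>carrier := quads T \<inter> B n \<times> B n \<times> B n \<times> B n\<rparr>)"
      unfolding is_algebra_def
    proof (intro allI impI)
      fix f qs
      assume *: "\<sigma> f = Some (length qs) \<and>
        set qs \<subseteq> carrier ((quad_algebra T)\<lparr>carrier := quads T \<inter> B n \<times> B n \<times> B n \<times> B n\<rparr>)"
      then have "opr (quad_algebra T) f qs \<in> quads T"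
        using qalg unfolding is_algebra_def by (auto simp: quad_algebra_def)
      moreover have c: "opr (ob1 T) f (map c qs) \<in> B n"
        if "\<And>qq. qq \<in> B n \<times> B n \<times> B n \<times> B n \<Longrightarrow> c qq \<in> B n" for c
      proof -
        have qs: "qq \<in> B n \<times> B n \<times> B n \<times> B n" if "qq \<in> set qs" for qq
          using * that by (auto simp del: mem_Sigma_iff)
        have "set (map c qs) \<subseteq> B n" using that[OF qs] unfolding set_map by blast
        moreover have "\<sigma> f = Some (length (map c qs))" using * by simp
        ultimately show ?thesis using is_algebraD[OF Suc.IH] by fastforce
      qed
      moreover have "opr (quad_algebra T) f qs \<in> B n \<times> B n \<times> B n \<times> B n"
        unfolding quad_algebra_def by (auto intro!: c)
      ultimately show "opr ((quad_algebra T)\<lparr>carrier := quads T \<inter> B n \<times> B n \<times> B n \<times> B n\<rparr>) f qs \<in>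
         carrier ((quad_algebra T)\<lparr>carrier := quads T \<inter> B n \<times> B n \<times> B n \<times> B n\<rparr>)"
        by simp
    qed
    then show ?case unfolding BS
      by (intro is_algebra_hom_image[OF qalg mhom]) (auto simp: quad_algebra_def)
  qed
  define U where "U = (\<Union>n. B n)"
  have U1: "U \<subseteq> carrier (ob1 T)" using Bc by (auto simp: U_def)
  have U2: "is_algebra \<sigma> ((ob1 T)\<lparr>carrier := U\<rparr>)"
    unfolding is_algebra_def
  proof (intro allI impI)
    fix f xs assume *: "\<sigma> f = Some (length xs) \<and> set xs \<subseteq> carrier ((ob1 T)\<lparr>carrier := U\<rparr>)"
    have "\<exists>n. \<forall>x\<in>set xs. x \<in> B n"
      by (rule chain_list) (use * Bmono in \<open>auto simp: U_def\<close>)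
    then obtain n where "set xs \<subseteq> B n" by blast
    then have "opr (ob1 T) f xs \<in> B n" using Balg[of n] * unfolding is_algebra_def by auto
    then show "opr ((ob1 T)\<lparr>carrier := U\<rparr>) f xs \<in> carrier ((ob1 T)\<lparr>carrier := U\<rparr>)"
      by (auto simp: U_def)
  qed
  have U3: "m ` (quads T \<inter> U \<times> U \<times> U \<times> U) \<subseteq> U"
  proof
    fix u assume "u \<in> m ` (quads T \<inter> U \<times> U \<times> U \<times> U)"
    then obtain f1 f2 f3 f4 where u: "u = m (f1, f2, f3, f4)" "(f1, f2, f3, f4) \<in> quads T"
      "f1 \<in> U" "f2 \<in> U" "f3 \<in> U" "f4 \<in> U" by auto
    have "\<exists>n. \<forall>x\<in>set [f1, f2, f3, f4]. x \<in> B n"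
      by (rule chain_list) (use u Bmono in \<open>auto simp: U_def\<close>)
    then obtain n where "f1 \<in> B n" "f2 \<in> B n" "f3 \<in> B n" "f4 \<in> B n" by auto
    then have "u \<in> B (Suc n)" using u by (auto simp: BS)
    then show "u \<in> U" by (auto simp: U_def)
  qed
  have inf: "infinite (UNIV :: 'a list set)" by (rule infinite_UNIV_listI)
  have "(card_of (carrier A), card_of (UNIV :: 'a list set)) \<in> ordLeq"
    by (rule card_of_ordLeqI[of "\<lambda>a. [a]"]) (auto simp: inj_on_def)
  then have "(card_of (B 0), card_of (UNIV :: 'a list set)) \<in> ordLeq" unfolding B0
    using card_of_image ordLeq_transitive by blast
  then have "(card_of (B n), card_of (UNIV :: 'a list set)) \<in> ordLeq" for n
  proof (induction n)
    case (Suc n)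
    then have IH: "(card_of (B n), card_of (UNIV :: 'a list set)) \<in> ordLeq" by blast
    have t: "(card_of (X \<times> Y), card_of (UNIV :: 'a list set)) \<in> ordLeq"
      if "(card_of X, card_of (UNIV :: 'a list set)) \<in> ordLeq" "(card_of Y, card_of (UNIV :: 'a list set)) \<in> ordLeq" for X :: "'x set" and Y :: "'y set"
      using card_of_Times_ordLeq_infinite_Field[OF _ that card_of_Card_order] inf
      by (simp add: Field_card_of)
    have "(card_of (quads T \<inter> B n \<times> B n \<times> B n \<times> B n), card_of (UNIV :: 'a list set)) \<in> ordLeq"
      using t[OF IH t[OF IH t[OF IH IH]]] card_of_mono1[of "quads T \<inter> B n \<times> B n \<times> B n \<times> B n" "B n \<times> B n \<times> B n \<times> B n"]
        ordLeq_transitive by blast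
    then show ?case unfolding BS using card_of_image ordLeq_transitive by blast
  qed
  moreover have "(card_of (UNIV :: nat set), card_of (UNIV :: 'a list set)) \<in> ordLeq"
    using inf infinite_iff_card_of_nat by blast
  ultimately have cU: "(card_of U, card_of (UNIV :: 'a list set)) \<in> ordLeq"
    unfolding U_def by (intro card_of_UNION_ordLeq_infinite[OF inf]) auto
  have "(card_of (leg T ` U), card_of (UNIV :: 'a list set)) \<in> ordLeq" "(card_of (leg' T ` U), card_of (UNIV :: 'a list set)) \<in> ordLeq"
    using cU card_of_image ordLeq_transitive by blast+
  with cU obtain g0 g1 g0' where
    g: "inj_on (g0 :: 'p \<Rightarrow> 'a list) (leg T ` U)" "inj_on (g1 :: 'q \<Rightarrow> 'a list) U"
       "inj_on (g0' :: 'r \<Rightarrow> 'a list) (leg' T ` U)"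
    unfolding card_of_ordLeq[symmetric] by auto
  define R where "R = \<lparr>ob0 = (ob0 T)\<lparr>carrier := leg T ` U\<rparr>, ob1 = (ob1 T)\<lparr>carrier := U\<rparr>,
                ob0' = (ob0' T)\<lparr>carrier := leg' T ` U\<rparr>, leg = leg T, leg' = leg' T\<rparr>"
  have R: "span_in_variety \<sigma> E R" "pseudogroupoid_structure \<sigma> R m"
    using subspan_pseudogroupoid[OF E T m U1 U2 U3] by (simp_all add: R_def)
  have im1: "\<phi>1 ` carrier A \<subseteq> U" using B0 by (auto simp: U_def)
  then have "\<phi>0 ` (carrier A // x) \<subseteq> leg T ` U" "\<phi>0' ` (carrier A // y) \<subseteq> leg' T ` U"
    using h(4) by (auto elim!: quotientE)
  then have "span_morphism \<sigma> (quot_span A x y) R \<phi>0 \<phi>1 \<phi>0'"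
    unfolding span_morphism_def R_def
    using alg_hom_codomain[OF h(1), of "leg T ` U"] alg_hom_codomain[OF h(2) im1]
      alg_hom_codomain[OF h(3), of "leg' T ` U"] h(4)
    by (auto simp: quot_span_def quot_algebra_def)
  note mor = span_morphism_comp[OF this transport_span_pseudogroupoid(3)[OF E R, of g0 g1 g0']]
  have g': "inj_on g0 (carrier (ob0 R))" "inj_on g1 (carrier (ob1 R))" "inj_on g0' (carrier (ob0' R))"
    using g by (simp_all add: R_def)
  have "(g1 \<circ> \<phi>1) a = (g1 \<circ> \<phi>1) b"
    using ab mor[OF g'] transport_span_pseudogroupoid(1,2)[OF E R g']
    unfolding commutator_def by blast
  moreover have "a \<in> carrier A" "b \<in> carrier A" using ab by (auto simp: commutator_def)
  ultimately show ?thesis using g(2) im1 by (auto dest: inj_onD)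
qed

lemma congruenceI:
  assumes "\<theta> \<subseteq> carrier A \<times> carrier A" "\<And>a. a \<in> carrier A \<Longrightarrow> (a, a) \<in> \<theta>"
    "\<And>a b. (a, b) \<in> \<theta> \<Longrightarrow> (b, a) \<in> \<theta>" "\<And>a b c. \<lbrakk>(a, b) \<in> \<theta>; (b, c) \<in> \<theta>\<rbrakk> \<Longrightarrow> (a, c) \<in> \<theta>"
    "\<And>f xs ys. \<lbrakk>\<sigma> f = Some (length xs); list_all2 (\<lambda>a b. (a, b) \<in> \<theta>) xs ys\<rbrakk> \<Longrightarrow>
       (opr A f xs, opr A f ys) \<in> \<theta>"
  shows "congruence \<sigma> A \<theta>"
  using assms unfolding congruence_def equiv_def refl_on_def sym_def trans_def by blast

lemma congruenceD:
  assumes "congruence \<sigma> A \<theta>"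
  shows "(a, b) \<in> \<theta> \<Longrightarrow> a \<in> carrier A" "(a, b) \<in> \<theta> \<Longrightarrow> b \<in> carrier A"
    "a \<in> carrier A \<Longrightarrow> (a, a) \<in> \<theta>" "(a, b) \<in> \<theta> \<Longrightarrow> (b, a) \<in> \<theta>"
    "\<lbrakk>(a, b) \<in> \<theta>; (b, c) \<in> \<theta>\<rbrakk> \<Longrightarrow> (a, c) \<in> \<theta>"
    "\<lbrakk>\<sigma> f = Some (length xs); list_all2 (\<lambda>a b. (a, b) \<in> \<theta>) xs ys\<rbrakk> \<Longrightarrow> (opr A f xs, opr A f ys) \<in> \<theta>"
  using assms unfolding congruence_def equiv_def refl_on_def sym_def trans_def by blast+

lemma list_all2_set:
  "list_all2 (\<lambda>a b. (a, b) \<in> r) xs ys \<Longrightarrow> r \<subseteq> X \<times> Y \<Longrightarrow> set xs \<subseteq> X \<and> set ys \<subseteq> Y"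
  by (fastforce simp: list_all2_conv_all_nth in_set_conv_nth)

lemma congruence_total: "is_algebra \<sigma> A \<Longrightarrow> congruence \<sigma> A (carrier A \<times> carrier A)"
proof (rule congruenceI)
  fix f xs ys
  assume *: "is_algebra \<sigma> A" "\<sigma> f = Some (length xs)"
    "list_all2 (\<lambda>a b. (a, b) \<in> carrier A \<times> carrier A) xs ys"
  then have "length ys = length xs" by (simp add: list_all2_lengthD)
  then show "(opr A f xs, opr A f ys) \<in> carrier A \<times> carrier A"
    using list_all2_set[OF *(3) subset_refl] is_algebraD[OF *(1), of f xs] is_algebraD[OF *(1), of f ys] *(2)
    by simp
qed auto

lemma congruence_Inter:
  assumes "\<Theta> \<noteq> {}" "\<And>\<theta>. \<theta> \<in> \<Theta> \<Longrightarrow> congruence \<sigma> A \<theta>"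
  shows "congruence \<sigma> A (\<Inter>\<Theta>)"
proof (rule congruenceI)
  obtain \<theta> where "\<theta> \<in> \<Theta>" using assms(1) by blast
  then have "\<theta> \<subseteq> carrier A \<times> carrier A" using assms(2)[of \<theta>] by (simp add: congruence_def equiv_def)
  with \<open>\<theta> \<in> \<Theta>\<close> show "\<Inter>\<Theta> \<subseteq> carrier A \<times> carrier A" by blast
next
  fix f xs ys assume *: "\<sigma> f = Some (length xs)" "list_all2 (\<lambda>a b. (a, b) \<in> \<Inter>\<Theta>) xs ys"
  show "(opr A f xs, opr A f ys) \<in> \<Inter>\<Theta>"
  proof
    fix \<theta> assume "\<theta> \<in> \<Theta>"
    then have "list_all2 (\<lambda>a b. (a, b) \<in> \<theta>) xs ys"
      using list_all2_mono[OF *(2), of "\<lambda>a b. (a, b) \<in> \<theta>"] by simp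
    then show "(opr A f xs, opr A f ys) \<in> \<theta>"
      using congruenceD(6)[OF assms(2)[OF \<open>\<theta> \<in> \<Theta>\<close>] *(1)] by simp
  qed
next
  show "(a, a) \<in> \<Inter>\<Theta>" if "a \<in> carrier A" for a
    using congruenceD(3)[OF assms(2) that] by (rule InterI)
  show "(b, a) \<in> \<Inter>\<Theta>" if "(a, b) \<in> \<Inter>\<Theta>" for a b
    by (rule InterI, rule congruenceD(4)[OF assms(2)], assumption, rule InterD[OF that])
  show "(a, c) \<in> \<Inter>\<Theta>" if "(a, b) \<in> \<Inter>\<Theta>" "(b, c) \<in> \<Inter>\<Theta>" for a b c
    by (rule InterI, rule congruenceD(5)[OF assms(2)], assumption, rule InterD[OF that(1)],
        assumption, rule InterD[OF that(2)])
qed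

lemma Cong_simps [simp]:
  "carrier (Cong \<sigma> A) = {\<theta>. congruence \<sigma> A \<theta>}" "le (Cong \<sigma> A) = (\<subseteq>)" "eq (Cong \<sigma> A) = (=)"
  by (simp_all add: Cong_def)

theorem complete_lattice_Cong:
  fixes A :: "('f, 'a) ualgebra"
  assumes "is_algebra \<sigma> A"
  shows "complete_lattice (Cong \<sigma> A)"
proof -
  interpret partial_order "Cong \<sigma> A"
    by unfold_locales auto
  show ?thesis
  proof (rule complete_lattice_criterion1)
    show "\<exists>g. greatest (Cong \<sigma> A) g (carrier (Cong \<sigma> A))"
      using congruence_total[OF assms] by (auto simp: greatest_def dest: congruenceD(1,2))
  next
    fix \<Theta> assume "\<Theta> \<subseteq> carrier (Cong \<sigma> A)" "\<Theta> \<noteq> {}"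
    then have "greatest (Cong \<sigma> A) (\<Inter>\<Theta>) (Lower (Cong \<sigma> A) \<Theta>)"
      using congruence_Inter[of \<Theta> \<sigma> A] by (auto simp: greatest_def Lower_def)
    then show "\<exists>i. greatest (Cong \<sigma> A) i (Lower (Cong \<sigma> A) \<Theta>)" ..
  qed
qed

lemma quot_algebra_hom:
  assumes "is_algebra \<sigma> A" "congruence \<sigma> A \<theta>"
  shows "(\<lambda>a. \<theta> `` {a}) \<in> alg_hom \<sigma> A (quot_algebra A \<theta>)"
  unfolding alg_hom_def
proof (intro CollectI conjI allI impI)
  show "(\<lambda>a. \<theta> `` {a}) ` carrier A \<subseteq> carrier (quot_algebra A \<theta>)"
    by (auto simp: quot_algebra_def quotient_def)
  fix f xs assume *: "\<sigma> f = Some (length xs) \<and> set xs \<subseteq> carrier A"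
  let ?ys = "map (\<lambda>X. SOME a. a \<in> X) (map (\<lambda>a. \<theta> `` {a}) xs)"
  have "(a, SOME b. b \<in> \<theta> `` {a}) \<in> \<theta>" if "a \<in> set xs" for a
    using someI[of "\<lambda>b. b \<in> \<theta> `` {a}" a] congruenceD(3)[OF assms(2), of a] * that by auto
  then have "list_all2 (\<lambda>a b. (a, b) \<in> \<theta>) xs ?ys"
    by (auto simp: list_all2_conv_all_nth)
  then have "(opr A f xs, opr A f ?ys) \<in> \<theta>" using * congruenceD(6)[OF assms(2)] by blast
  then show "\<theta> `` {opr A f xs} = opr (quot_algebra A \<theta>) f (map (\<lambda>a. \<theta> `` {a}) xs)"
    using assms(2) by (auto simp: quot_algebra_def congruence_def dest: equiv_class_eq)
qed

lemma in_variety_quot_algebra: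
  assumes "wf_identities \<sigma> E" "in_variety \<sigma> E A" "congruence \<sigma> A \<theta>"
  shows "in_variety \<sigma> E (quot_algebra A \<theta>)"
proof (rule in_variety_hom_image[OF assms(1,2) quot_algebra_hom[OF _ assms(3)]])
  show "is_algebra \<sigma> A" using assms(2) by (simp add: in_variety_def)
qed (auto simp: quot_algebra_def quotient_def)

lemma commutatorD:
  fixes A :: "('f, 'a) ualgebra" and T :: "('f, 'a list, 'a list, 'a list) alg_span"
  assumes "(a, b) \<in> commutator \<sigma> E A x y" "span_in_variety \<sigma> E T" "pseudogroupoid_structure \<sigma> T m"
    "span_morphism \<sigma> (quot_span A x y) T \<phi>0 \<phi>1 \<phi>0'"
  shows "\<phi>1 a = \<phi>1 b"
  using assms unfolding commutator_def by blast

lemma commutatorI: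
  fixes A :: "('f, 'a) ualgebra"
  assumes "a \<in> carrier A" "b \<in> carrier A"
    "\<And>(T :: ('f, 'a list, 'a list, 'a list) alg_span) m \<phi>0 \<phi>1 \<phi>0'.
      \<lbrakk>span_in_variety \<sigma> E T; pseudogroupoid_structure \<sigma> T m;
       span_morphism \<sigma> (quot_span A x y) T \<phi>0 \<phi>1 \<phi>0'\<rbrakk> \<Longrightarrow> \<phi>1 a = \<phi>1 b"
  shows "(a, b) \<in> commutator \<sigma> E A x y"
  using assms unfolding commutator_def by blast

lemma congruence_commutator:
  fixes A :: "('f, 'a) ualgebra"
  assumes "is_algebra \<sigma> A"
  shows "congruence \<sigma> A (commutator \<sigma> E A x y)"
proof (rule congruenceI)
  show sub: "commutator \<sigma> E A x y \<subseteq> carrier A \<times> carrier A" by (auto simp: commutator_def)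
  fix f xs ys
  assume f: "\<sigma> f = Some (length xs)"
    and l: "list_all2 (\<lambda>a b. (a, b) \<in> commutator \<sigma> E A x y) xs ys"
  have len: "length ys = length xs" using l by (simp add: list_all2_lengthD)
  have s: "set xs \<subseteq> carrier A" "set ys \<subseteq> carrier A" using list_all2_set[OF l sub] by auto
  show "(opr A f xs, opr A f ys) \<in> commutator \<sigma> E A x y"
  proof (rule commutatorI)
    show "opr A f xs \<in> carrier A" "opr A f ys \<in> carrier A"
      using is_algebraD[OF assms] f len s by simp_all
    fix T :: "('f, 'a list, 'a list, 'a list) alg_span" and m \<phi>0 \<phi>1 \<phi>0'
    assume T: "span_in_variety \<sigma> E T" "pseudogroupoid_structure \<sigma> T m"
       "span_morphism \<sigma> (quot_span A x y) T \<phi>0 \<phi>1 \<phi>0'"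
    then have h: "\<phi>1 \<in> alg_hom \<sigma> A (ob1 T)" by (simp add: span_morphism_def quot_span_def)
    have "map \<phi>1 xs = map \<phi>1 ys"
      using l commutatorD[OF _ T] by (auto simp: list_all2_conv_all_nth list_eq_iff_nth_eq)
    then show "\<phi>1 (opr A f xs) = \<phi>1 (opr A f ys)"
      using alg_homD[OF h, of f xs] alg_homD[OF h, of f ys] f len s by simp
  qed
next
  show "(a, a) \<in> commutator \<sigma> E A x y" if "a \<in> carrier A" for a
    using that by (intro commutatorI) simp_all
  show "(b, a) \<in> commutator \<sigma> E A x y" if "(a, b) \<in> commutator \<sigma> E A x y" for a b
  proof (rule commutatorI)
    show "b \<in> carrier A" "a \<in> carrier A" using that by (auto simp: commutator_def)
  qed (rule commutatorD[OF that, symmetric])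
  show "(a, c) \<in> commutator \<sigma> E A x y"
    if "(a, b) \<in> commutator \<sigma> E A x y" "(b, c) \<in> commutator \<sigma> E A x y" for a b c
  proof (rule commutatorI)
    show "a \<in> carrier A" "c \<in> carrier A" using that by (auto simp: commutator_def)
  qed (rule trans[OF commutatorD[OF that(1)] commutatorD[OF that(2)]])
qed

lemma commutator_subset:
  fixes A :: "('f, 'a) ualgebra"
  assumes E: "wf_identities \<sigma> E" and A: "in_variety \<sigma> E A"
    and xy: "congruence \<sigma> A x" "congruence \<sigma> A y"
  shows "commutator \<sigma> E A x y \<subseteq> x" "commutator \<sigma> E A x y \<subseteq> y"
proof -
  have alg: "is_algebra \<sigma> A" using A by (simp add: in_variety_def)
  define I :: "('f, unit) ualgebra" where "I = \<lparr>carrier = {()}, opr = (\<lambda>_ _. ())\<rparr>"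
  have I: "in_variety \<sigma> E I" by (auto simp: in_variety_def is_algebra_def I_def)
  have toI: "h \<in> alg_hom \<sigma> B I" for h and B :: "('f, 'b) ualgebra" by (auto simp: alg_hom_def I_def)
  have ident: "(\<lambda>u. u) \<in> alg_hom \<sigma> B B" for B :: "('f, 'b) ualgebra" by (auto simp: alg_hom_def)
  define p3 :: "'a set \<times> 'a set \<times> 'a set \<times> 'a set \<Rightarrow> 'a set" where "p3 = (\<lambda>(f1, f2, f3, f4). f3)"
  let ?X = "\<lparr>ob0 = quot_algebra A x, ob1 = quot_algebra A x, ob0' = I, leg = (\<lambda>u. u), leg' = (\<lambda>_. ())\<rparr>"
  let ?Y = "\<lparr>ob0 = I, ob1 = quot_algebra A y, ob0' = quot_algebra A y, leg = (\<lambda>_. ()), leg' = (\<lambda>u. u)\<rparr>"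
  have X: "span_in_variety \<sigma> E ?X" and Y: "span_in_variety \<sigma> E ?Y"
    using in_variety_quot_algebra[OF E A xy(1)] in_variety_quot_algebra[OF E A xy(2)] I
    by (auto simp: span_in_variety_def toI ident)
  have pX: "pseudogroupoid_structure \<sigma> ?X p3"
    by (rule pseudogroupoid_structureI) (auto simp: quads_def p3_def alg_hom_def quad_algebra_def)
  have pY: "pseudogroupoid_structure \<sigma> ?Y p3"
    by (rule pseudogroupoid_structureI) (auto simp: quads_def p3_def alg_hom_def quad_algebra_def)
  have mX: "span_morphism \<sigma> (quot_span A x y) ?X (\<lambda>u. u) (\<lambda>a. x `` {a}) (\<lambda>_. ())"
    using quot_algebra_hom[OF alg xy(1)] by (auto simp: span_morphism_def quot_span_def toI ident)
  have mY: "span_morphism \<sigma> (quot_span A x y) ?Y (\<lambda>_. ()) (\<lambda>a. y `` {a}) (\<lambda>u. u)"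
    using quot_algebra_hom[OF alg xy(2)] by (auto simp: span_morphism_def quot_span_def toI ident)
  show "commutator \<sigma> E A x y \<subseteq> x"
  proof (clarify)
    fix a b assume ab: "(a, b) \<in> commutator \<sigma> E A x y"
    then have "x `` {a} = x `` {b}" by (rule commutator_all_types[OF E alg X pX mX])
    then show "(a, b) \<in> x" using ab xy(1)
      by (auto simp: commutator_def congruence_def dest: eq_equiv_class)
  qed
  show "commutator \<sigma> E A x y \<subseteq> y"
  proof (clarify)
    fix a b assume ab: "(a, b) \<in> commutator \<sigma> E A x y"
    then have "y `` {a} = y `` {b}" by (rule commutator_all_types[OF E alg Y pY mY])
    then show "(a, b) \<in> y" using ab xy(2)
      by (auto simp: commutator_def congruence_def dest: eq_equiv_class)
  qed
qed

lemma Cong_meet: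
  assumes "is_algebra \<sigma> A" "congruence \<sigma> A x" "congruence \<sigma> A y"
  shows "x \<sqinter>\<^bsub>Cong \<sigma> A\<^esub> y = x \<inter> y"
proof -
  interpret complete_lattice "Cong \<sigma> A" by (rule complete_lattice_Cong[OF assms(1)])
  have "congruence \<sigma> A (x \<inter> y)" using congruence_Inter[of "{x, y}" \<sigma> A] assms(2,3) by auto
  then show ?thesis
    using meet_left[of x y] meet_right[of x y] meet_le[of "x \<inter> y" x y] assms(2,3) by auto
qed

lemma congruence_join:
  assumes A: "is_algebra \<sigma> A" and xy: "congruence \<sigma> A x" "congruence \<sigma> A y"
  shows "congruence \<sigma> A ((x \<union> y)\<^sup>+)"
proof (rule congruenceI)
  let ?r = "x O y"
  have "?r \<subseteq> (x \<union> y)\<^sup>+" by (auto intro: trancl_trans r_into_trancl)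
  moreover have "x \<union> y \<subseteq> ?r"
  proof
    fix p assume p: "p \<in> x \<union> y"
    obtain a b where ab: "p = (a, b)" by force
    have "a \<in> carrier A" "b \<in> carrier A"
      using p ab congruenceD(1,2)[OF xy(1)] congruenceD(1,2)[OF xy(2)] by auto
    then have "(a, a) \<in> x" "(b, b) \<in> y" using congruenceD(3)[OF xy(1)] congruenceD(3)[OF xy(2)] by auto
    then show "p \<in> ?r" using p ab by auto
  qed
  ultimately have eq: "(x \<union> y)\<^sup>+ = ?r\<^sup>+"
    by (metis subset_antisym trancl_id trancl_mono_subset trans_trancl)
  have c: "x \<union> y \<subseteq> carrier A \<times> carrier A" using congruenceD(1,2)[OF xy(1)] congruenceD(1,2)[OF xy(2)] by auto
  show sub: "(x \<union> y)\<^sup>+ \<subseteq> carrier A \<times> carrier A" by (rule trancl_subset_Sigma[OF c])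
  show "(a, a) \<in> (x \<union> y)\<^sup>+" if "a \<in> carrier A" for a using congruenceD(3)[OF xy(1) that] by blast
  have "sym (x \<union> y)" using xy by (auto simp: congruence_def equiv_def intro: sym_Un)
  then show "(b, a) \<in> (x \<union> y)\<^sup>+" if "(a, b) \<in> (x \<union> y)\<^sup>+" for a b
    using that by (auto dest: sym_trancl symD)
  show "(a, c) \<in> (x \<union> y)\<^sup>+" if "(a, b) \<in> (x \<union> y)\<^sup>+" "(b, c) \<in> (x \<union> y)\<^sup>+" for a b c
    using that by (rule trancl_trans)
  fix f xs ys
  assume f: "\<sigma> f = Some (length xs)" and l: "list_all2 (\<lambda>a b. (a, b) \<in> (x \<union> y)\<^sup>+) xs ys"
  have compat: "(opr A f us, opr A f vs) \<in> ?r ^^ n"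
    if "list_all2 (\<lambda>a b. (a, b) \<in> ?r ^^ n) us vs" "length us = length xs" "set us \<subseteq> carrier A" for n us vs
    using that
  proof (induction n arbitrary: vs)
    case 0
    then show ?case by (simp add: list_all2_eq[symmetric])
  next
    case (Suc n)
    then have "\<forall>i<length us. \<exists>w v. (us ! i, w) \<in> ?r ^^ n \<and> (w, v) \<in> x \<and> (v, vs ! i) \<in> y"
      by (fastforce simp: list_all2_conv_all_nth)
    then obtain w v where wv: "\<forall>i<length us. (us ! i, w i) \<in> ?r ^^ n \<and> (w i, v i) \<in> x \<and> (v i, vs ! i) \<in> y"
      by metis
    let ?w = "map w [0..<length us]" and ?v = "map v [0..<length us]"
    have len: "length vs = length us" using Suc.prems(1) by (simp add: list_all2_lengthD)
    have "list_all2 (\<lambda>a b. (a, b) \<in> ?r ^^ n) us ?w" "list_all2 (\<lambda>a b. (a, b) \<in> x) ?w ?v"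
      "list_all2 (\<lambda>a b. (a, b) \<in> y) ?v vs"
      using wv len by (auto simp: list_all2_conv_all_nth)
    then have "(opr A f us, opr A f ?w) \<in> ?r ^^ n" "(opr A f ?w, opr A f ?v) \<in> x" "(opr A f ?v, opr A f vs) \<in> y"
      using Suc.IH[of ?w] Suc.prems congruenceD(6)[OF xy(1), of f ?w ?v] congruenceD(6)[OF xy(2), of f ?v vs] f
      by auto
    then show ?case by auto
  qed
  have sx: "set xs \<subseteq> carrier A" using list_all2_set[OF l sub] by simp
  have "\<exists>n. \<forall>p\<in>set (zip xs ys). p \<in> ?r ^^ Suc n"
  proof (rule chain_list)
    show "p \<in> ?r ^^ Suc (Suc n)" if "p \<in> ?r ^^ Suc n" for n p
    proof -
      obtain a b where p: "p = (a, b)" by force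
      have "(a, b) \<in> ?r\<^sup>+" using that p trancl_power by blast
      then have "b \<in> carrier A" using sub eq by auto
      then have "(b, b) \<in> ?r" using congruenceD(3)[OF xy(1)] congruenceD(3)[OF xy(2)] by blast
      then show ?thesis using that p by (metis relpow_Suc_I)
    qed
    show "\<forall>p\<in>set (zip xs ys). \<exists>n. p \<in> ?r ^^ Suc n"
    proof
      fix p assume "p \<in> set (zip xs ys)"
      then have "p \<in> ?r\<^sup>+" using l eq by (auto simp: list_all2_iff)
      then show "\<exists>n. p \<in> ?r ^^ Suc n" by (metis trancl_power gr0_conv_Suc)
    qed
  qed
  then obtain n where "\<forall>p\<in>set (zip xs ys). p \<in> ?r ^^ Suc n" ..
  then have "list_all2 (\<lambda>a b. (a, b) \<in> ?r ^^ Suc n) xs ys"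
    using l unfolding list_all2_iff by auto
  then have "(opr A f xs, opr A f ys) \<in> ?r ^^ Suc n" using compat sx by blast
  then show "(opr A f xs, opr A f ys) \<in> (x \<union> y)\<^sup>+" unfolding eq trancl_power by blast
qed

lemma trancl_incr: "r \<subseteq> r\<^sup>+"
  by auto

lemma Cong_join:
  assumes "is_algebra \<sigma> A" "congruence \<sigma> A x" "congruence \<sigma> A y"
  shows "x \<squnion>\<^bsub>Cong \<sigma> A\<^esub> y = (x \<union> y)\<^sup>+"
proof
  interpret complete_lattice "Cong \<sigma> A" by (rule complete_lattice_Cong[OF assms(1)])
  have c: "x \<squnion>\<^bsub>Cong \<sigma> A\<^esub> y \<in> carrier (Cong \<sigma> A)" using assms by (intro join_closed) auto
  have "x \<union> y \<subseteq> x \<squnion>\<^bsub>Cong \<sigma> A\<^esub> y" using join_left[of x y] join_right[of x y] assms by auto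
  moreover have "trans (x \<squnion>\<^bsub>Cong \<sigma> A\<^esub> y)" using c by (simp add: congruence_def equiv_def)
  ultimately show "(x \<union> y)\<^sup>+ \<subseteq> x \<squnion>\<^bsub>Cong \<sigma> A\<^esub> y" by (metis trancl_id trancl_mono_subset)
  show "x \<squnion>\<^bsub>Cong \<sigma> A\<^esub> y \<subseteq> (x \<union> y)\<^sup>+"
    using join_le[of x "(x \<union> y)\<^sup>+" y] congruence_join[OF assms] assms
      trancl_incr[of "x \<union> y"] by simp
qed

lemma modular_lattice_Cong_iff:
  assumes A: "is_algebra \<sigma> A"
  shows "modular_lattice (Cong \<sigma> A) \<longleftrightarrow>
    (\<forall>x y z. congruence \<sigma> A x \<and> congruence \<sigma> A y \<and> congruence \<sigma> A z \<and> x \<subseteq> z \<longrightarrow>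
       (x \<union> y)\<^sup>+ \<inter> z \<subseteq> (x \<union> (y \<inter> z))\<^sup>+)" (is "_ \<longleftrightarrow> ?R")
proof -
  interpret complete_lattice "Cong \<sigma> A" by (rule complete_lattice_Cong[OF A])
  have lat: "lattice (Cong \<sigma> A)" by unfold_locales
  have "x \<squnion>\<^bsub>Cong \<sigma> A\<^esub> (y \<sqinter>\<^bsub>Cong \<sigma> A\<^esub> z) = (x \<squnion>\<^bsub>Cong \<sigma> A\<^esub> y) \<sqinter>\<^bsub>Cong \<sigma> A\<^esub> z \<longleftrightarrow>
      (x \<union> y)\<^sup>+ \<inter> z \<subseteq> (x \<union> (y \<inter> z))\<^sup>+"
    if c: "congruence \<sigma> A x" "congruence \<sigma> A y" "congruence \<sigma> A z" "x \<subseteq> z" for x y z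
  proof -
    have yz: "congruence \<sigma> A (y \<inter> z)" using congruence_Inter[of "{y, z}" \<sigma> A] c by auto
    have "trans z" using c by (simp add: congruence_def equiv_def)
    then have "(x \<union> (y \<inter> z))\<^sup>+ \<subseteq> z" using c(4) by (metis Un_least inf_le2 trancl_id trancl_mono_subset)
    moreover have "(x \<union> (y \<inter> z))\<^sup>+ \<subseteq> (x \<union> y)\<^sup>+" by (rule trancl_mono_subset) auto
    ultimately show ?thesis
      using c yz congruence_join[OF A c(1,2)] by (auto simp: Cong_join[OF A] Cong_meet[OF A])
  qed
  then show ?thesis unfolding modular_lattice_def using lat by simp blast
qed

lemma trancl_finite_support:
  assumes "(a, b) \<in> r\<^sup>+"
  shows "\<exists>C. finite C \<and> (a, b) \<in> (r \<inter> C \<times> C)\<^sup>+"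
  using assms
proof (induction)
  case (base y)
  then show ?case by (intro exI[of _ "{a, y}"]) auto
next
  case (step y z)
  then obtain C where "finite C" "(a, y) \<in> (r \<inter> C \<times> C)\<^sup>+" by blast
  moreover have "(r \<inter> C \<times> C)\<^sup>+ \<subseteq> (r \<inter> insert y (insert z C) \<times> insert y (insert z C))\<^sup>+"
    by (rule trancl_mono_subset) auto
  ultimately show ?case using step(2)
    by (intro exI[of _ "insert y (insert z C)"]) (auto intro: trancl_into_trancl)
qed

theorem congruence_modular_variety_all_types:
  fixes A :: "('f, 'a) ualgebra"
  assumes mod: "congruence_modular_variety \<sigma> E" and A: "in_variety \<sigma> E A"
  shows "modular_lattice (Cong \<sigma> A)"
proof -
  have E: "wf_identities \<sigma> E" using mod by (simp add: congruence_modular_variety_def)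
  have alg: "is_algebra \<sigma> A" using A by (simp add: in_variety_def)
  show ?thesis
    unfolding modular_lattice_Cong_iff[OF alg]
  proof (intro allI impI subrelI, elim conjE IntE)
    fix x y z a b
    assume c: "congruence \<sigma> A x" "congruence \<sigma> A y" "congruence \<sigma> A z" and xz: "x \<subseteq> z"
      and ab: "(a, b) \<in> (x \<union> y)\<^sup>+" and abz: "(a, b) \<in> z"
    obtain C0 where C0: "finite C0" "(a, b) \<in> ((x \<union> y) \<inter> C0 \<times> C0)\<^sup>+"
      using trancl_finite_support[OF ab] by blast
    have xyA: "x \<union> y \<subseteq> carrier A \<times> carrier A"
      using congruenceD(1,2)[OF c(1)] congruenceD(1,2)[OF c(2)] by auto
    define C where "C = insert a (C0 \<inter> carrier A)"
    have aA: "a \<in> carrier A" using congruenceD(1)[OF c(3) abz] .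
    have C: "finite C" "C \<noteq> {}" "C \<subseteq> carrier A" using C0 aA by (auto simp: C_def)
    have "(x \<union> y) \<inter> C0 \<times> C0 \<subseteq> (x \<union> y) \<inter> C \<times> C" using xyA by (auto simp: C_def)
    then have abC: "(a, b) \<in> ((x \<union> y) \<inter> C \<times> C)\<^sup>+" using C0(2) trancl_mono_subset by blast
    have "\<exists>\<rho> :: nat \<Rightarrow> 'a. range \<rho> = C"
      using C by (metis countable_finite range_from_nat_into)
    then obtain \<rho> :: "nat \<Rightarrow> 'a" where \<rho>: "range \<rho> = C" ..
    define W :: "('f, nat) trm set" where "W = {t. wf_trm \<sigma> t}"
    define S where "S = trm_val A \<rho> ` W"
    have SA: "S \<subseteq> carrier A" using trm_val_closed[OF alg] \<rho> C(3) by (auto simp: S_def W_def)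
    have CS: "C \<subseteq> S"
    proof
      fix c assume "c \<in> C"
      then obtain n where "c = \<rho> n" using \<rho> by blast
      then show "c \<in> S" unfolding S_def W_def by (intro image_eqI[of _ _ "Var n"]) auto
    qed
    define g where "g = inv_into W (trm_val A \<rho>)"
    have gW: "g s \<in> W" "trm_val A \<rho> (g s) = s" if "s \<in> S" for s
      using that unfolding g_def S_def by (auto intro: inv_into_into f_inv_into_f)
    have ginj: "inj_on g S" using gW by (metis inj_onI)
    have Salg: "is_algebra \<sigma> (A\<lparr>carrier := S\<rparr>)"
      unfolding is_algebra_def
    proof (intro allI impI)
      fix f xs assume *: "\<sigma> f = Some (length xs) \<and> set xs \<subseteq> carrier (A\<lparr>carrier := S\<rparr>)"
      then have "Op f (map g xs) \<in> W" using gW by (auto simp: W_def)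
      moreover have "map (trm_val A \<rho>) (map g xs) = xs" using * gW by (auto intro!: map_idI)
      then have "opr A f xs = trm_val A \<rho> (Op f (map g xs))" by (simp del: map_map)
      ultimately have "opr A f xs \<in> S" unfolding S_def by (rule rev_image_eqI)
      then show "opr (A\<lparr>carrier := S\<rparr>) f xs \<in> carrier (A\<lparr>carrier := S\<rparr>)" by simp
    qed
    have SV: "in_variety \<sigma> E (A\<lparr>carrier := S\<rparr>)" by (rule in_variety_subalgebra[OF A SA Salg])
    define D where "D = transport g (A\<lparr>carrier := S\<rparr>)"
    have ginj': "inj_on g (carrier (A\<lparr>carrier := S\<rparr>))" using ginj by simp
    have DV: "in_variety \<sigma> E D" unfolding D_def by (rule in_variety_transport[OF E SV ginj'])
    then have Dalg: "is_algebra \<sigma> D" by (simp add: in_variety_def)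
    define k where "k = inv_into S g"
    have k: "k \<in> alg_hom \<sigma> D (A\<lparr>carrier := S\<rparr>)"
      using transport_inv_hom[OF ginj' Salg] by (simp add: D_def k_def)
    have kg: "k (g s) = s" if "s \<in> S" for s using that ginj by (simp add: k_def)
    have gD: "g s \<in> carrier D" if "s \<in> S" for s using that by (simp add: D_def transport_def)
    have kS: "k u \<in> S" if "u \<in> carrier D" for u using alg_hom_carrier[OF k that] by simp
    define P where "P = (\<lambda>r. {(u, v) \<in> carrier D \<times> carrier D. (k u, k v) \<in> r})"
    have P: "congruence \<sigma> D (P r)" if r: "congruence \<sigma> A r" for r
    proof (rule congruenceI)
      fix f us vs
      assume f: "\<sigma> f = Some (length us)" and l: "list_all2 (\<lambda>a b. (a, b) \<in> P r) us vs"
      have s: "set us \<subseteq> carrier D" "set vs \<subseteq> carrier D"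
        using list_all2_set[OF l, of "carrier D" "carrier D"] by (auto simp: P_def)
      have len: "length vs = length us" using l by (simp add: list_all2_lengthD)
      have "list_all2 (\<lambda>a b. (a, b) \<in> r) (map k us) (map k vs)"
        using l by (auto simp: list_all2_conv_all_nth P_def)
      then have "(opr A f (map k us), opr A f (map k vs)) \<in> r"
        using congruenceD(6)[OF r] f by simp
      then show "(opr D f us, opr D f vs) \<in> P r"
        using alg_homD[OF k, of f us] alg_homD[OF k, of f vs] is_algebraD[OF Dalg, of f us]
          is_algebraD[OF Dalg, of f vs] f s len by (simp add: P_def)
    next
      show "(u, u) \<in> P r" if "u \<in> carrier D" for u
        using that kS[OF that] SA congruenceD(3)[OF r] by (auto simp: P_def)
    next
      show "(v, u) \<in> P r" if "(u, v) \<in> P r" for u v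
        using that congruenceD(4)[OF r] by (auto simp: P_def)
    next
      show "(u, w) \<in> P r" if "(u, v) \<in> P r" "(v, w) \<in> P r" for u v w
        using that congruenceD(5)[OF r] unfolding P_def by blast
    qed (auto simp: P_def)
    have gC: "g u \<in> carrier D" "k (g u) = u" if "u \<in> C" for u
      using that CS gD kg by auto
    have push: "(g u, g v) \<in> (P x \<union> P y)\<^sup>+" if "(u, v) \<in> ((x \<union> y) \<inter> C \<times> C)\<^sup>+" for u v
      using that
    proof induction
      case (base v)
      then show ?case using gC by (intro r_into_trancl) (auto simp: P_def)
    next
      case (step v w)
      then have "(g v, g w) \<in> P x \<union> P y" using gC by (auto simp: P_def)
      with step.IH show ?case by (rule trancl_into_trancl)
    qed
    have bS: "b \<in> S"
    proof -
      have "(a, b) \<in> C \<times> C" using abC trancl_subset_Sigma[of "(x \<union> y) \<inter> C \<times> C" C] by blast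
      then show ?thesis using CS by blast
    qed
    have aS: "a \<in> S" using CS by (auto simp: C_def)
    have "modular_lattice (Cong \<sigma> D)"
      using mod DV unfolding congruence_modular_variety_def by blast
    moreover have "P x \<subseteq> P z" using xz by (auto simp: P_def)
    moreover have "(g a, g b) \<in> P z" using aS bS abz by (auto simp: P_def gD kg)
    ultimately have "(g a, g b) \<in> (P x \<union> (P y \<inter> P z))\<^sup>+"
      using push[OF abC] P[OF c(1)] P[OF c(2)] P[OF c(3)]
      unfolding modular_lattice_Cong_iff[OF Dalg] by blast
    moreover have "(k u, k v) \<in> (x \<union> (y \<inter> z))\<^sup>+" if "(u, v) \<in> (P x \<union> (P y \<inter> P z))\<^sup>+" for u v
      using that
    proof induction
      case (base v)
      then show ?case by (intro r_into_trancl) (auto simp: P_def)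
    next
      case (step v w)
      then have "(k v, k w) \<in> x \<union> (y \<inter> z)" by (auto simp: P_def)
      with step.IH show ?case by (rule trancl_into_trancl)
    qed
    ultimately show "(a, b) \<in> (x \<union> (y \<inter> z))\<^sup>+" using kg aS bS by metis
  qed
qed

section \<open>The multiplicative lattice of congruences and the Zariski topology\<close>

theorem complete_multiplicative_lattice_Cong:
  assumes E: "wf_identities \<sigma> E" and A: "in_variety \<sigma> E A"
  shows "complete_multiplicative_lattice (Cong_mult \<sigma> E A)"
proof -
  have alg: "is_algebra \<sigma> A" using A by (simp add: in_variety_def)
  have *: "carrier (Cong_mult \<sigma> E A) = carrier (Cong \<sigma> A)" "le (Cong_mult \<sigma> E A) = le (Cong \<sigma> A)"
    "eq (Cong_mult \<sigma> E A) = eq (Cong \<sigma> A)"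
    by (simp_all add: Cong_mult_def)
  interpret C: complete_lattice "Cong \<sigma> A" by (rule complete_lattice_Cong[OF alg])
  have L: "Lower (Cong_mult \<sigma> E A) = Lower (Cong \<sigma> A)" "Upper (Cong_mult \<sigma> E A) = Upper (Cong \<sigma> A)"
    "greatest (Cong_mult \<sigma> E A) = greatest (Cong \<sigma> A)" "least (Cong_mult \<sigma> E A) = least (Cong \<sigma> A)"
    by (simp_all add: fun_eq_iff Lower_def Upper_def greatest_def least_def *)
  interpret M: complete_lattice "Cong_mult \<sigma> E A"
    by unfold_locales (use C.sup_exists C.inf_exists in \<open>auto simp: * L\<close>)
  have meet: "meet (Cong_mult \<sigma> E A) = meet (Cong \<sigma> A)"
    by (simp add: fun_eq_iff meet_def inf_def L)
  show ?thesis
  proof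
    fix x y assume "x \<in> carrier (Cong_mult \<sigma> E A)" "y \<in> carrier (Cong_mult \<sigma> E A)"
    then have c: "congruence \<sigma> A x" "congruence \<sigma> A y" by (simp_all add: *)
    show "lprod (Cong_mult \<sigma> E A) x y \<in> carrier (Cong_mult \<sigma> E A)"
      using congruence_commutator[OF alg] by (simp add: Cong_mult_def)
    have "commutator \<sigma> E A x y \<subseteq> x \<sqinter>\<^bsub>Cong \<sigma> A\<^esub> y"
      using commutator_subset[OF E A c] Cong_meet[OF alg c] by simp
    then show "lprod (Cong_mult \<sigma> E A) x y \<sqsubseteq>\<^bsub>Cong_mult \<sigma> E A\<^esub> x \<sqinter>\<^bsub>Cong_mult \<sigma> E A\<^esub> y"
      by (simp add: meet *) (simp add: Cong_mult_def)
  qed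
qed

context complete_multiplicative_lattice
begin

lemma zariski_closed_prod:
  assumes "x \<in> carrier L" "y \<in> carrier L"
  shows "zariski_closed L (lprod L x y) = zariski_closed L x \<union> zariski_closed L y"
proof -
  have xy: "lprod L x y \<in> carrier L" "lprod L x y \<sqsubseteq> x" "lprod L x y \<sqsubseteq> y"
    using lprod_closed lprod_le_meet le_trans[OF _ meet_left] le_trans[OF _ meet_right] assms meet_closed
    by metis+
  show ?thesis
    using assms xy by (auto simp: zariski_closed_def Spec_def prime_element_def intro: le_trans)
qed

lemma istopology_zariski:
  "istopology (\<lambda>U. \<exists>x\<in>carrier L. U = Spec L - zariski_closed L x)"
  unfolding istopology_def
proof (intro conjI allI impI)
  fix U V
  assume "\<exists>x\<in>carrier L. U = Spec L - zariski_closed L x" "\<exists>x\<in>carrier L. V = Spec L - zariski_closed L x"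
  then obtain x y where "x \<in> carrier L" "y \<in> carrier L" "U = Spec L - zariski_closed L x"
    "V = Spec L - zariski_closed L y" by blast
  then show "\<exists>x\<in>carrier L. U \<inter> V = Spec L - zariski_closed L x"
    using zariski_closed_prod lprod_closed by (intro bexI[of _ "lprod L x y"]) auto
next
  fix K assume K: "\<forall>U\<in>K. \<exists>x\<in>carrier L. U = Spec L - zariski_closed L x"
  define X where "X = {x \<in> carrier L. Spec L - zariski_closed L x \<in> K}"
  have X: "X \<subseteq> carrier L" by (auto simp: X_def)
  have "\<Squnion>X \<sqsubseteq> p \<longleftrightarrow> (\<forall>x\<in>X. x \<sqsubseteq> p)" if "p \<in> Spec L" for p
  proof
    have p: "p \<in> carrier L" using that by (simp add: Spec_def prime_element_def)
    show "\<forall>x\<in>X. x \<sqsubseteq> p" if "\<Squnion>X \<sqsubseteq> p"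
      using le_trans[OF sup_upper[OF X] that _ sup_closed[OF X] p] X by blast
    show "\<Squnion>X \<sqsubseteq> p" if "\<forall>x\<in>X. x \<sqsubseteq> p"
      using that p by (intro sup_least[OF X]) (auto simp: Upper_def)
  qed
  then have "\<Union>K = Spec L - zariski_closed L (\<Squnion>X)"
    using K by (auto simp: zariski_closed_def X_def)
  then show "\<exists>x\<in>carrier L. \<Union>K = Spec L - zariski_closed L x" using sup_closed[OF X] by blast
qed

theorem openin_zariski:
  "openin (zariski L) U \<longleftrightarrow> (\<exists>x\<in>carrier L. U = Spec L - zariski_closed L x)"
  unfolding zariski_def by (simp add: topology_inverse' istopology_zariski)

theorem topspace_zariski: "topspace (zariski L) = Spec L"
proof
  show "topspace (zariski L) \<subseteq> Spec L" by (auto simp: topspace_def openin_zariski)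
  have "Spec L = Spec L - zariski_closed L \<top>"
    by (auto simp: zariski_closed_def Spec_def prime_element_def intro: top_higher le_antisym)
  then have "openin (zariski L) (Spec L)" unfolding openin_zariski using top_closed by blast
  then show "Spec L \<subseteq> topspace (zariski L)" by (rule openin_subset)
qed

theorem closedin_zariski:
  "closedin (zariski L) C \<longleftrightarrow> (\<exists>x\<in>carrier L. C = zariski_closed L x)"
proof -
  have sub: "zariski_closed L x \<subseteq> Spec L" for x by (auto simp: zariski_closed_def)
  have "Spec L - C = Spec L - zariski_closed L x \<longleftrightarrow> C = zariski_closed L x" if "C \<subseteq> Spec L" for x
    using that sub[of x] by blast
  then show ?thesis
    unfolding closedin_def topspace_zariski openin_zariski using sub by blast
qed

end

end

theory Submission
  imports Defs
begin

text \<open>The spectrum is always sober. Compactness of the basic open sets needs enough primes: if \<open>k\<close> is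
  compact and no iterated square of \<open>k\<close> lies below \<open>a\<close>, then an element \<open>p \<ge> a\<close> that is maximal without
  an iterated square of \<open>k\<close> below it is prime, because \<open>xy \<le> p\<close> implies \<open>(p \<or> x)(p \<or> y) \<le> p\<close> for the
  commutator of a congruence modular variety.

  To see the latter, consider the squares generated by trivial ones whose rows are in \<open>x\<close> and columns in
  \<open>y\<close>. The value of a pseudogroupoid operation on such a square is its third entry. Hence the term
  condition holds modulo the commutator in both directions, by Day's terms also modulo \<open>p\<close>, and it
  survives closing the set of squares under \<open>p\<close> and under compositions. The closure \<open>M\<close> contains the
  trivial squares for \<open>p \<or> x\<close> and \<open>p \<or> y\<close>. Modulo \<open>p\<close>, a square in \<open>M\<close> is determined by its entries other
  than the third one, and these can be prescribed because of Gumm's difference term. So \<open>M\<close> is the graph of a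
  pseudogroupoid operation on \<open>A/p\<close>. That the test spans range over a variety which need not be modular
  does not matter, since modularity is used only for subalgebras of powers of \<open>A\<close>.\<close>

section \<open>Quaternary term operations\<close>

text \<open>The commutator is an intersection of kernels. Knowing \<open>xy \<le> p\<close>
  therefore allows arbitrary pseudogroupoids to be evaluated, but the bound on the product of the
  two joins has to be witnessed by one explicit test span. Its middle algebra is \<open>A/p\<close>,
  because the kernel of the quotient map is exactly \<open>p\<close>. The obstacle is the domain of
  the operation: it must be defined on all squares with rows in one join and columns in the other,
  while the available squares are only generated ones. Joins are transitive closures, and a trivial
  square over a chain is pasted from the trivial squares over its links; this is why compositions
  are adjoined. The same pasting later gives the associative law. A missing corner is a question
  about columns. It is answered in the algebra whose elements are the columns, so Day's terms and
  the difference term are developed for an arbitrary algebra of a modular variety and used for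
  \<open>A\<close> as well as for that algebra of pairs.\<close>

definition valuation4 :: "'a \<Rightarrow> 'a \<Rightarrow> 'a \<Rightarrow> 'a \<Rightarrow> nat \<Rightarrow> 'a" where
  "valuation4 a b c d n = (if n = 0 then a else if n = 1 then b else if n = 2 then c else d)"

lemma valuation4_simps [simp]:
  "valuation4 a b c d 0 = a" "valuation4 a b c d (Suc 0) = b" "valuation4 a b c d 2 = c"
  "valuation4 a b c d 3 = d"
  by (simp_all add: valuation4_def)

lemma valuation4_cases:
  "P a \<Longrightarrow> P b \<Longrightarrow> P c \<Longrightarrow> P d \<Longrightarrow> P (valuation4 a b c d n)"
  by (simp add: valuation4_def)

text \<open>Only values on the carrier are constrained. The term may contain any variables:
  \<open>valuation4\<close> gives the fourth argument to all indices from 3 on, so assignments never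
  leave the carrier.\<close>

definition term_op4 ::
  "'f signature \<Rightarrow> ('f, 'a) ualgebra \<Rightarrow> ('a \<Rightarrow> 'a \<Rightarrow> 'a \<Rightarrow> 'a \<Rightarrow> 'a) \<Rightarrow> bool" where
  "term_op4 \<sigma> D m \<longleftrightarrow> (\<exists>t. wf_trm \<sigma> t \<and> (\<forall>a\<in>carrier D. \<forall>b\<in>carrier D. \<forall>c\<in>carrier D. \<forall>d\<in>carrier D.
     m a b c d = trm_val D (valuation4 a b c d) t))"

lemma term_op4_proj:
  "term_op4 \<sigma> D (\<lambda>a b c d. a)" "term_op4 \<sigma> D (\<lambda>a b c d. b)"
  "term_op4 \<sigma> D (\<lambda>a b c d. c)" "term_op4 \<sigma> D (\<lambda>a b c d. d)"
  unfolding term_op4_def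
  by (rule exI[of _ "Var 0"], simp, rule exI[of _ "Var (Suc 0)"], simp,
      rule exI[of _ "Var 2"], simp, rule exI[of _ "Var 3"], simp)

lemma term_op4_closed:
  assumes "is_algebra \<sigma> D" "term_op4 \<sigma> D m"
    "a \<in> carrier D" "b \<in> carrier D" "c \<in> carrier D" "d \<in> carrier D"
  shows "m a b c d \<in> carrier D"
proof -
  obtain t where t: "wf_trm \<sigma> t" "m a b c d = trm_val D (valuation4 a b c d) t"
    using assms unfolding term_op4_def by blast
  have "range (valuation4 a b c d) \<subseteq> carrier D"
    using assms valuation4_cases[of "\<lambda>x. x \<in> carrier D"] by auto
  then show ?thesis using trm_val_closed[OF assms(1) _ t(1)] t(2) by simp
qed

fun trm_subst :: "('v \<Rightarrow> ('f, 'w) trm) \<Rightarrow> ('f, 'v) trm \<Rightarrow> ('f, 'w) trm" where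
  "trm_subst s (Var v) = s v"
| "trm_subst s (Op f ts) = Op f (map (trm_subst s) ts)"

lemma wf_trm_subst: "wf_trm \<sigma> t \<Longrightarrow> (\<And>v. wf_trm \<sigma> (s v)) \<Longrightarrow> wf_trm \<sigma> (trm_subst s t)"
  by (induction t) auto

lemma trm_val_subst: "trm_val D \<rho> (trm_subst s t) = trm_val D (\<lambda>v. trm_val D \<rho> (s v)) t"
  by (induction t) (auto simp: o_def cong: map_cong)

lemma term_op4_comp:
  assumes D: "is_algebra \<sigma> D" and m: "term_op4 \<sigma> D m"
    and g: "term_op4 \<sigma> D g1" "term_op4 \<sigma> D g2" "term_op4 \<sigma> D g3" "term_op4 \<sigma> D g4"
  shows "term_op4 \<sigma> D (\<lambda>a b c d. m (g1 a b c d) (g2 a b c d) (g3 a b c d) (g4 a b c d))"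
proof -
  obtain t where t: "wf_trm \<sigma> t" "\<And>a b c d. \<lbrakk>a \<in> carrier D; b \<in> carrier D; c \<in> carrier D; d \<in> carrier D\<rbrakk> \<Longrightarrow>
     m a b c d = trm_val D (valuation4 a b c d) t"
    using m unfolding term_op4_def by blast
  obtain s1 where s1: "wf_trm \<sigma> s1" "\<And>a b c d. \<lbrakk>a \<in> carrier D; b \<in> carrier D; c \<in> carrier D; d \<in> carrier D\<rbrakk> \<Longrightarrow>
     g1 a b c d = trm_val D (valuation4 a b c d) s1"
    using g(1) unfolding term_op4_def by blast
  obtain s2 where s2: "wf_trm \<sigma> s2" "\<And>a b c d. \<lbrakk>a \<in> carrier D; b \<in> carrier D; c \<in> carrier D; d \<in> carrier D\<rbrakk> \<Longrightarrow>
     g2 a b c d = trm_val D (valuation4 a b c d) s2"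
    using g(2) unfolding term_op4_def by blast
  obtain s3 where s3: "wf_trm \<sigma> s3" "\<And>a b c d. \<lbrakk>a \<in> carrier D; b \<in> carrier D; c \<in> carrier D; d \<in> carrier D\<rbrakk> \<Longrightarrow>
     g3 a b c d = trm_val D (valuation4 a b c d) s3"
    using g(3) unfolding term_op4_def by blast
  obtain s4 where s4: "wf_trm \<sigma> s4" "\<And>a b c d. \<lbrakk>a \<in> carrier D; b \<in> carrier D; c \<in> carrier D; d \<in> carrier D\<rbrakk> \<Longrightarrow>
     g4 a b c d = trm_val D (valuation4 a b c d) s4"
    using g(4) unfolding term_op4_def by blast
  show ?thesis
    unfolding term_op4_def
  proof (intro exI[of _ "trm_subst (valuation4 s1 s2 s3 s4) t"] conjI ballI)
    show "wf_trm \<sigma> (trm_subst (valuation4 s1 s2 s3 s4) t)"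
      by (rule wf_trm_subst[OF t(1)]) (simp add: valuation4_def s1 s2 s3 s4)
    fix a b c d assume c: "a \<in> carrier D" "b \<in> carrier D" "c \<in> carrier D" "d \<in> carrier D"
    have "(\<lambda>v. trm_val D \<rho> (valuation4 s1 s2 s3 s4 v)) =
        valuation4 (trm_val D \<rho> s1) (trm_val D \<rho> s2) (trm_val D \<rho> s3) (trm_val D \<rho> s4)" for \<rho>
      by (auto simp: valuation4_def fun_eq_iff)
    then show "m (g1 a b c d) (g2 a b c d) (g3 a b c d) (g4 a b c d) =
        trm_val D (valuation4 a b c d) (trm_subst (valuation4 s1 s2 s3 s4) t)"
      using t(2)[OF term_op4_closed[OF D g(1) c] term_op4_closed[OF D g(2) c]
          term_op4_closed[OF D g(3) c] term_op4_closed[OF D g(4) c]]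
      by (simp add: trm_val_subst s1(2)[OF c] s2(2)[OF c] s3(2)[OF c] s4(2)[OF c])
  qed
qed

section \<open>Day's terms\<close>

locale modular_algebra =
  fixes \<sigma> :: "'f signature" and E :: "'f identities" and D :: "('f, 'a) ualgebra"
  assumes modular: "congruence_modular_variety \<sigma> E" and in_variety: "in_variety \<sigma> E D"
begin

lemma algebra: "is_algebra \<sigma> D"
  using in_variety by (simp add: in_variety_def)

definition in_carrier4 :: "'a \<Rightarrow> 'a \<Rightarrow> 'a \<Rightarrow> 'a \<Rightarrow> bool" where
  "in_carrier4 a b c d \<longleftrightarrow> a \<in> carrier D \<and> b \<in> carrier D \<and> c \<in> carrier D \<and> d \<in> carrier D"

text \<open>Fixing the values off the carrier makes equality of functions the same as equality of
  term operations, so that identities can hold in an algebra of functions.\<close>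

definition restr4 :: "('a \<Rightarrow> 'a \<Rightarrow> 'a \<Rightarrow> 'a \<Rightarrow> 'a) \<Rightarrow> ('a \<Rightarrow> 'a \<Rightarrow> 'a \<Rightarrow> 'a \<Rightarrow> 'a)" where
  "restr4 m = (\<lambda>a b c d. if in_carrier4 a b c d then m a b c d else undefined)"

lemma restr4: "in_carrier4 a b c d \<Longrightarrow> restr4 m a b c d = m a b c d"
  by (simp add: restr4_def)

text \<open>The free algebra on four generators, in the variety generated by \<open>D\<close>.\<close>

definition free4 :: "('f, 'a \<Rightarrow> 'a \<Rightarrow> 'a \<Rightarrow> 'a \<Rightarrow> 'a) ualgebra" where
  "free4 = \<lparr>carrier = restr4 ` {m. term_op4 \<sigma> D m},
     opr = (\<lambda>f ms. restr4 (\<lambda>a b c d. opr D f (map (\<lambda>m. m a b c d) ms)))\<rparr>"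

lemma term_op4_cong:
  assumes "term_op4 \<sigma> D m" "\<And>a b c d. in_carrier4 a b c d \<Longrightarrow> m a b c d = m' a b c d"
  shows "term_op4 \<sigma> D m'"
  using assms unfolding term_op4_def in_carrier4_def by metis

lemma term_op4_restr4: "term_op4 \<sigma> D m \<Longrightarrow> term_op4 \<sigma> D (restr4 m)"
  by (erule term_op4_cong) (simp add: restr4)

lemma carrier_free4: "m \<in> carrier free4 \<longleftrightarrow> term_op4 \<sigma> D m \<and> restr4 m = m"
proof
  assume "m \<in> carrier free4"
  then show "term_op4 \<sigma> D m \<and> restr4 m = m"
    by (auto simp: free4_def term_op4_restr4) (simp add: restr4_def fun_eq_iff)
next
  assume "term_op4 \<sigma> D m \<and> restr4 m = m"
  then have "m = restr4 m" "term_op4 \<sigma> D m" by simp_all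
  then show "m \<in> carrier free4" unfolding free4_def by auto
qed

lemma term_op4_opr:
  assumes f: "\<sigma> f = Some (length ms)" and ms: "\<And>m. m \<in> set ms \<Longrightarrow> term_op4 \<sigma> D m"
  shows "term_op4 \<sigma> D (\<lambda>a b c d. opr D f (map (\<lambda>m. m a b c d) ms))"
proof -
  obtain s where s: "\<And>m. m \<in> set ms \<Longrightarrow> wf_trm \<sigma> (s m) \<and> (\<forall>a\<in>carrier D. \<forall>b\<in>carrier D. \<forall>c\<in>carrier D. \<forall>d\<in>carrier D.
     m a b c d = trm_val D (valuation4 a b c d) (s m))"
    using ms unfolding term_op4_def by metis
  show ?thesis
    unfolding term_op4_def using s f
    by (intro exI[of _ "Op f (map s ms)"]) (auto intro!: arg_cong[where f = "opr D f"])
qed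

lemma trm_val_free4:
  assumes "in_carrier4 a b c d"
  shows "trm_val free4 \<rho> t a b c d = trm_val D (\<lambda>v. \<rho> v a b c d) t"
proof (induction t)
  case (Op f ts)
  then show ?case
    using assms by (auto simp: free4_def restr4 o_def intro!: arg_cong[where f = "opr D f"])
qed simp

lemma is_algebra_free4: "is_algebra \<sigma> free4"
  unfolding is_algebra_def
proof (intro allI impI)
  fix f ms assume "\<sigma> f = Some (length ms) \<and> set ms \<subseteq> carrier free4"
  then have "term_op4 \<sigma> D (\<lambda>a b c d. opr D f (map (\<lambda>m. m a b c d) ms))"
    by (intro term_op4_opr) (auto simp: carrier_free4)
  then show "opr free4 f ms \<in> carrier free4" by (auto simp: free4_def)
qed

lemma in_variety_free4: "in_variety \<sigma> E free4"
proof -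
  have E: "wf_identities \<sigma> E" using modular by (simp add: congruence_modular_variety_def)
  have "trm_val free4 \<rho> s = trm_val free4 \<rho> t" if st: "(s, t) \<in> E" and \<rho>: "range \<rho> \<subseteq> carrier free4" for s t \<rho>
  proof -
    have "trm_val free4 \<rho> s a b c d = trm_val free4 \<rho> t a b c d" for a b c d
    proof (cases "in_carrier4 a b c d")
      case True
      then have "range (\<lambda>v. \<rho> v a b c d) \<subseteq> carrier D"
        using \<rho> term_op4_closed[OF algebra] by (auto simp: image_subset_iff carrier_free4 in_carrier4_def)
      then show ?thesis
        using in_variety st True by (auto simp: trm_val_free4 in_variety_def)
    next
      case False
      have "trm_val free4 \<rho> r a b c d = undefined" if "wf_trm \<sigma> r" for r
      proof -
        have "restr4 (trm_val free4 \<rho> r) = trm_val free4 \<rho> r"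
          using trm_val_closed[OF is_algebra_free4 \<rho> that] by (simp add: carrier_free4)
        then have "trm_val free4 \<rho> r a b c d = restr4 (trm_val free4 \<rho> r) a b c d" by simp
        then show ?thesis using False by (simp add: restr4_def)
      qed
      then show ?thesis using E st by (auto simp: wf_identities_def)
    qed
    then show ?thesis by (simp add: fun_eq_iff)
  qed
  then show ?thesis using is_algebra_free4 by (auto simp: in_variety_def)
qed

text \<open>The kernel of restriction to the argument tuples satisfying \<open>P\<close>. It encodes
  an identification of free generators: \<open>b = c\<close> as a condition on arguments stands for
  identifying the second and third projections.\<close>

definition agree :: "('a \<Rightarrow> 'a \<Rightarrow> 'a \<Rightarrow> 'a \<Rightarrow> bool) \<Rightarrow>
    (('a \<Rightarrow> 'a \<Rightarrow> 'a \<Rightarrow> 'a \<Rightarrow> 'a) \<times> ('a \<Rightarrow> 'a \<Rightarrow> 'a \<Rightarrow> 'a \<Rightarrow> 'a)) set" where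
  "agree P = {(m, m'). m \<in> carrier free4 \<and> m' \<in> carrier free4 \<and>
     (\<forall>a b c d. in_carrier4 a b c d \<longrightarrow> P a b c d \<longrightarrow> m a b c d = m' a b c d)}"

lemma congruence_agree: "congruence \<sigma> free4 (agree P)"
proof (rule congruenceI)
  fix f ms ms' assume f: "\<sigma> f = Some (length ms)" and l: "list_all2 (\<lambda>m m'. (m, m') \<in> agree P) ms ms'"
  have s: "set ms \<subseteq> carrier free4" "set ms' \<subseteq> carrier free4" and len: "length ms' = length ms"
    using list_all2_set[OF l, of "carrier free4" "carrier free4"] l
    by (auto simp: agree_def list_all2_lengthD)
  have "map (\<lambda>m. m a b c d) ms = map (\<lambda>m. m a b c d) ms'" if "in_carrier4 a b c d" "P a b c d" for a b c d
    using l that by (intro nth_equalityI) (auto simp: list_all2_conv_all_nth agree_def)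
  moreover have "opr free4 f ms \<in> carrier free4" "opr free4 f ms' \<in> carrier free4"
    using is_algebraD[OF is_algebra_free4, of f] f len s by auto
  ultimately show "(opr free4 f ms, opr free4 f ms') \<in> agree P"
    by (auto simp: agree_def free4_def restr4)
qed (auto simp: agree_def)

definition day_op :: "('a \<Rightarrow> 'a \<Rightarrow> 'a \<Rightarrow> 'a \<Rightarrow> 'a) \<Rightarrow> bool" where
  "day_op m \<longleftrightarrow> term_op4 \<sigma> D m \<and> (\<forall>a\<in>carrier D. \<forall>b\<in>carrier D. m a b b a = a)"

text \<open>Day's chain of terms from \<open>a\<close> to \<open>d\<close>, in the form of an induction along the chain. It is
  obtained from \<open>(x \<or> y) \<and> z \<le> x \<or> (y \<and> z)\<close> in the free algebra for the congruences \<open>x\<close>, \<open>y\<close>, \<open>z\<close>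
  that identify \<open>b = c\<close>, \<open>a = b, c = d\<close> and \<open>a = d, b = c\<close>, respectively.\<close>

lemma day_induct:
  assumes first: "\<And>m. \<lbrakk>day_op m; \<And>a b c d. in_carrier4 a b c d \<Longrightarrow> m a b c d = a\<rbrakk> \<Longrightarrow> Q m"
    and mid: "\<And>m m'. \<lbrakk>Q m; day_op m; day_op m'; \<And>a b c. in_carrier4 a b b c \<Longrightarrow> m a b b c = m' a b b c\<rbrakk> \<Longrightarrow> Q m'"
    and sides: "\<And>m m'. \<lbrakk>Q m; day_op m; day_op m'; \<And>a b. in_carrier4 a a b b \<Longrightarrow> m a a b b = m' a a b b\<rbrakk> \<Longrightarrow> Q m'"
  obtains m where "Q m" "day_op m" "\<And>a b c d. in_carrier4 a b c d \<Longrightarrow> m a b c d = d"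
proof -
  define x where "x = agree (\<lambda>a b c d. b = c)"
  define y where "y = agree (\<lambda>a b c d. a = b \<and> c = d)"
  define z where "z = agree (\<lambda>a b c d. a = d \<and> b = c)"
  have pF: "restr4 (\<lambda>a b c d. a) \<in> carrier free4" "restr4 (\<lambda>a b c d. b) \<in> carrier free4"
     "restr4 (\<lambda>a b c d. c) \<in> carrier free4" "restr4 (\<lambda>a b c d. d) \<in> carrier free4"
    by (auto simp: free4_def term_op4_proj)
  have "(restr4 (\<lambda>a b c d. a), restr4 (\<lambda>a b c d. b)) \<in> y" "(restr4 (\<lambda>a b c d. b), restr4 (\<lambda>a b c d. c)) \<in> x"
    "(restr4 (\<lambda>a b c d. c), restr4 (\<lambda>a b c d. d)) \<in> y"
    using pF by (auto simp: x_def y_def agree_def restr4)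
  then have "(restr4 (\<lambda>a b c d. a), restr4 (\<lambda>a b c d. d)) \<in> (x \<union> y)\<^sup>+"
    by (meson UnCI r_into_trancl trancl_into_trancl)
  moreover have "(restr4 (\<lambda>a b c d. a), restr4 (\<lambda>a b c d. d)) \<in> z"
    using pF by (auto simp: z_def agree_def restr4)
  moreover have "(x \<union> y)\<^sup>+ \<inter> z \<subseteq> (x \<union> (y \<inter> z))\<^sup>+"
  proof -
    have "modular_lattice (Cong \<sigma> free4)"
      by (rule congruence_modular_variety_all_types[OF modular in_variety_free4])
    moreover have "x \<subseteq> z" by (auto simp: x_def z_def agree_def)
    ultimately show ?thesis
      unfolding modular_lattice_Cong_iff[OF is_algebra_free4]
      using congruence_agree by (simp add: x_def y_def z_def)
  qed
  ultimately have "(restr4 (\<lambda>a b c d. a), restr4 (\<lambda>a b c d. d)) \<in> (x \<union> (y \<inter> z))\<^sup>+" by blast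
  moreover have day0: "day_op (restr4 (\<lambda>a b c d. a))"
    by (simp add: day_op_def term_op4_restr4 term_op4_proj restr4 in_carrier4_def)
  \<comment> \<open>Both kinds of links lie in \<open>z\<close>, which compares values at
    \<open>a b b a\<close>; hence Day's identity passes from the first projection to every member of
    the chain.\<close>
  moreover have day_z: "day_op m'" if "day_op m" "(m, m') \<in> x \<union> (y \<inter> z)" for m m'
  proof -
    have "(m, m') \<in> z" using that by (auto simp: x_def z_def agree_def)
    then show ?thesis using that(1)
      by (auto simp: z_def agree_def day_op_def carrier_free4 in_carrier4_def)
  qed
  moreover have Q_step: "Q m' \<and> day_op m'"
    if m: "Q m \<and> day_op m" and mm': "(m, m') \<in> x \<union> (y \<inter> z)" for m m'
  proof -
    have "day_op m'" using m mm' day_z by blast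
    moreover have "(\<forall>a b c. in_carrier4 a b b c \<longrightarrow> m a b b c = m' a b b c) \<or>
        (\<forall>a b. in_carrier4 a a b b \<longrightarrow> m a a b b = m' a a b b)"
      using mm' unfolding x_def y_def agree_def by blast
    ultimately show ?thesis using mid[of m m'] sides[of m m'] m by blast
  qed
  ultimately have "Q (restr4 (\<lambda>a b c d. d)) \<and> day_op (restr4 (\<lambda>a b c d. d))"
  proof (induction rule: trancl_induct)
    case (base m)
    have "Q (restr4 (\<lambda>a b c d. a))" by (rule first[OF base(2)]) (simp add: restr4)
    with base show ?case using Q_step by blast
  next
    case (step m m')
    then show ?case using Q_step by blast
  qed
  then show thesis using that[of "restr4 (\<lambda>a b c d. d)"] by (simp add: restr4)
qed

end

section \<open>Relations on squares\<close>

definition compatible4 ::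
  "'f signature \<Rightarrow> ('f, 'a) ualgebra \<Rightarrow> ('a \<Rightarrow> 'a \<Rightarrow> 'a \<Rightarrow> 'a \<Rightarrow> bool) \<Rightarrow> bool" where
  "compatible4 \<sigma> D N \<longleftrightarrow> (\<forall>f xs ys zs ws. \<sigma> f = Some (length xs) \<and>
     length ys = length xs \<and> length zs = length xs \<and> length ws = length xs \<and>
     (\<forall>i<length xs. N (xs ! i) (ys ! i) (zs ! i) (ws ! i)) \<longrightarrow>
     N (opr D f xs) (opr D f ys) (opr D f zs) (opr D f ws))"

lemma compatible4D:
  assumes "compatible4 \<sigma> D N" "\<sigma> f = Some (length xs)"
    "length ys = length xs" "length zs = length xs" "length ws = length xs"
    "\<And>i. i < length xs \<Longrightarrow> N (xs ! i) (ys ! i) (zs ! i) (ws ! i)"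
  shows "N (opr D f xs) (opr D f ys) (opr D f zs) (opr D f ws)"
  using assms unfolding compatible4_def by blast

lemma compatible4_trm_val:
  assumes N: "compatible4 \<sigma> D N" and \<rho>: "\<And>v. N (\<rho>1 v) (\<rho>2 v) (\<rho>3 v) (\<rho>4 v)"
  shows "wf_trm \<sigma> t \<Longrightarrow> N (trm_val D \<rho>1 t) (trm_val D \<rho>2 t) (trm_val D \<rho>3 t) (trm_val D \<rho>4 t)"
proof (induction t)
  case (Op f ts)
  then show ?case by (auto intro!: compatible4D[OF N])
qed (simp add: \<rho>)

lemma compatible4_term_op4:
  assumes N: "compatible4 \<sigma> D N" and m: "term_op4 \<sigma> D m"
    and c: "\<And>a b c d. N a b c d \<Longrightarrow> {a, b, c, d} \<subseteq> carrier D"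
    and a: "N a1 a2 a3 a4" "N b1 b2 b3 b4" "N c1 c2 c3 c4" "N d1 d2 d3 d4"
  shows "N (m a1 b1 c1 d1) (m a2 b2 c2 d2) (m a3 b3 c3 d3) (m a4 b4 c4 d4)"
proof -
  obtain t where t: "wf_trm \<sigma> t" "\<And>a b c d. \<lbrakk>a \<in> carrier D; b \<in> carrier D; c \<in> carrier D; d \<in> carrier D\<rbrakk> \<Longrightarrow>
     m a b c d = trm_val D (valuation4 a b c d) t"
    using m unfolding term_op4_def by blast
  have "N (valuation4 a1 b1 c1 d1 v) (valuation4 a2 b2 c2 d2 v)
      (valuation4 a3 b3 c3 d3 v) (valuation4 a4 b4 c4 d4 v)" for v
    using a by (simp add: valuation4_def)
  from compatible4_trm_val[OF N this t(1)] show ?thesis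
    using c[OF a(1)] c[OF a(2)] c[OF a(3)] c[OF a(4)] by (simp add: t(2))
qed

text \<open>Two copies of \<open>\<delta>\<close> side by side form a compatible quaternary
  relation, so the result on squares applies.\<close>

lemma congruence_term_op4:
  assumes \<delta>: "congruence \<sigma> D \<delta>" and m: "term_op4 \<sigma> D m"
    and a: "(a, a') \<in> \<delta>" "(b, b') \<in> \<delta>" "(c, c') \<in> \<delta>" "(d, d') \<in> \<delta>"
  shows "(m a b c d, m a' b' c' d') \<in> \<delta>"
proof -
  have "compatible4 \<sigma> D (\<lambda>a b c d. (a, b) \<in> \<delta> \<and> (c, d) \<in> \<delta>)"
    unfolding compatible4_def
    by (auto intro!: congruenceD(6)[OF \<delta>] simp: list_all2_conv_all_nth)
  from compatible4_term_op4[OF this m, of a a' a a' b b' b b' c c' c c' d d' d d'] show ?thesis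
    using a congruenceD(1,2)[OF \<delta>] by auto
qed

definition flip4 :: "('a \<Rightarrow> 'a \<Rightarrow> 'a \<Rightarrow> 'a \<Rightarrow> bool) \<Rightarrow> 'a \<Rightarrow> 'a \<Rightarrow> 'a \<Rightarrow> 'a \<Rightarrow> bool" where
  "flip4 N = (\<lambda>a b c d. N a c b d)"

lemma flip4_flip4 [simp]: "flip4 (flip4 N) = N"
  by (simp add: flip4_def)

text \<open>A quadruple \<open>a b c d\<close> is to be read as the square with the rows \<open>a b\<close> and \<open>c d\<close>.\<close>

definition square_rel ::
  "'f signature \<Rightarrow> ('f, 'a) ualgebra \<Rightarrow> ('a \<Rightarrow> 'a \<Rightarrow> 'a \<Rightarrow> 'a \<Rightarrow> bool) \<Rightarrow> bool" where
  "square_rel \<sigma> D N \<longleftrightarrow> compatible4 \<sigma> D N \<and> (\<forall>a\<in>carrier D. N a a a a) \<and>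
     (\<forall>a b c d. N a b c d \<longrightarrow> {a, b, c, d} \<subseteq> carrier D \<and> N b a d c \<and> N c d a b \<and> N a b a b \<and> N a a c c)"

lemma square_relD:
  assumes "square_rel \<sigma> D N"
  shows "compatible4 \<sigma> D N" "a \<in> carrier D \<Longrightarrow> N a a a a"
    "N a b c d \<Longrightarrow> {a, b, c, d} \<subseteq> carrier D" "N a b c d \<Longrightarrow> N b a d c" "N a b c d \<Longrightarrow> N c d a b"
    "N a b c d \<Longrightarrow> N a b a b" "N a b c d \<Longrightarrow> N a a c c"
  using assms unfolding square_rel_def by blast+

lemma square_rel_term_op4:
  assumes N: "square_rel \<sigma> D N" and m: "term_op4 \<sigma> D m"
    and a: "N a1 a2 a3 a4" "N b1 b2 b3 b4" "N c1 c2 c3 c4" "N d1 d2 d3 d4"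
  shows "N (m a1 b1 c1 d1) (m a2 b2 c2 d2) (m a3 b3 c3 d3) (m a4 b4 c4 d4)"
  by (rule compatible4_term_op4[OF square_relD(1)[OF N] m square_relD(3)[OF N] a])

lemma square_rel_flip4: "square_rel \<sigma> D N \<Longrightarrow> square_rel \<sigma> D (flip4 N)"
  unfolding square_rel_def compatible4_def flip4_def by (intro conjI allI impI) blast+

definition hcomp :: "('a \<Rightarrow> 'a \<Rightarrow> 'a \<Rightarrow> 'a \<Rightarrow> bool) \<Rightarrow> 'a \<Rightarrow> 'a \<Rightarrow> 'a \<Rightarrow> 'a \<Rightarrow> bool" where
  "hcomp N = (\<lambda>a b c d. \<exists>e e'. N a e c e' \<and> N e b e' d)"

lemma square_rel_hcomp:
  assumes N: "square_rel \<sigma> D N"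
  shows "square_rel \<sigma> D (hcomp N)"
  unfolding square_rel_def
proof (intro conjI allI impI ballI)
  show "compatible4 \<sigma> D (hcomp N)"
    unfolding compatible4_def
  proof (intro allI impI, elim conjE)
    fix f xs ys zs ws
    assume f: "\<sigma> f = Some (length xs)" "length ys = length xs" "length zs = length xs" "length ws = length xs"
      and "\<forall>i<length xs. hcomp N (xs ! i) (ys ! i) (zs ! i) (ws ! i)"
    then obtain e e' where e: "\<And>i. i < length xs \<Longrightarrow> N (xs ! i) (e i) (zs ! i) (e' i) \<and> N (e i) (ys ! i) (e' i) (ws ! i)"
      unfolding hcomp_def by metis
    define es where "es = map e [0..<length xs]"
    define es' where "es' = map e' [0..<length xs]"
    have "N (opr D f xs) (opr D f es) (opr D f zs) (opr D f es')"
      using f e by (intro compatible4D[OF square_relD(1)[OF N]]) (auto simp: es_def es'_def)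
    moreover have "N (opr D f es) (opr D f ys) (opr D f es') (opr D f ws)"
      using f e by (intro compatible4D[OF square_relD(1)[OF N]]) (auto simp: es_def es'_def)
    ultimately show "hcomp N (opr D f xs) (opr D f ys) (opr D f zs) (opr D f ws)"
      unfolding hcomp_def by blast
  qed
next
  fix a assume "a \<in> carrier D"
  then show "hcomp N a a a a" unfolding hcomp_def using square_relD(2)[OF N] by blast
next
  fix a b c d assume *: "hcomp N a b c d"
  show "{a, b, c, d} \<subseteq> carrier D" using * square_relD(3)[OF N] unfolding hcomp_def by blast
  show "hcomp N b a d c" using * square_relD(4)[OF N] unfolding hcomp_def by blast
  show "hcomp N c d a b" using * square_relD(5)[OF N] unfolding hcomp_def by blast
  show "hcomp N a b a b" using * square_relD(6)[OF N] unfolding hcomp_def by blast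
  show "hcomp N a a c c"
  proof -
    obtain e e' where "N a e c e'" using * unfolding hcomp_def by blast
    then have "N a a c c" by (rule square_relD(7)[OF N])
    then show ?thesis unfolding hcomp_def by blast
  qed
qed

text \<open>A square is its own composite with the trivial square on its right column.\<close>

lemma hcomp_incr:
  assumes N: "square_rel \<sigma> D N" and "N a b c d"
  shows "hcomp N a b c d"
  unfolding hcomp_def using square_relD(7)[OF N square_relD(4)[OF assms]] assms(2) by blast

section \<open>Squares modulo a congruence and the term condition\<close>

definition saturated :: "('a \<times> 'a) set \<Rightarrow> ('a \<Rightarrow> 'a \<Rightarrow> 'a \<Rightarrow> 'a \<Rightarrow> bool) \<Rightarrow> bool" where
  "saturated \<delta> N \<longleftrightarrow> (\<forall>a b c d a' b' c' d'. N a b c d \<longrightarrow>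
     (a, a') \<in> \<delta> \<longrightarrow> (b, b') \<in> \<delta> \<longrightarrow> (c, c') \<in> \<delta> \<longrightarrow> (d, d') \<in> \<delta> \<longrightarrow> N a' b' c' d')"

lemma saturatedD:
  "\<lbrakk>saturated \<delta> N; N a b c d; (a, a') \<in> \<delta>; (b, b') \<in> \<delta>; (c, c') \<in> \<delta>; (d, d') \<in> \<delta>\<rbrakk> \<Longrightarrow> N a' b' c' d'"
  unfolding saturated_def by blast

definition saturation ::
  "('a \<times> 'a) set \<Rightarrow> ('a \<Rightarrow> 'a \<Rightarrow> 'a \<Rightarrow> 'a \<Rightarrow> bool) \<Rightarrow> 'a \<Rightarrow> 'a \<Rightarrow> 'a \<Rightarrow> 'a \<Rightarrow> bool" where
  "saturation \<delta> N = (\<lambda>a b c d. \<exists>a' b' c' d'. N a' b' c' d' \<and>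
     (a', a) \<in> \<delta> \<and> (b', b) \<in> \<delta> \<and> (c', c) \<in> \<delta> \<and> (d', d) \<in> \<delta>)"

definition term_condition :: "('a \<times> 'a) set \<Rightarrow> ('a \<Rightarrow> 'a \<Rightarrow> 'a \<Rightarrow> 'a \<Rightarrow> bool) \<Rightarrow> bool" where
  "term_condition \<delta> N \<longleftrightarrow> (\<forall>a b c d. N a b c d \<longrightarrow> (a, b) \<in> \<delta> \<longrightarrow> (c, d) \<in> \<delta>)"

lemma term_conditionD: "\<lbrakk>term_condition \<delta> N; N a b c d; (a, b) \<in> \<delta>\<rbrakk> \<Longrightarrow> (c, d) \<in> \<delta>"
  unfolding term_condition_def by blast

text \<open>The commutator of Freese and McKenzie is below \<open>\<delta>\<close> if this holds for the squares generated by the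
  two congruences.\<close>

definition centralizing ::
  "'f signature \<Rightarrow> ('f, 'a) ualgebra \<Rightarrow> ('a \<times> 'a) set \<Rightarrow> ('a \<Rightarrow> 'a \<Rightarrow> 'a \<Rightarrow> 'a \<Rightarrow> bool) \<Rightarrow> bool" where
  "centralizing \<sigma> D \<delta> N \<longleftrightarrow> square_rel \<sigma> D N \<and> term_condition \<delta> N \<and> term_condition \<delta> (flip4 N)"

lemma centralizing_flip4: "centralizing \<sigma> D \<delta> N \<Longrightarrow> centralizing \<sigma> D \<delta> (flip4 N)"
  by (simp add: centralizing_def square_rel_flip4)

lemma saturated_flip4: "saturated \<delta> N \<Longrightarrow> saturated \<delta> (flip4 N)"
  unfolding saturated_def flip4_def by blast

lemma saturated_hcomp:
  assumes N: "square_rel \<sigma> D N" and \<delta>: "congruence \<sigma> D \<delta>" and s: "saturated \<delta> N"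
  shows "saturated \<delta> (hcomp N)"
  unfolding saturated_def
proof (intro allI impI)
  fix a b c d a' b' c' d'
  assume "hcomp N a b c d" and p: "(a, a') \<in> \<delta>" "(b, b') \<in> \<delta>" "(c, c') \<in> \<delta>" "(d, d') \<in> \<delta>"
  then obtain e e' where e: "N a e c e'" "N e b e' d" unfolding hcomp_def by blast
  then have "(e, e) \<in> \<delta>" "(e', e') \<in> \<delta>" using square_relD(3)[OF N] congruenceD(3)[OF \<delta>] by blast+
  then have "N a' e c' e'" "N e b' e' d'" using saturatedD[OF s e(1)] saturatedD[OF s e(2)] p by blast+
  then show "hcomp N a' b' c' d'" unfolding hcomp_def by blast
qed

lemma square_rel_saturation:
  assumes N: "square_rel \<sigma> D N" and \<delta>: "congruence \<sigma> D \<delta>"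
  shows "square_rel \<sigma> D (saturation \<delta> N)"
  unfolding square_rel_def
proof (intro conjI allI impI ballI)
  show "compatible4 \<sigma> D (saturation \<delta> N)"
    unfolding compatible4_def
  proof (intro allI impI, elim conjE)
    fix f xs ys zs ws
    assume f: "\<sigma> f = Some (length xs)" "length ys = length xs" "length zs = length xs" "length ws = length xs"
      and "\<forall>i<length xs. saturation \<delta> N (xs ! i) (ys ! i) (zs ! i) (ws ! i)"
    then obtain x y z w where e: "\<And>i. i < length xs \<Longrightarrow> N (x i) (y i) (z i) (w i) \<and> (x i, xs ! i) \<in> \<delta> \<and>
        (y i, ys ! i) \<in> \<delta> \<and> (z i, zs ! i) \<in> \<delta> \<and> (w i, ws ! i) \<in> \<delta>"
      unfolding saturation_def by metis
    let ?m = "\<lambda>g. map g [0..<length xs]"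
    have "N (opr D f (?m x)) (opr D f (?m y)) (opr D f (?m z)) (opr D f (?m w))"
      using f e by (intro compatible4D[OF square_relD(1)[OF N]]) auto
    moreover have "(opr D f (?m x), opr D f xs) \<in> \<delta>" "(opr D f (?m y), opr D f ys) \<in> \<delta>"
       "(opr D f (?m z), opr D f zs) \<in> \<delta>" "(opr D f (?m w), opr D f ws) \<in> \<delta>"
      using f e by (auto intro!: congruenceD(6)[OF \<delta>] simp: list_all2_conv_all_nth)
    ultimately show "saturation \<delta> N (opr D f xs) (opr D f ys) (opr D f zs) (opr D f ws)"
      unfolding saturation_def by blast
  qed
next
  fix a assume "a \<in> carrier D"
  then show "saturation \<delta> N a a a a"
    unfolding saturation_def using square_relD(2)[OF N] congruenceD(3)[OF \<delta>] by blast
next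
  fix a b c d assume "saturation \<delta> N a b c d"
  then obtain a' b' c' d' where *: "N a' b' c' d'" "(a', a) \<in> \<delta>" "(b', b) \<in> \<delta>" "(c', c) \<in> \<delta>" "(d', d) \<in> \<delta>"
    unfolding saturation_def by blast
  show "{a, b, c, d} \<subseteq> carrier D" using * congruenceD(2)[OF \<delta>] by blast
  show "saturation \<delta> N b a d c" using * square_relD(4)[OF N] unfolding saturation_def by blast
  show "saturation \<delta> N c d a b" using * square_relD(5)[OF N] unfolding saturation_def by blast
  show "saturation \<delta> N a b a b" using * square_relD(6)[OF N *(1)] unfolding saturation_def by blast
  show "saturation \<delta> N a a c c" using * square_relD(7)[OF N *(1)] unfolding saturation_def by blast
qed

lemma saturated_saturation:
  assumes \<delta>: "congruence \<sigma> D \<delta>"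
  shows "saturated \<delta> (saturation \<delta> N)"
  unfolding saturated_def
proof (intro allI impI)
  fix a b c d a' b' c' d'
  assume "saturation \<delta> N a b c d" and p: "(a, a') \<in> \<delta>" "(b, b') \<in> \<delta>" "(c, c') \<in> \<delta>" "(d, d') \<in> \<delta>"
  then obtain e f g h where *: "N e f g h" "(e, a) \<in> \<delta>" "(f, b) \<in> \<delta>" "(g, c) \<in> \<delta>" "(h, d) \<in> \<delta>"
    unfolding saturation_def by blast
  note tr = congruenceD(5)[OF \<delta>]
  show "saturation \<delta> N a' b' c' d'"
    unfolding saturation_def
    using *(1) tr[OF *(2) p(1)] tr[OF *(3) p(2)] tr[OF *(4) p(3)] tr[OF *(5) p(4)] by blast
qed

lemma saturation_incr:
  assumes "square_rel \<sigma> D N" "congruence \<sigma> D \<delta>" "N a b c d"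
  shows "saturation \<delta> N a b c d"
  unfolding saturation_def
  using square_relD(3)[OF assms(1,3)] congruenceD(3)[OF assms(2)] assms(3) by blast

lemma flip4_saturation: "flip4 (saturation \<delta> N) = saturation \<delta> (flip4 N)"
  by (auto simp: fun_eq_iff flip4_def saturation_def)

lemma term_condition_saturation:
  assumes \<delta>: "congruence \<sigma> D \<delta>" and "term_condition \<delta> N"
  shows "term_condition \<delta> (saturation \<delta> N)"
  unfolding term_condition_def
proof (intro allI impI)
  fix a b c d assume "saturation \<delta> N a b c d" "(a, b) \<in> \<delta>"
  then obtain a' b' c' d' where *: "N a' b' c' d'" "(a', a) \<in> \<delta>" "(b', b) \<in> \<delta>" "(c', c) \<in> \<delta>" "(d', d) \<in> \<delta>"
    unfolding saturation_def by blast
  then have "(a', b') \<in> \<delta>" using \<open>(a, b) \<in> \<delta>\<close> congruenceD(4,5)[OF \<delta>] by blast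
  then have "(c', d') \<in> \<delta>" by (rule term_conditionD[OF assms(2) *(1)])
  then show "(c, d) \<in> \<delta>" using * congruenceD(4,5)[OF \<delta>] by blast
qed

lemma centralizing_saturation:
  "\<lbrakk>congruence \<sigma> D \<delta>; centralizing \<sigma> D \<delta> N\<rbrakk> \<Longrightarrow> centralizing \<sigma> D \<delta> (saturation \<delta> N)"
  by (simp add: centralizing_def square_rel_saturation term_condition_saturation flip4_saturation)

definition comp_closed :: "('a \<Rightarrow> 'a \<Rightarrow> 'a \<Rightarrow> 'a \<Rightarrow> bool) \<Rightarrow> bool" where
  "comp_closed M \<longleftrightarrow> (\<forall>a b c d e e'. M a e c e' \<longrightarrow> M e b e' d \<longrightarrow> M a b c d) \<and>
     (\<forall>a b c d e e'. M a b e e' \<longrightarrow> M e e' c d \<longrightarrow> M a b c d)"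

lemma comp_closedD:
  assumes "comp_closed M"
  shows "\<lbrakk>M a e c e'; M e b e' d\<rbrakk> \<Longrightarrow> M a b c d" "\<lbrakk>M a b e e'; M e e' c d\<rbrakk> \<Longrightarrow> M a b c d"
  using assms unfolding comp_closed_def by blast+

section \<open>Transfer of the term condition and closure under composition\<close>

context modular_algebra
begin

text \<open>The quadruple of the four values of a Day term below has a trivial first column, so that the
  term condition on columns bounds \<open>(m c c d d, m c a b d)\<close>. This bound involves rows and columns
  symmetrically and is inherited by all congruences above.\<close>

lemma term_condition_flip4:
  assumes N: "square_rel \<sigma> D N" and c: "congruence \<sigma> D \<delta>" "congruence \<sigma> D \<delta>'" "\<delta>' \<subseteq> \<delta>"
    and tc: "term_condition \<delta>' (flip4 N)"
  shows "term_condition \<delta> N"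
  unfolding term_condition_def
proof (intro allI impI)
  fix a b c d assume abcd: "N a b c d" and ab: "(a, b) \<in> \<delta>"
  have carr: "a \<in> carrier D" "b \<in> carrier D" "c \<in> carrier D" "d \<in> carrier D"
    using square_relD(3)[OF N abcd] by auto
  have ba: "(b, a) \<in> \<delta>" using congruenceD(4)[OF c(1) ab] .
  have refl: "(e, e) \<in> \<delta>" if "e \<in> carrier D" for e using congruenceD(3)[OF c(1) that] .
  have X: "(m c c d d, m c a b d) \<in> \<delta>" if m: "day_op m" for m
  proof -
    have t: "term_op4 \<sigma> D m" and i: "m c c c c = c" "m c a a c = c"
      using m carr by (auto simp: day_op_def)
    have "N (m c c c c) (m c c d d) (m c a a c) (m c a b d)"
      by (rule square_rel_term_op4[OF N t square_relD(2)[OF N carr(3)]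
            square_relD(7)[OF N square_relD(5)[OF N abcd]] square_relD(5)[OF N abcd]
            square_relD(6)[OF N square_relD(5)[OF N abcd]]])
    then have "(m c c d d, m c a b d) \<in> \<delta>'"
      using term_conditionD[OF tc, of "m c c c c" "m c a a c" "m c c d d" "m c a b d"] i
        congruenceD(3)[OF c(2) carr(3)] by (simp add: flip4_def)
    then show ?thesis using c(3) by blast
  qed
  \<comment> \<open>Along Day's chain the value at \<open>c a b d\<close> moves from
    \<open>c\<close> to \<open>d\<close>; each link keeps it in the \<open>\<delta>\<close>-class of
    \<open>c\<close>.\<close>
  have "(d, c) \<in> \<delta>"
  proof (rule day_induct[where Q = "\<lambda>m. (m c a b d, c) \<in> \<delta>"])
    fix m assume "day_op m" "\<And>a b c d. in_carrier4 a b c d \<Longrightarrow> m a b c d = a"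
    then show "(m c a b d, c) \<in> \<delta>" using carr refl by (simp add: in_carrier4_def)
  next
    fix m m' assume *: "(m c a b d, c) \<in> \<delta>" "day_op m" "day_op m'"
      "\<And>a b c. in_carrier4 a b b c \<Longrightarrow> m a b b c = m' a b b c"
    have "(m c a b d, m c a a d) \<in> \<delta>" "(m' c a b d, m' c a a d) \<in> \<delta>"
      using *(2,3) congruence_term_op4[OF c(1) _ refl[OF carr(3)] refl[OF carr(1)] ba refl[OF carr(4)]]
      by (simp_all add: day_op_def)
    moreover have "m c a a d = m' c a a d" using *(4) carr by (simp add: in_carrier4_def)
    ultimately show "(m' c a b d, c) \<in> \<delta>"
      using *(1) congruenceD(4,5)[OF c(1)] by metis
  next
    fix m m' assume *: "(m c a b d, c) \<in> \<delta>" "day_op m" "day_op m'"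
      "\<And>a b. in_carrier4 a a b b \<Longrightarrow> m a a b b = m' a a b b"
    have "m c c d d = m' c c d d" using *(4) carr by (simp add: in_carrier4_def)
    then show "(m' c a b d, c) \<in> \<delta>"
      using *(1) X[OF *(2)] X[OF *(3)] congruenceD(4,5)[OF c(1)] by metis
  next
    fix m assume "(m c a b d, c) \<in> \<delta>" "\<And>a b c d. in_carrier4 a b c d \<Longrightarrow> m a b c d = d"
    then show ?thesis using carr by (simp add: in_carrier4_def)
  qed
  then show "(c, d) \<in> \<delta>" by (rule congruenceD(4)[OF c(1)])
qed

text \<open>The column condition modulo \<open>\<delta>'\<close> gives the row condition modulo any
  larger congruence, and transposition gives the converse. In general algebras the term condition is
  not inherited upwards; here this is what leads from the commutator to an arbitrary
  \<open>p\<close> above it.\<close>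

lemma centralizing_mono:
  assumes "centralizing \<sigma> D \<delta>' N" "congruence \<sigma> D \<delta>" "congruence \<sigma> D \<delta>'" "\<delta>' \<subseteq> \<delta>"
  shows "centralizing \<sigma> D \<delta> N"
  using assms term_condition_flip4[of N \<delta> \<delta>'] term_condition_flip4[of "flip4 N" \<delta> \<delta>']
  by (simp add: centralizing_def square_rel_flip4)

lemma centralizing_hcomp:
  assumes N: "centralizing \<sigma> D \<delta> N" and \<delta>: "congruence \<sigma> D \<delta>"
  shows "centralizing \<sigma> D \<delta> (hcomp N)"
proof -
  have sq: "square_rel \<sigma> D (hcomp N)" using N square_rel_hcomp by (auto simp: centralizing_def)
  have "term_condition \<delta> (flip4 (hcomp N))"
    using N unfolding centralizing_def term_condition_def flip4_def hcomp_def by blast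
  then show ?thesis using term_condition_flip4[OF sq \<delta> \<delta>] sq by (simp add: centralizing_def)
qed

text \<open>Composition of squares in one direction preserves the term condition in the other one, whence
  both by the previous lemmas; so one can close under both compositions in turn.\<close>

primrec comp_iter :: "('a \<Rightarrow> 'a \<Rightarrow> 'a \<Rightarrow> 'a \<Rightarrow> bool) \<Rightarrow> nat \<Rightarrow> 'a \<Rightarrow> 'a \<Rightarrow> 'a \<Rightarrow> 'a \<Rightarrow> bool" where
  "comp_iter N 0 = N"
| "comp_iter N (Suc n) = flip4 (hcomp (flip4 (hcomp (comp_iter N n))))"

text \<open>Two squares in the union of the increasing iterates already occur at a common level, so
  the union is closed under both compositions. The top row of a composite is a top row of a factor
  or a composite of such rows, and similarly for columns; hence bounds by transitive relations
  survive, which keeps the sides of \<open>M\<close> in the prescribed congruences.\<close>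

lemma comp_closure:
  assumes N: "centralizing \<sigma> D \<delta> N" and \<delta>: "congruence \<sigma> D \<delta>" and s: "saturated \<delta> N"
  obtains M where "centralizing \<sigma> D \<delta> M" "saturated \<delta> M"
    "N \<le> M" "comp_closed M"
    "\<forall>x. trans x \<longrightarrow> (\<forall>a b c d. N a b c d \<longrightarrow> (a, b) \<in> x) \<longrightarrow> (\<forall>a b c d. M a b c d \<longrightarrow> (a, b) \<in> x)"
    "\<forall>y. trans y \<longrightarrow> (\<forall>a b c d. N a b c d \<longrightarrow> (a, c) \<in> y) \<longrightarrow> (\<forall>a b c d. M a b c d \<longrightarrow> (a, c) \<in> y)"
proof -
  let ?N = "comp_iter N"
  have step: "centralizing \<sigma> D \<delta> (flip4 (hcomp M)) \<and> saturated \<delta> (flip4 (hcomp M))"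
    if "centralizing \<sigma> D \<delta> M \<and> saturated \<delta> M" for M
  proof -
    have M: "centralizing \<sigma> D \<delta> M" "saturated \<delta> M" using that by blast+
    then have "square_rel \<sigma> D M" by (simp add: centralizing_def)
    from centralizing_flip4[OF centralizing_hcomp[OF M(1) \<delta>]]
      saturated_flip4[OF saturated_hcomp[OF this \<delta> M(2)]]
    show ?thesis ..
  qed
  have *: "centralizing \<sigma> D \<delta> (?N n) \<and> saturated \<delta> (?N n)" for n
  proof (induction n)
    case 0
    show ?case using N s by simp
  next
    case (Suc n)
    show ?case using step[OF step[OF Suc]] by (simp only: comp_iter.simps)
  qed
  then have sq: "square_rel \<sigma> D (?N n)" for n by (simp only: centralizing_def)
  have sq': "square_rel \<sigma> D (flip4 (hcomp (?N n)))" for n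
    by (rule square_rel_flip4[OF square_rel_hcomp[OF sq]])
  have h: "?N (Suc n) a b c d" if "hcomp (?N n) a b c d" for n a b c d
    using hcomp_incr[OF sq', of n a c b d] that by (simp add: flip4_def)
  have v: "?N (Suc n) a b c d" if "?N n a b e e'" "?N n e e' c d" for n a b c d e e'
    using hcomp_incr[OF sq that(1)] hcomp_incr[OF sq that(2)]
    by (auto simp: flip4_def hcomp_def[of "\<lambda>a b c d. hcomp (?N n) a c b d"])
  have Suc: "?N (Suc n) a b c d" if "?N n a b c d" for n a b c d
    using h hcomp_incr[OF sq that] by blast
  have mono: "?N n' a b c d" if "?N n a b c d" "n \<le> n'" for n n' a b c d
    using that(2,1) by (induction rule: dec_induct) (auto intro: Suc simp del: comp_iter.simps(2))
  define M where "M = (\<lambda>a b c d. \<exists>n. ?N n a b c d)"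
  have M2: "\<exists>n. ?N n a b c d \<and> ?N n a' b' c' d'" if "M a b c d" "M a' b' c' d'" for a b c d a' b' c' d'
    using that mono max.cobounded1 max.cobounded2 unfolding M_def by metis
  have sqM: "square_rel \<sigma> D M"
    unfolding square_rel_def
  proof (intro conjI allI impI ballI)
    show "compatible4 \<sigma> D M"
      unfolding compatible4_def
    proof (intro allI impI, elim conjE)
      fix f xs ys zs ws
      assume f: "\<sigma> f = Some (length xs)" "length ys = length xs" "length zs = length xs" "length ws = length xs"
        and "\<forall>i<length xs. M (xs ! i) (ys ! i) (zs ! i) (ws ! i)"
      then obtain n where n: "\<And>i. i < length xs \<Longrightarrow> ?N (n i) (xs ! i) (ys ! i) (zs ! i) (ws ! i)"
        unfolding M_def by metis
      \<comment> \<open>The \<open>0\<close> covers nullary operations, where the image is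
        empty.\<close>
      define k where "k = Max (insert 0 (n ` {..<length xs}))"
      have "n i \<le> k" if "i < length xs" for i using that by (auto simp: k_def intro!: Max_ge)
      then have "?N k (opr D f xs) (opr D f ys) (opr D f zs) (opr D f ws)"
        using f n mono by (intro compatible4D[OF square_relD(1)[OF sq]]) blast+
      then show "M (opr D f xs) (opr D f ys) (opr D f zs) (opr D f ws)" unfolding M_def by blast
    qed
    show "M a a a a" if "a \<in> carrier D" for a unfolding M_def using square_relD(2)[OF sq that] by blast
    fix a b c d assume "M a b c d"
    then obtain n where n: "?N n a b c d" unfolding M_def by blast
    show "{a, b, c, d} \<subseteq> carrier D" by (rule square_relD(3)[OF sq n])
    show "M b a d c" "M c d a b" "M a b a b" "M a a c c"
      unfolding M_def using square_relD(4-7)[OF sq n] by blast+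
  qed
  have tcM: "term_condition \<delta> M" "term_condition \<delta> (flip4 M)" "saturated \<delta> M"
    using * unfolding term_condition_def flip4_def centralizing_def saturated_def M_def by blast+
  have NM: "M a b c d" if "N a b c d" for a b c d
    unfolding M_def using that by (intro exI[of _ 0]) simp
  have hM: "M a b c d" if "M a e c e'" "M e b e' d" for a b c d e e'
    using M2[OF that] h unfolding M_def hcomp_def by blast
  have vM: "M a b c d" if "M a b e e'" "M e e' c d" for a b c d e e'
    using M2[OF that] v unfolding M_def by blast
  have xM: "(a, b) \<in> x" if x: "trans x" "\<And>a b c d. N a b c d \<Longrightarrow> (a, b) \<in> x" and "M a b c d" for x a b c d
  proof -
    have "?N n a b c d \<Longrightarrow> (a, b) \<in> x" for n a b c d
    proof (induction n arbitrary: a b c d)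
      case (Suc n)
      then obtain e e' where "hcomp (?N n) a b e e'"
        by (auto simp: flip4_def hcomp_def[of "\<lambda>a b c d. hcomp (?N n) a c b d"])
      then show ?case using Suc.IH x(1) unfolding hcomp_def by (meson transD)
    qed (use x in auto)
    then show ?thesis using that(3) unfolding M_def by blast
  qed
  have yM: "(a, c) \<in> y" if y: "trans y" "\<And>a b c d. N a b c d \<Longrightarrow> (a, c) \<in> y" and "M a b c d" for y a b c d
  proof -
    have "?N n a b c d \<Longrightarrow> (a, c) \<in> y" for n a b c d
    proof (induction n arbitrary: a b c d)
      case (Suc n)
      then obtain e e' where "hcomp (?N n) a b e e'" "hcomp (?N n) e e' c d"
        by (auto simp: flip4_def hcomp_def[of "\<lambda>a b c d. hcomp (?N n) a c b d"])
      then have "(a, e) \<in> y" "(e, c) \<in> y" using Suc.IH unfolding hcomp_def by blast+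
      then show ?case using y(1) by (meson transD)
    qed (use y in auto)
    then show ?thesis using that(3) unfolding M_def by blast
  qed
  have "centralizing \<sigma> D \<delta> M" using sqM tcM by (simp add: centralizing_def)
  moreover have "N \<le> M" using NM by (simp add: le_fun_def)
  moreover have "comp_closed M" unfolding comp_closed_def
    by (intro conjI allI impI) (rule hM vM; assumption)+
  ultimately show thesis
    by (rule that[OF _ tcM(3)]) (intro allI impI, rule xM yM; blast)+
qed

end

section \<open>Gumm's difference term\<close>

context modular_algebra
begin

text \<open>In an affine algebra a Day term has the form \<open>(1 - k) a + k d + l (b - c)\<close>, and along the chain
  \<open>k\<close> changes only when \<open>k - l\<close> is constant. The term \<open>q\<close> below is \<open>c + k (a - b)\<close> then, and the three
  applications of the term condition verify this in a single \<open>\<theta>\<close>-class modulo \<open>\<delta>\<close>.\<close>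

lemma difference_term:
  assumes N: "square_rel \<sigma> D N" and tc: "term_condition \<delta> N"
    and \<delta>: "congruence \<sigma> D \<delta>" and \<theta>: "congruence \<sigma> D \<theta>"
    and row: "\<And>a b. (a, b) \<in> \<theta> \<Longrightarrow> N a b a b" and col: "\<And>a b. (a, b) \<in> \<theta> \<Longrightarrow> N a a b b"
  obtains P where "term_op4 \<sigma> D P"
    "\<forall>a\<in>carrier D. \<forall>c\<in>carrier D. \<forall>d\<in>carrier D. P a a c d = c"
    "\<forall>a b. (a, b) \<in> \<theta> \<longrightarrow> (P a b b b, a) \<in> \<delta>"
proof -
  let ?Q = "\<lambda>m. \<exists>q. term_op4 \<sigma> D q \<and> (\<forall>a\<in>carrier D. \<forall>c\<in>carrier D. \<forall>d\<in>carrier D. q a a c d = c) \<and>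
    (\<forall>a b. (a, b) \<in> \<theta> \<longrightarrow> (q a b b b, m b b b a) \<in> \<delta>)"
  note car = congruenceD(1,2)[OF \<theta>]
  show thesis
  proof (rule day_induct[where Q = ?Q])
    fix m assume "day_op m" "\<And>a b c d. in_carrier4 a b c d \<Longrightarrow> m a b c d = a"
    then show "?Q m"
      using term_op4_proj(3)[of \<sigma> D] car congruenceD(3)[OF \<delta>]
      by (intro exI[of _ "\<lambda>a b c d. c"]) (auto simp: in_carrier4_def)
  next
    fix m m' assume Q: "?Q m" and *: "\<And>a b c. in_carrier4 a b b c \<Longrightarrow> m a b b c = m' a b b c"
    have "m b b b a = m' b b b a" if "(a, b) \<in> \<theta>" for a b
      using * car[OF that] by (simp add: in_carrier4_def)
    then show "?Q m'" using Q by metis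
  next
    fix m m' assume "?Q m" and day: "day_op m" "day_op m'"
      and *: "\<And>a b. in_carrier4 a a b b \<Longrightarrow> m a a b b = m' a a b b"
    then obtain q where q: "term_op4 \<sigma> D q"
      "\<And>a c d. \<lbrakk>a \<in> carrier D; c \<in> carrier D; d \<in> carrier D\<rbrakk> \<Longrightarrow> q a a c d = c"
      "\<And>a b. (a, b) \<in> \<theta> \<Longrightarrow> (q a b b b, m b b b a) \<in> \<delta>"
      by blast
    have t: "term_op4 \<sigma> D m" "term_op4 \<sigma> D m'" using day by (auto simp: day_op_def)
    have i: "m a b b a = a" "m' a b b a = a" if "a \<in> carrier D" "b \<in> carrier D" for a b
      using day that by (auto simp: day_op_def)
    \<comment> \<open>In the affine picture \<open>w\<close> is \<open>c + (k - l)(a - b)\<close>,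
      and \<open>q'\<close> adds \<open>l'(a - b)\<close> to it. Since
      \<open>k - l = k' - l'\<close> for the two neighbouring terms, \<open>q'\<close> is
      \<open>c + k'(a - b)\<close>.\<close>
    define w where "w = (\<lambda>a b c d. m (q a b c d) b a (q a b c d))"
    define q' where "q' = (\<lambda>a b c d. m' (w a b c d) a b (w a b c d))"
    note proj = term_op4_proj[of \<sigma> D]
    have w: "term_op4 \<sigma> D w"
      unfolding w_def by (rule term_op4_comp[OF algebra t(1) q(1) proj(2) proj(1) q(1)])
    have "term_op4 \<sigma> D q'"
      unfolding q'_def by (rule term_op4_comp[OF algebra t(2) w proj(1) proj(2) w])
    moreover have "q' a a c d = c" if "a \<in> carrier D" "c \<in> carrier D" "d \<in> carrier D" for a c d
      using that by (simp add: q'_def w_def q(2) i)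
    moreover have "(q' a b b b, m' b b b a) \<in> \<delta>" if ab: "(a, b) \<in> \<theta>" for a b
    proof -
      have ba: "(b, a) \<in> \<theta>" using congruenceD(4)[OF \<theta> ab] .
      note c = car[OF ab]
      note N_refl = square_relD(2)[OF N]
      \<comment> \<open>Both \<open>n b b a a\<close> and \<open>n e b a e\<close> are
        \<open>b + (k - l)(a - b)\<close> in the affine picture. In general they form the bottom row
        of a square whose top row is constantly \<open>e\<close>, by Day's identity.\<close>
      have key: "(n b b b a, b) \<in> \<theta> \<and> (n b b a a, n (n b b b a) b a (n b b b a)) \<in> \<delta>"
        if n: "day_op n" for n
      proof -
        define e where "e = n b b b a"
        have nt: "term_op4 \<sigma> D n" and ni: "\<And>a b. a \<in> carrier D \<Longrightarrow> b \<in> carrier D \<Longrightarrow> n a b b a = a"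
          using n by (auto simp: day_op_def)
        have eb: "(e, b) \<in> \<theta>"
          using congruence_term_op4[OF \<theta> nt congruenceD(3)[OF \<theta> c(2)] congruenceD(3)[OF \<theta> c(2)]
              congruenceD(3)[OF \<theta> c(2)] ab] ni c by (simp add: e_def)
        have "N (n b b b a) (n e b b e) (n b b a a) (n e b a e)"
          by (rule square_rel_term_op4[OF N nt row[OF congruenceD(4)[OF \<theta> eb]] N_refl[OF c(2)] col[OF ba]
                row[OF congruenceD(5)[OF \<theta> ab congruenceD(4)[OF \<theta> eb]]]])
        then show ?thesis
          using term_conditionD[OF tc, of "n b b b a" "n e b b e"] ni[OF car(1)[OF eb] c(2)] eb
            congruenceD(3)[OF \<delta>, of e] congruenceD(1)[OF \<theta> eb] by (simp add: e_def)
      qed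
      define e where "e = m b b b a"
      define e' where "e' = m' b b b a"
      define w' where "w' = m' e' b a e'"
      have e: "(e, b) \<in> \<theta>" "(m b b a a, m e b a e) \<in> \<delta>" using key[OF day(1)] by (simp_all add: e_def)
      have e': "(e', b) \<in> \<theta>" "(m' b b a a, w') \<in> \<delta>" using key[OF day(2)] by (simp_all add: e'_def w'_def)
      have ce': "e' \<in> carrier D" using car(1)[OF e'(1)] .
      have cw': "w' \<in> carrier D" unfolding w'_def by (rule term_op4_closed[OF algebra t(2) ce' c(2,1) ce'])
      have "(w', e') \<in> \<theta>"
        using congruence_term_op4[OF \<theta> t(2) congruenceD(3)[OF \<theta> ce'] congruenceD(3)[OF \<theta> c(2)] ab
            congruenceD(3)[OF \<theta> ce']] i(2)[OF ce' c(2)] by (simp add: w'_def)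
      \<comment> \<open>Modulo \<open>\<delta>\<close>, \<open>u \<mapsto> m' u a b u\<close> undoes
        the step from \<open>e'\<close> to \<open>w'\<close> made by
        \<open>u \<mapsto> m' u b a u\<close>: the top row of this square is constantly
        \<open>w'\<close>, and its bottom row compares the result with \<open>e'\<close>.\<close>
      then have "N (m' w' a a w') (m' e' b a e') (m' w' a b w') (m' e' b b e')"
        by (intro square_rel_term_op4[OF N t(2) row row[OF ab] col[OF ab] row])
      then have w'e': "(m' w' a b w', e') \<in> \<delta>"
        using term_conditionD[OF tc, of "m' w' a a w'" "m' e' b a e'"] i(2) c ce' cw'
          congruenceD(3)[OF \<delta> cw'] by (simp add: w'_def)
      have "(q a b b b, e) \<in> \<delta>" using q(3)[OF ab] by (simp add: e_def)
      then have "(w a b b b, m e b a e) \<in> \<delta>"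
        unfolding w_def
        using congruence_term_op4[OF \<delta> t(1) _ congruenceD(3)[OF \<delta> c(2)] congruenceD(3)[OF \<delta> c(1)]] by blast
      moreover have "m b b a a = m' b b a a" using * c by (simp add: in_carrier4_def)
      ultimately have "(w a b b b, w') \<in> \<delta>" using e(2) e'(2) congruenceD(4,5)[OF \<delta>] by metis
      then have "(q' a b b b, m' w' a b w') \<in> \<delta>"
        unfolding q'_def
        using congruence_term_op4[OF \<delta> t(2) _ congruenceD(3)[OF \<delta> c(1)] congruenceD(3)[OF \<delta> c(2)]] by blast
      then show ?thesis using w'e' congruenceD(5)[OF \<delta>] unfolding e'_def by blast
    qed
    ultimately show "?Q m'" by blast
  next
    fix m assume "?Q m" and *: "\<And>a b c d. in_carrier4 a b c d \<Longrightarrow> m a b c d = d"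
    then obtain q where q: "term_op4 \<sigma> D q"
      "\<And>a c d. \<lbrakk>a \<in> carrier D; c \<in> carrier D; d \<in> carrier D\<rbrakk> \<Longrightarrow> q a a c d = c"
      "\<And>a b. (a, b) \<in> \<theta> \<Longrightarrow> (q a b b b, m b b b a) \<in> \<delta>"
      by blast
    moreover have "m b b b a = a" if "(a, b) \<in> \<theta>" for a b
      using * car[OF that] by (simp add: in_carrier4_def)
    ultimately show thesis using that[of q] by metis
  qed
qed

end

section \<open>Congruences as algebras of pairs\<close>

definition pair_algebra :: "('f, 'a) ualgebra \<Rightarrow> ('a \<times> 'a) set \<Rightarrow> ('f, 'a \<times> 'a) ualgebra" where
  "pair_algebra D y = \<lparr>carrier = y, opr = (\<lambda>f ps. (opr D f (map fst ps), opr D f (map snd ps)))\<rparr>"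

lemma carrier_pair_algebra [simp]: "carrier (pair_algebra D y) = y"
  by (simp add: pair_algebra_def)

lemma opr_pair_algebra: "opr (pair_algebra D y) f ps = (opr D f (map fst ps), opr D f (map snd ps))"
  by (simp add: pair_algebra_def)

lemma trm_val_pair_algebra:
  "trm_val (pair_algebra D y) \<rho> t = (trm_val D (fst \<circ> \<rho>) t, trm_val D (snd \<circ> \<rho>) t)"
proof (induction t)
  case (Op f ts)
  then show ?case by (auto simp: opr_pair_algebra o_def intro!: arg_cong[where f = "opr D f"])
qed simp

lemma is_algebra_pair_algebra:
  assumes y: "congruence \<sigma> D y"
  shows "is_algebra \<sigma> (pair_algebra D y)"
  unfolding is_algebra_def carrier_pair_algebra opr_pair_algebra
proof (intro allI impI)
  fix f ps assume *: "\<sigma> f = Some (length ps) \<and> set ps \<subseteq> y"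
  have "list_all2 (\<lambda>a b. (a, b) \<in> y) (map fst ps) (map snd ps)"
    using * subsetD[OF conjunct2[OF *] nth_mem] by (simp add: list_all2_conv_all_nth)
  then show "(opr D f (map fst ps), opr D f (map snd ps)) \<in> y"
    using * by (intro congruenceD(6)[OF y]) auto
qed

lemma in_variety_pair_algebra:
  assumes "in_variety \<sigma> E D" and y: "congruence \<sigma> D y"
  shows "in_variety \<sigma> E (pair_algebra D y)"
proof -
  have "trm_val D (g \<circ> \<rho>) s = trm_val D (g \<circ> \<rho>) t"
    if "(s, t) \<in> E" "range \<rho> \<subseteq> y" "g = fst \<or> g = snd" for s t \<rho> and g :: "'b \<times> 'b \<Rightarrow> 'b"
  proof -
    have "\<rho> n \<in> y" for n using that(2) by blast
    then have "fst (\<rho> n) \<in> carrier D" "snd (\<rho> n) \<in> carrier D" for n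
      using congruenceD(1,2)[OF y] by (metis prod.collapse)+
    then have "range (g \<circ> \<rho>) \<subseteq> carrier D" using that(3) by auto
    then show ?thesis using assms(1) that(1) by (auto simp: in_variety_def)
  qed
  then show ?thesis
    using is_algebra_pair_algebra[OF y] by (auto simp: in_variety_def trm_val_pair_algebra)
qed

section \<open>Existence of a missing corner\<close>

context modular_algebra
begin

text \<open>With \<open>R\<close> the congruence of vertical pairs defined by \<open>M\<close>, the kernel \<open>\<eta>\<close> of the first projection and
  the congruence \<open>\<theta>\<close> of pairs that are \<open>x\<close>-related in both components, modularity gives
  \<open>\<theta> = R \<or> (\<eta> \<and> \<theta>)\<close>. The latter centralizes itself modulo \<open>R\<close>, hence so does \<open>\<theta>\<close>, and the difference
  term is a Maltsev operation on \<open>\<theta>\<close>-classes modulo \<open>R\<close>.\<close>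

lemma complete_square:
  assumes x: "congruence \<sigma> D x" and y: "congruence \<sigma> D y" and \<delta>: "congruence \<sigma> D \<delta>"
    and M: "centralizing \<sigma> D \<delta> M" "saturated \<delta> M"
    and closed: "comp_closed M"
    and Mx: "\<And>a b c d. M a b c d \<Longrightarrow> (a, b) \<in> x" and My: "\<And>a b c d. M a b c d \<Longrightarrow> (a, c) \<in> y"
    and row: "\<And>a b. (a, b) \<in> x \<Longrightarrow> M a b a b" and col: "\<And>a b. (a, b) \<in> y \<Longrightarrow> M a a b b"
    and f: "(f1, f2) \<in> x" "(f1, f3) \<in> y" "(f3, f4) \<in> x" "(f2, f4) \<in> y"
  obtains e where "M f1 f2 e f4"
proof -
  define B where "B = pair_algebra D y"
  have carB [simp]: "carrier B = y" by (simp add: B_def)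
  interpret B: modular_algebra \<sigma> E B
    by unfold_locales (simp_all add: B_def modular in_variety_pair_algebra[OF in_variety y])
  have sq: "square_rel \<sigma> D M" and tc: "term_condition \<delta> M" "term_condition \<delta> (flip4 M)"
    using M(1) by (simp_all add: centralizing_def)
  note carx = congruenceD(1,2)[OF x] and cary = congruenceD(1,2)[OF y]
  have c: "f1 \<in> carrier D" "f2 \<in> carrier D" "f3 \<in> carrier D" "f4 \<in> carrier D"
    using carx[OF f(1)] carx[OF f(3)] by auto
  have My': "(b, d) \<in> y" if "M a b c d" for a b c d using My[OF square_relD(4)[OF sq that]] .
  have Mx': "(c, d) \<in> x" if "M a b c d" for a b c d using Mx[OF square_relD(5)[OF sq that]] .
  define R where "R = {(V, W). M (fst V) (fst W) (snd V) (snd W)}"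
  define \<theta> where "\<theta> = {(V, W). V \<in> y \<and> W \<in> y \<and> (fst V, fst W) \<in> x \<and> (snd V, snd W) \<in> x}"
  define \<eta> where "\<eta> = {(V, W). V \<in> y \<and> W \<in> y \<and> fst V = fst W}"
  have opr_y: "opr B f Vs \<in> y" if "\<sigma> f = Some (length Vs)" "\<And>i. i < length Vs \<Longrightarrow> Vs ! i \<in> y" for f Vs
  proof -
    have "set Vs \<subseteq> carrier B" using that(2) unfolding set_conv_nth carB by blast
    then show ?thesis using is_algebraD[OF B.algebra that(1)] by simp
  qed
  have R: "congruence \<sigma> B R"
  proof (rule congruenceI)
    show "R \<subseteq> carrier B \<times> carrier B" using My My' by (force simp: R_def)
    show "(V, V) \<in> R" if "V \<in> carrier B" for V using that col by (cases V) (simp add: R_def)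
    show "(W, V) \<in> R" if "(V, W) \<in> R" for V W using that square_relD(4)[OF sq] by (simp add: R_def)
    show "(V, U) \<in> R" if "(V, W) \<in> R" "(W, U) \<in> R" for V W U using that comp_closedD(1)[OF closed] unfolding R_def by blast
    fix f Vs Ws assume "\<sigma> f = Some (length Vs)" "list_all2 (\<lambda>V W. (V, W) \<in> R) Vs Ws"
    then show "(opr B f Vs, opr B f Ws) \<in> R"
      by (auto simp: R_def B_def opr_pair_algebra list_all2_conv_all_nth
          intro!: compatible4D[OF square_relD(1)[OF sq]])
  qed
  have \<theta>: "congruence \<sigma> B \<theta>"
  proof (rule congruenceI)
    show "(V, V) \<in> \<theta>" if "V \<in> carrier B" for V
      using that cary congruenceD(3)[OF x] by (cases V) (auto simp: \<theta>_def)
    show "(W, V) \<in> \<theta>" if "(V, W) \<in> \<theta>" for V W using that congruenceD(4)[OF x] by (simp add: \<theta>_def)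
    show "(V, U) \<in> \<theta>" if "(V, W) \<in> \<theta>" "(W, U) \<in> \<theta>" for V W U
      using that congruenceD(5)[OF x] unfolding \<theta>_def by blast
    fix f Vs Ws assume "\<sigma> f = Some (length Vs)" "list_all2 (\<lambda>V W. (V, W) \<in> \<theta>) Vs Ws"
    then show "(opr B f Vs, opr B f Ws) \<in> \<theta>"
      using opr_y[of f Vs] opr_y[of f Ws]
      by (auto simp: \<theta>_def B_def opr_pair_algebra list_all2_conv_all_nth intro!: congruenceD(6)[OF x])
  qed (auto simp: \<theta>_def)
  have \<eta>: "congruence \<sigma> B \<eta>"
  proof (rule congruenceI)
    fix f Vs Ws assume f: "\<sigma> f = Some (length Vs)" "list_all2 (\<lambda>V W. (V, W) \<in> \<eta>) Vs Ws"
    then have "map fst Vs = map fst Ws"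
      by (intro nth_equalityI) (auto simp: list_all2_conv_all_nth \<eta>_def)
    then show "(opr B f Vs, opr B f Ws) \<in> \<eta>"
      using f opr_y[of f Vs] opr_y[of f Ws]
      by (auto simp: \<eta>_def B_def opr_pair_algebra list_all2_conv_all_nth)
  qed (auto simp: \<eta>_def)
  have join: "\<theta> \<subseteq> (R \<union> (\<eta> \<inter> \<theta>))\<^sup>+"
  proof -
    have "\<theta> \<subseteq> (R \<union> \<eta>)\<^sup>+"
    proof
      fix p assume "p \<in> \<theta>"
      then obtain a b c d where p: "p = ((a, b), (c, d))" "(a, b) \<in> y" "(c, d) \<in> y" "(a, c) \<in> x"
        by (auto simp: \<theta>_def)
      have "((a, b), (a, a)) \<in> \<eta>" "((c, c), (c, d)) \<in> \<eta>"
        using p cary congruenceD(3)[OF y] by (auto simp: \<eta>_def)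
      moreover have "((a, a), (c, c)) \<in> R" using row[OF p(4)] by (simp add: R_def)
      ultimately show "p \<in> (R \<union> \<eta>)\<^sup>+" unfolding p(1)
        by (meson UnCI r_into_trancl trancl_into_trancl)
    qed
    moreover have "R \<subseteq> \<theta>" using My My' Mx Mx' by (force simp: R_def \<theta>_def)
    ultimately show ?thesis
      using congruence_modular_variety_all_types[OF modular B.in_variety] R \<theta> \<eta>
      unfolding modular_lattice_Cong_iff[OF B.algebra] by blast
  qed
  \<comment> \<open>Inside an \<open>\<eta>\<close>-class a pair is determined by its second
    component, and \<open>R\<close> amounts to \<open>\<delta>\<close> on these components. The term
    condition for \<open>M\<close> modulo \<open>\<delta>\<close> thus becomes one for
    \<open>N\<close> modulo \<open>R\<close>.\<close>
  define N where "N = (\<lambda>V1 V2 V3 V4. {V1, V2, V3, V4} \<subseteq> y \<and> fst V1 = fst V2 \<and> fst V1 = fst V3 \<and>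
    fst V1 = fst V4 \<and> M (snd V1) (snd V2) (snd V3) (snd V4))"
  have N: "square_rel \<sigma> B N"
    unfolding square_rel_def
  proof (intro conjI allI impI ballI)
    show "compatible4 \<sigma> B N"
      unfolding compatible4_def
    proof (intro allI impI, elim conjE)
      fix f V1 V2 V3 V4
      assume l: "\<sigma> f = Some (length V1)" "length V2 = length V1" "length V3 = length V1" "length V4 = length V1"
        and n: "\<forall>i<length V1. N (V1 ! i) (V2 ! i) (V3 ! i) (V4 ! i)"
      have "map fst V2 = map fst V1" "map fst V3 = map fst V1" "map fst V4 = map fst V1"
        using l n by (auto simp: N_def intro!: nth_equalityI)
      moreover have "M (opr D f (map snd V1)) (opr D f (map snd V2)) (opr D f (map snd V3)) (opr D f (map snd V4))"
        using l n by (intro compatible4D[OF square_relD(1)[OF sq]]) (auto simp: N_def)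
      moreover have "opr B f V1 \<in> y" "opr B f V2 \<in> y" "opr B f V3 \<in> y" "opr B f V4 \<in> y"
        using l n by (auto intro!: opr_y simp: N_def)
      ultimately show "N (opr B f V1) (opr B f V2) (opr B f V3) (opr B f V4)"
        by (simp add: N_def B_def opr_pair_algebra)
    qed
    show "N V V V V" if "V \<in> carrier B" for V
      using that cary[of "fst V" "snd V"] square_relD(2)[OF sq] by (simp add: N_def)
    fix V1 V2 V3 V4 assume n: "N V1 V2 V3 V4"
    then have m: "M (snd V1) (snd V2) (snd V3) (snd V4)" by (simp add: N_def)
    show "{V1, V2, V3, V4} \<subseteq> carrier B" using n by (simp add: N_def)
    show "N V2 V1 V4 V3" "N V3 V4 V1 V2" "N V1 V2 V1 V2" "N V1 V1 V3 V3"
      using n square_relD(4-7)[OF sq m] by (auto simp: N_def)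
  qed
  have R_iff: "(V, W) \<in> R \<longleftrightarrow> (snd V, snd W) \<in> \<delta>" if "V \<in> y" "W \<in> y" "fst V = fst W" for V W
  proof
    have V: "(fst V, snd V) \<in> y" using that(1) by simp
    assume "(V, W) \<in> R"
    then have "M (fst V) (fst V) (snd V) (snd W)" using that by (simp add: R_def)
    then show "(snd V, snd W) \<in> \<delta>" using congruenceD(3)[OF \<delta>] cary[OF V] by (blast intro: term_conditionD[OF tc(1)])
  next
    have V: "(fst V, snd V) \<in> y" using that(1) by simp
    assume "(snd V, snd W) \<in> \<delta>"
    then have "M (fst V) (fst V) (snd V) (snd W)"
      using saturatedD[OF M(2) col[OF V]] congruenceD(3)[OF \<delta>] cary[OF V] by blast
    then show "(V, W) \<in> R" using that by (simp add: R_def)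
  qed
  have N_tc: "centralizing \<sigma> B R N"
  proof -
    have "(V3, V4) \<in> R" if "N V1 V2 V3 V4" "(V1, V2) \<in> R" for V1 V2 V3 V4
    proof -
      have n: "V1 \<in> y" "V2 \<in> y" "fst V1 = fst V2" "V3 \<in> y" "V4 \<in> y" "fst V3 = fst V4"
        using that(1) by (auto simp: N_def)
      have "(snd V1, snd V2) \<in> \<delta>" using R_iff[OF n(1-3)] that(2) by blast
      then have "(snd V3, snd V4) \<in> \<delta>"
        using term_conditionD[OF tc(1), of "snd V1" "snd V2" "snd V3" "snd V4"] that(1) by (simp add: N_def)
      then show ?thesis using R_iff[OF n(4-6)] by blast
    qed
    moreover have "(V2, V4) \<in> R" if "N V1 V2 V3 V4" "(V1, V3) \<in> R" for V1 V2 V3 V4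
    proof -
      have n: "V1 \<in> y" "V3 \<in> y" "fst V1 = fst V3" "V2 \<in> y" "V4 \<in> y" "fst V2 = fst V4"
        using that(1) by (auto simp: N_def)
      have "(snd V1, snd V3) \<in> \<delta>" using R_iff[OF n(1-3)] that(2) by blast
      then have "(snd V2, snd V4) \<in> \<delta>"
        using term_conditionD[OF tc(2), of "snd V1" "snd V3" "snd V2" "snd V4"] that(1) by (simp add: N_def flip4_def)
      then show ?thesis using R_iff[OF n(4-6)] by blast
    qed
    ultimately show ?thesis
      using N unfolding centralizing_def term_condition_def flip4_def by blast
  qed
  \<comment> \<open>Saturation supplies the trivial squares over \<open>R\<close>, and compositions
    extend them from \<open>R\<close> and \<open>\<eta> \<inter> \<theta>\<close> to the join, which
    contains \<open>\<theta>\<close>.\<close>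
  obtain M' where M': "centralizing \<sigma> B R M'" "saturated R M'"
    "saturation R N \<le> M'" "comp_closed M'"
    "\<forall>x. trans x \<longrightarrow> (\<forall>a b c d. saturation R N a b c d \<longrightarrow> (a, b) \<in> x) \<longrightarrow> (\<forall>a b c d. M' a b c d \<longrightarrow> (a, b) \<in> x)"
    "\<forall>y. trans y \<longrightarrow> (\<forall>a b c d. saturation R N a b c d \<longrightarrow> (a, c) \<in> y) \<longrightarrow> (\<forall>a b c d. M' a b c d \<longrightarrow> (a, c) \<in> y)"
    by (rule B.comp_closure[OF centralizing_saturation[OF R N_tc] R saturated_saturation[OF R]])
  have sq': "square_rel \<sigma> B M'" using M'(1) by (simp add: centralizing_def)
  have gen: "M' V W V W \<and> M' V V W W" if VW: "(V, W) \<in> R \<union> (\<eta> \<inter> \<theta>)" for V W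
  proof (cases "(V, W) \<in> R")
    case True
    then have VW: "(V, V) \<in> R" "(V, W) \<in> R" using congruenceD(1,3)[OF R] by blast+
    then have "M' V V V V" using square_relD(2)[OF sq'] congruenceD(1)[OF R] by blast
    then show ?thesis using VW saturatedD[OF M'(2)] by blast
  next
    case False
    then have s: "V \<in> y" "W \<in> y" "fst V = fst W" "(snd V, snd W) \<in> x" using VW by (auto simp: \<eta>_def \<theta>_def)
    have "(fst V, snd V) \<in> y" using s(1) by simp
    moreover have "(fst V, snd W) \<in> y" using s(2,3) by simp
    \<comment> \<open>Pairs with a common first component have \<open>y\<close>-related second
      components. Together with the relation by \<open>x\<close>, the second components can serve
      both as a row and as a column of \<open>M\<close>, so that
      \<open>\<eta> \<inter> \<theta>\<close> centralizes itself.\<close>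
    ultimately have "(snd V, snd W) \<in> y" using congruenceD(4,5)[OF y] by blast
    then have "N V W V W" "N V V W W" using s row col by (simp_all add: N_def)
    then show ?thesis using M'(3) saturation_incr[OF N R] unfolding le_fun_def le_bool_def by blast
  qed
  have "M' V W V W \<and> M' V V W W" if "(V, W) \<in> (R \<union> (\<eta> \<inter> \<theta>))\<^sup>+" for V W
    using that
  proof (induction rule: trancl_induct)
    case (step W U)
    then show ?case using gen[OF step(2)] comp_closedD(1)[OF M'(4), of V W V W U U] comp_closedD(2)[OF M'(4), of V V W W U U] by blast
  qed (use gen in blast)
  then have M'\<theta>: "M' V W V W" "M' V V W W" if "(V, W) \<in> \<theta>" for V W using that join by blast+
  have "term_condition R M'" using M'(1) by (simp add: centralizing_def)
  then obtain P where P: "term_op4 \<sigma> B P"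
    "\<forall>a\<in>carrier B. \<forall>c\<in>carrier B. \<forall>d\<in>carrier B. P a a c d = c"
    "\<forall>a b. (a, b) \<in> \<theta> \<longrightarrow> (P a b b b, a) \<in> R"
    by (rule B.difference_term[OF sq' _ R \<theta> M'\<theta>])
  then have P: "term_op4 \<sigma> B P" "\<And>a c d. \<lbrakk>a \<in> y; c \<in> y; d \<in> y\<rbrakk> \<Longrightarrow> P a a c d = c"
    "\<And>a b. (a, b) \<in> \<theta> \<Longrightarrow> (P a b b b, a) \<in> R"
    unfolding carB by blast+
  obtain t where t: "\<And>a b c d. \<lbrakk>a \<in> y; b \<in> y; c \<in> y; d \<in> y\<rbrakk> \<Longrightarrow> P a b c d = trm_val B (valuation4 a b c d) t"
    using P(1) unfolding term_op4_def carB by blast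
  define p where "p = (\<lambda>a b c d. trm_val D (valuation4 a b c d) t)"
  have Pp: "P a b c d = (p (fst a) (fst b) (fst c) (fst d), p (snd a) (snd b) (snd c) (snd d))"
    if "a \<in> y" "b \<in> y" "c \<in> y" "d \<in> y" for a b c d
  proof -
    have "g \<circ> valuation4 a b c d = valuation4 (g a) (g b) (g c) (g d)" for g :: "'a \<times> 'a \<Rightarrow> 'a"
      by (simp add: fun_eq_iff valuation4_def)
    then show ?thesis by (simp add: t[OF that] B_def trm_val_pair_algebra p_def)
  qed
  have p: "p a a b b = b" if "a \<in> carrier D" "b \<in> carrier D" for a b
    using P(2)[of "(a, a)" "(b, b)" "(b, b)"] Pp[of "(a, a)" "(a, a)" "(b, b)" "(b, b)"]
      congruenceD(3)[OF y] that by simp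
  \<comment> \<open>The column \<open>W\<close> is to be moved within its \<open>R\<close>-class to
    one starting with \<open>f1\<close>. The term is Maltsev only modulo \<open>R\<close>, so
    \<open>p f1 f2 f2 f2\<close> may differ from \<open>f1\<close>; but it is the first component of
    both \<open>V1\<close> and \<open>V2\<close>, and therefore cancels exactly in \<open>U\<close>.
    Modulo \<open>R\<close>, \<open>V1\<close> is \<open>W\<close> and \<open>V2\<close> is
    \<open>V\<close>, which turns \<open>U\<close> into \<open>P W V V V\<close>, that is, into
    \<open>W\<close>.\<close>
  define V where "V = (f1, f3)"
  define W where "W = (f2, f4)"
  define V1 where "V1 = P (f1, f1) (f2, f2) W W"
  define V2 where "V2 = P V W W W"
  define U where "U = P V1 V2 V V"
  have yVW: "V \<in> y" "W \<in> y" "(f1, f1) \<in> y" "(f2, f2) \<in> y"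
    using f c congruenceD(3)[OF y] by (auto simp: V_def W_def)
  have y12: "V1 \<in> y" "V2 \<in> y"
    using term_op4_closed[OF B.algebra P(1)] yVW by (simp_all add: V1_def V2_def)
  note r = congruenceD(3)[OF R, unfolded carB]
  have "((f1, f1), (f2, f2)) \<in> R" using row[OF f(1)] by (simp add: R_def)
  then have "(V1, P (f2, f2) (f2, f2) W W) \<in> R"
    unfolding V1_def by (rule congruence_term_op4[OF R P(1) _ r[OF yVW(4)] r[OF yVW(2)] r[OF yVW(2)]])
  then have V1: "(V1, W) \<in> R" using P(2) yVW by simp
  have VW: "(V, W) \<in> \<theta>" using f yVW by (simp add: \<theta>_def V_def W_def)
  have V2: "(V2, V) \<in> R" unfolding V2_def by (rule P(3)[OF VW])
  have "(U, P W V V V) \<in> R"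
    unfolding U_def by (rule congruence_term_op4[OF R P(1) V1 V2 r[OF yVW(1)] r[OF yVW(1)]])
  then have UW: "(U, W) \<in> R" using P(3)[OF congruenceD(4)[OF \<theta> VW]] congruenceD(5)[OF R] by blast
  have "fst V1 = fst V2" using Pp yVW by (simp add: V1_def V2_def V_def W_def)
  moreover have "fst V1 \<in> carrier D" using y12 cary[of "fst V1" "snd V1"] by simp
  ultimately have "fst U = f1"
    using Pp[OF y12 yVW(1) yVW(1)] p c by (simp add: U_def V_def)
  then have "M f1 f2 (snd U) f4" using UW by (simp add: R_def W_def)
  then show thesis by (rule that)
qed

end

section \<open>The commutator in congruence modular varieties\<close>

text \<open>For congruences \<open>x\<close> and \<open>y\<close> this is the subalgebra of the
  fourth power of \<open>A\<close> known as the algebra of matrices in the term condition definition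
  of the commutator.\<close>

inductive gen_square ::
  "'f signature \<Rightarrow> ('f, 'a) ualgebra \<Rightarrow> ('a \<times> 'a) set \<Rightarrow> ('a \<times> 'a) set \<Rightarrow> 'a \<Rightarrow> 'a \<Rightarrow> 'a \<Rightarrow> 'a \<Rightarrow> bool"
  for \<sigma> A x y where
  row: "(a, b) \<in> x \<Longrightarrow> gen_square \<sigma> A x y a b a b"
| col: "(a, b) \<in> y \<Longrightarrow> gen_square \<sigma> A x y a a b b"
| opr: "\<lbrakk>\<sigma> f = Some (length xs); length ys = length xs; length zs = length xs; length ws = length xs;
    \<And>i. i < length xs \<Longrightarrow> gen_square \<sigma> A x y (xs ! i) (ys ! i) (zs ! i) (ws ! i)\<rbrakk> \<Longrightarrow>
    gen_square \<sigma> A x y (opr A f xs) (opr A f ys) (opr A f zs) (opr A f ws)"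

lemma gen_square_sides:
  assumes x: "congruence \<sigma> A x" and y: "congruence \<sigma> A y" and "gen_square \<sigma> A x y a b c d"
  shows "(a, b) \<in> x \<and> (c, d) \<in> x \<and> (a, c) \<in> y \<and> (b, d) \<in> y"
  using assms(3)
proof induction
  case (row a b)
  then show ?case using congruenceD(1,2)[OF x] congruenceD(3)[OF y] by blast
next
  case (col a b)
  then show ?case using congruenceD(1,2)[OF y] congruenceD(3)[OF x] by blast
next
  case (opr f xs ys zs ws)
  then show ?case
    by (auto intro!: congruenceD(6)[OF x] congruenceD(6)[OF y] simp: list_all2_conv_all_nth)
qed

lemma square_rel_gen_square:
  assumes x: "congruence \<sigma> A x" and y: "congruence \<sigma> A y"
  shows "square_rel \<sigma> A (gen_square \<sigma> A x y)"
  unfolding square_rel_def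
proof (intro conjI allI impI ballI)
  show "compatible4 \<sigma> A (gen_square \<sigma> A x y)"
    unfolding compatible4_def by (intro allI impI, elim conjE, rule gen_square.opr) auto
  show "gen_square \<sigma> A x y a a a a" if "a \<in> carrier A" for a
    by (rule gen_square.row[OF congruenceD(3)[OF x that]])
  fix a b c d assume g: "gen_square \<sigma> A x y a b c d"
  note s = gen_square_sides[OF x y g]
  show "{a, b, c, d} \<subseteq> carrier A" using s congruenceD(1,2)[OF x] by blast
  show "gen_square \<sigma> A x y a b a b" by (rule gen_square.row) (use s in blast)
  show "gen_square \<sigma> A x y a a c c" by (rule gen_square.col) (use s in blast)
  show "gen_square \<sigma> A x y b a d c"
    using g
  proof induction
    case (row a b)
    show ?case by (rule gen_square.row[OF congruenceD(4)[OF x row]])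
  next
    case (opr f xs ys zs ws)
    then show ?case by (auto intro: gen_square.opr)
  qed (rule gen_square.col)
  show "gen_square \<sigma> A x y c d a b"
    using g
  proof induction
    case (col a b)
    show ?case by (rule gen_square.col[OF congruenceD(4)[OF y col]])
  next
    case (opr f xs ys zs ws)
    then show ?case by (auto intro: gen_square.opr)
  qed (rule gen_square.row)
qed

lemma class_eq:
  assumes "congruence \<sigma> A \<theta>" "a \<in> carrier A" "b \<in> carrier A"
  shows "\<theta> `` {a} = \<theta> `` {b} \<longleftrightarrow> (a, b) \<in> \<theta>"
  using assms eq_equiv_class_iff[of "carrier A" \<theta> a b] by (simp add: congruence_def)

text \<open>On a trivial square one of the two unit laws, \<open>f2 = f4\<close> for rows and
  \<open>f1 = f2\<close> for columns, forces the value to be the third entry. Since \<open>m\<close>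
  and \<open>\<phi>1\<close> are homomorphisms, this spreads to all generated squares.\<close>

lemma pseudogroupoid_gen_square:
  assumes x: "congruence \<sigma> A x" and y: "congruence \<sigma> A y"
    and m: "pseudogroupoid_structure \<sigma> T m"
    and \<phi>: "span_morphism \<sigma> (quot_span A x y) T \<phi>0 \<phi>1 \<phi>0'"
    and g: "gen_square \<sigma> A x y a b c d"
  shows "(\<phi>1 a, \<phi>1 b, \<phi>1 c, \<phi>1 d) \<in> quads T" "m (\<phi>1 a, \<phi>1 b, \<phi>1 c, \<phi>1 d) = \<phi>1 c"
proof -
  have h: "\<phi>1 \<in> alg_hom \<sigma> A (ob1 T)"
    and l: "\<And>a. a \<in> carrier A \<Longrightarrow> leg T (\<phi>1 a) = \<phi>0 (x `` {a})"
    "\<And>a. a \<in> carrier A \<Longrightarrow> leg' T (\<phi>1 a) = \<phi>0' (y `` {a})"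
    using \<phi> by (auto simp: span_morphism_def quot_span_def)
  have q: "(\<phi>1 a, \<phi>1 b, \<phi>1 c, \<phi>1 d) \<in> quads T" if g: "gen_square \<sigma> A x y a b c d" for a b c d
  proof -
    note s = gen_square_sides[OF x y g]
    then have car: "a \<in> carrier A" "b \<in> carrier A" "c \<in> carrier A" "d \<in> carrier A"
      using congruenceD(1,2)[OF x] by blast+
    then have "x `` {a} = x `` {b}" "x `` {c} = x `` {d}" "y `` {a} = y `` {c}" "y `` {b} = y `` {d}"
      using s class_eq[OF x] class_eq[OF y] by blast+
    then show ?thesis using l car alg_hom_carrier[OF h] by (simp add: quads_def)
  qed
  show "(\<phi>1 a, \<phi>1 b, \<phi>1 c, \<phi>1 d) \<in> quads T" by (rule q[OF g])
  note mD = pseudogroupoid_structureD[OF m]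
  show "m (\<phi>1 a, \<phi>1 b, \<phi>1 c, \<phi>1 d) = \<phi>1 c"
    using g
  proof induction
    case (row a b)
    show ?case by (rule mD(6)[OF q[OF gen_square.row[OF row]]])
  next
    case (col a b)
    show ?case by (rule mD(5)[OF q[OF gen_square.col[OF col]]])
  next
    case (opr f xs ys zs ws)
    define qs where "qs = map (\<lambda>i. (\<phi>1 (xs ! i), \<phi>1 (ys ! i), \<phi>1 (zs ! i), \<phi>1 (ws ! i))) [0..<length xs]"
    have sub: "set xs \<subseteq> carrier A" "set ys \<subseteq> carrier A" "set zs \<subseteq> carrier A" "set ws \<subseteq> carrier A"
      using opr square_relD(3)[OF square_rel_gen_square[OF x y]]
      by (auto simp: in_set_conv_nth) blast+
    have "set qs \<subseteq> carrier (quad_algebra T)"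
      using opr q by (auto simp: qs_def quad_algebra_def)
    then have "m (ualgebra.opr (quad_algebra T) f qs) = ualgebra.opr (ob1 T) f (map m qs)"
      using alg_homD[OF mD(1), of f qs] opr by (simp add: qs_def)
    moreover have "map m qs = map \<phi>1 zs" using opr by (auto simp: qs_def intro!: nth_equalityI)
    moreover have "map (\<lambda>(f1, f2, f3, f4). f1) qs = map \<phi>1 xs" "map (\<lambda>(f1, f2, f3, f4). f2) qs = map \<phi>1 ys"
      "map (\<lambda>(f1, f2, f3, f4). f3) qs = map \<phi>1 zs" "map (\<lambda>(f1, f2, f3, f4). f4) qs = map \<phi>1 ws"
      using opr by (auto simp: qs_def intro!: nth_equalityI)
    ultimately show ?case
      using alg_homD[OF h, of f xs] alg_homD[OF h, of f ys] alg_homD[OF h, of f zs] alg_homD[OF h, of f ws]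
        opr sub by (simp add: quad_algebra_def)
  qed
qed

text \<open>In every test span the operation returns the third entry of a generated square. If the
  top row collapses, the unit law for \<open>f1 = f2\<close> returns the fourth entry as well, so
  the bottom row collapses. Columns are treated with the mirror image \<open>b a d c\<close> and the
  other unit law.\<close>

lemma centralizing_commutator:
  fixes A :: "('f, 'a) ualgebra"
  assumes x: "congruence \<sigma> A x" and y: "congruence \<sigma> A y"
  shows "centralizing \<sigma> A (commutator \<sigma> E A x y) (gen_square \<sigma> A x y)"
proof -
  note sq = square_rel_gen_square[OF x y]
  have "(c, d) \<in> commutator \<sigma> E A x y"
    if g: "gen_square \<sigma> A x y a b c d" and ab: "(a, b) \<in> commutator \<sigma> E A x y" for a b c d
  proof (rule commutatorI)
    show "c \<in> carrier A" "d \<in> carrier A" using square_relD(3)[OF sq g] by auto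
    fix T :: "('f, 'a list, 'a list, 'a list) alg_span" and m \<phi>0 \<phi>1 \<phi>0'
    assume T: "span_in_variety \<sigma> E T" "pseudogroupoid_structure \<sigma> T m"
      and \<phi>: "span_morphism \<sigma> (quot_span A x y) T \<phi>0 \<phi>1 \<phi>0'"
    have e: "\<phi>1 a = \<phi>1 b" by (rule commutatorD[OF ab T \<phi>])
    show "\<phi>1 c = \<phi>1 d"
      using pseudogroupoid_gen_square[OF x y T(2) \<phi> g, folded e] pseudogroupoid_structureD(5)[OF T(2)] by metis
  qed
  moreover have "(b, d) \<in> commutator \<sigma> E A x y"
    if g: "gen_square \<sigma> A x y a b c d" and ac: "(a, c) \<in> commutator \<sigma> E A x y" for a b c d
  proof (rule commutatorI)
    show "b \<in> carrier A" "d \<in> carrier A" using square_relD(3)[OF sq g] by auto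
    fix T :: "('f, 'a list, 'a list, 'a list) alg_span" and m \<phi>0 \<phi>1 \<phi>0'
    assume T: "span_in_variety \<sigma> E T" "pseudogroupoid_structure \<sigma> T m"
      and \<phi>: "span_morphism \<sigma> (quot_span A x y) T \<phi>0 \<phi>1 \<phi>0'"
    have e: "\<phi>1 a = \<phi>1 c" by (rule commutatorD[OF ac T \<phi>])
    show "\<phi>1 b = \<phi>1 d"
      using pseudogroupoid_gen_square[OF x y T(2) \<phi> square_relD(4)[OF sq g], folded e]
        pseudogroupoid_structureD(6)[OF T(2)] by metis
  qed
  ultimately show ?thesis
    using sq unfolding centralizing_def term_condition_def flip4_def by blast
qed

section \<open>Pseudogroupoid operations on quotients\<close>

lemma carrier_quot_algebra [simp]: "carrier (quot_algebra A \<theta>) = carrier A // \<theta>"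
  by (simp add: quot_algebra_def)

lemma list_of_classes:
  assumes "set Zs \<subseteq> carrier A // \<theta>"
  obtains as where "set as \<subseteq> carrier A" "Zs = map (\<lambda>a. \<theta> `` {a}) as"
proof -
  have "\<exists>as. set as \<subseteq> carrier A \<and> Zs = map (\<lambda>a. \<theta> `` {a}) as"
    using assms
  proof (induction Zs)
    case (Cons Z Zs)
    then obtain as a where "set as \<subseteq> carrier A" "Zs = map (\<lambda>a. \<theta> `` {a}) as" "a \<in> carrier A" "Z = \<theta> `` {a}"
      by (auto elim: quotientE)
    then show ?case by (intro exI[of _ "a # as"]) auto
  qed simp
  then show thesis using that by blast
qed

lemma class_class:
  assumes p: "congruence \<sigma> A p" and x: "congruence \<sigma> A x" and px: "p \<subseteq> x" and a: "a \<in> carrier A"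
  shows "x `` (p `` {a}) = x `` {a}"
proof
  show "x `` (p `` {a}) \<subseteq> x `` {a}" using px congruenceD(5)[OF x] by blast
  show "x `` {a} \<subseteq> x `` (p `` {a})" using congruenceD(3)[OF p a] by blast
qed

lemma quot_algebra_hom_quot:
  assumes A: "is_algebra \<sigma> A" and p: "congruence \<sigma> A p" and x: "congruence \<sigma> A x" and px: "p \<subseteq> x"
  shows "(\<lambda>Z. x `` Z) \<in> alg_hom \<sigma> (quot_algebra A p) (quot_algebra A x)"
  unfolding alg_hom_def
proof (intro CollectI conjI allI impI)
  show "(\<lambda>Z. x `` Z) ` carrier (quot_algebra A p) \<subseteq> carrier (quot_algebra A x)"
    using class_class[OF p x px] by (auto elim!: quotientE intro!: quotientI)
  fix f Zs assume *: "\<sigma> f = Some (length Zs) \<and> set Zs \<subseteq> carrier (quot_algebra A p)"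
  then obtain as where as: "set as \<subseteq> carrier A" "Zs = map (\<lambda>a. p `` {a}) as"
    using list_of_classes[of Zs A p] by auto
  have classes: "map (\<lambda>Z. x `` Z) Zs = map (\<lambda>a. x `` {a}) as"
    using as class_class[OF p x px] by auto
  have "opr (quot_algebra A x) f (map (\<lambda>Z. x `` Z) Zs) = x `` {opr A f as}"
    unfolding classes using alg_homD[OF quot_algebra_hom[OF A x], of f as] * as by simp
  moreover have "opr (quot_algebra A p) f Zs = p `` {opr A f as}"
    using alg_homD[OF quot_algebra_hom[OF A p], of f as] * as by simp
  moreover have "opr A f as \<in> carrier A" using is_algebraD[OF A, of f as] * as by simp
  ultimately show "x `` opr (quot_algebra A p) f Zs = opr (quot_algebra A x) f (map (\<lambda>Z. x `` Z) Zs)"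
    using class_class[OF p x px] by simp
qed

text \<open>Squares in \<open>M\<close> with given entries \<open>a\<close>, \<open>b\<close>, \<open>d\<close> exist and are unique modulo \<open>p\<close>, and the third entry
  is the value of the pseudogroupoid operation.\<close>

lemma quotient_pseudogroupoid:
  fixes p :: "('a \<times> 'a) set"
  assumes A: "is_algebra \<sigma> A"
    and p: "congruence \<sigma> A p" and x: "congruence \<sigma> A x" and y: "congruence \<sigma> A y"
    and px: "p \<subseteq> x" and py: "p \<subseteq> y"
    and M: "centralizing \<sigma> A p M" "saturated p M" "comp_closed M"
    and Mx: "\<And>a b c d. M a b c d \<Longrightarrow> (a, b) \<in> x" and My: "\<And>a b c d. M a b c d \<Longrightarrow> (a, c) \<in> y"
    and row: "\<And>a b. (a, b) \<in> x \<Longrightarrow> M a b a b" and col: "\<And>a b. (a, b) \<in> y \<Longrightarrow> M a a b b"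
    and ex: "\<And>a b c d. \<lbrakk>(a, b) \<in> x; (a, c) \<in> y; (c, d) \<in> x; (b, d) \<in> y\<rbrakk> \<Longrightarrow> \<exists>e. M a b e d"
  defines "T \<equiv> \<lparr>ob0 = quot_algebra A x, ob1 = quot_algebra A p, ob0' = quot_algebra A y,
    leg = (\<lambda>Z. x `` Z), leg' = (\<lambda>Z. y `` Z)\<rparr>"
  shows "\<exists>m. pseudogroupoid_structure \<sigma> T m"
proof -
  define cl where "cl = (\<lambda>a. p `` {a})"
  \<comment> \<open>Collecting all solutions \<open>e\<close> avoids choosing representatives;
    saturation makes the result a full \<open>p\<close>-class. The third argument is ignored, which
    gives law (ii) at once.\<close>
  define m where "m = (\<lambda>(Z1, Z2, Z3 :: 'a set, Z4). {e. \<exists>a\<in>Z1. \<exists>b\<in>Z2. \<exists>d\<in>Z4. M a b e d})"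
  have sq: "square_rel \<sigma> A M" and tc: "term_condition p M" using M(1) by (simp_all add: centralizing_def)
  note refl = congruenceD(3)[OF p]
  have car: "a \<in> carrier A" "b \<in> carrier A" "c \<in> carrier A" "d \<in> carrier A" if "M a b c d" for a b c d
    using square_relD(3)[OF sq that] by auto
  have uniq: "(e, e') \<in> p" if "M a b e d" "M a b e' d" for a b d e e'
  proof -
    \<comment> \<open>One square is pasted to the mirror image of the other along their common
      column \<open>b d\<close>.\<close>
    have "M a a e e'" using comp_closedD(1)[OF M(3) that(1) square_relD(4)[OF sq that(2)]] .
    then show ?thesis using term_conditionD[OF tc] refl[OF car(1)[OF that(1)]] by blast
  qed
  have m_eq: "m (cl a, cl b, Z, cl d) = cl e" if e: "M a b e d" for a b d e Z
  proof
    show "m (cl a, cl b, Z, cl d) \<subseteq> cl e"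
    proof
      fix e' assume "e' \<in> m (cl a, cl b, Z, cl d)"
      then obtain a' b' d' where *: "M a' b' e' d'" "(a, a') \<in> p" "(b, b') \<in> p" "(d, d') \<in> p"
        by (auto simp: m_def cl_def)
      note sym = congruenceD(4)[OF p]
      have "M a b e' d"
        by (rule saturatedD[OF M(2) *(1) sym[OF *(2)] sym[OF *(3)] refl[OF car(3)[OF *(1)]] sym[OF *(4)]])
      then show "e' \<in> cl e" using uniq[OF e] by (simp add: cl_def)
    qed
    show "cl e \<subseteq> m (cl a, cl b, Z, cl d)"
    proof
      fix e' assume "e' \<in> cl e"
      then have "M a b e' d"
        using saturatedD[OF M(2) e] refl car[OF e] by (simp add: cl_def)
      then show "e' \<in> m (cl a, cl b, Z, cl d)"
        using refl car[OF e] by (auto simp: m_def cl_def)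
    qed
  qed
  have cl: "cl a \<in> carrier A // p" if "a \<in> carrier A" for a using that by (simp add: cl_def quotientI)
  have leg: "x `` cl a = x `` {a}" "y `` cl a = y `` {a}" if "a \<in> carrier A" for a
    using class_class[OF p x px that] class_class[OF p y py that] by (simp_all add: cl_def)
  have cl_eq: "cl a = cl b \<longleftrightarrow> (a, b) \<in> p" if "a \<in> carrier A" "b \<in> carrier A" for a b
    using class_eq[OF p that] by (simp add: cl_def)
  have quads: "(cl a, cl b, cl c, cl d) \<in> quads T \<longleftrightarrow> (a, b) \<in> x \<and> (a, c) \<in> y \<and> (c, d) \<in> x \<and> (b, d) \<in> y"
    if "a \<in> carrier A" "b \<in> carrier A" "c \<in> carrier A" "d \<in> carrier A" for a b c d
    using that by (simp add: quads_def T_def cl leg class_eq[OF x] class_eq[OF y])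
  have quadsE: "\<exists>a b c d. a \<in> carrier A \<and> b \<in> carrier A \<and> c \<in> carrier A \<and> d \<in> carrier A \<and>
      Z1 = cl a \<and> Z2 = cl b \<and> Z3 = cl c \<and> Z4 = cl d" if "(Z1, Z2, Z3, Z4) \<in> quads T" for Z1 Z2 Z3 Z4
    using that by (auto simp: quads_def T_def cl_def elim!: quotientE)
  have val: "\<exists>a b c d e. Z1 = cl a \<and> Z2 = cl b \<and> Z3 = cl c \<and> Z4 = cl d \<and> M a b e d \<and> c \<in> carrier A \<and>
      (a, c) \<in> y \<and> (c, d) \<in> x \<and> m (Z1, Z2, Z3, Z4) = cl e"
    if q: "(Z1, Z2, Z3, Z4) \<in> quads T" for Z1 Z2 Z3 Z4
  proof -
    obtain a b c d where *: "a \<in> carrier A" "b \<in> carrier A" "c \<in> carrier A" "d \<in> carrier A"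
      "Z1 = cl a" "Z2 = cl b" "Z3 = cl c" "Z4 = cl d" using quadsE[OF q] by blast
    then have s: "(a, b) \<in> x" "(a, c) \<in> y" "(c, d) \<in> x" "(b, d) \<in> y" using q quads by blast+
    then obtain e where "M a b e d" using ex by blast
    then show ?thesis using * s m_eq by blast
  qed
  have "pseudogroupoid_structure \<sigma> T m"
  proof (rule pseudogroupoid_structureI)
    show "m \<in> alg_hom \<sigma> (quad_algebra T) (ob1 T)"
      unfolding alg_hom_def
    proof (intro CollectI conjI allI impI)
      show "m ` carrier (quad_algebra T) \<subseteq> carrier (ob1 T)"
      proof
        fix Z assume "Z \<in> m ` carrier (quad_algebra T)"
        then obtain Z1 Z2 Z3 Z4 where "(Z1, Z2, Z3, Z4) \<in> quads T" "Z = m (Z1, Z2, Z3, Z4)"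
          by (auto simp: quad_algebra_def)
        then obtain a b d e where "M a b e d" "Z = cl e" using val by blast
        then show "Z \<in> carrier (ob1 T)" using cl car by (simp add: T_def)
      qed
      fix f qs assume *: "\<sigma> f = Some (length qs) \<and> set qs \<subseteq> carrier (quad_algebra T)"
      have "\<exists>a b c d e. qs ! i = (cl a, cl b, cl c, cl d) \<and> M a b e d \<and> c \<in> carrier A \<and> m (qs ! i) = cl e"
        if "i < length qs" for i
      proof -
        obtain Z1 Z2 Z3 Z4 where Z: "qs ! i = (Z1, Z2, Z3, Z4)" by (cases "qs ! i")
        then have "(Z1, Z2, Z3, Z4) \<in> quads T" using * nth_mem[OF that] by (auto simp: quad_algebra_def)
        then show ?thesis using val unfolding Z by blast
      qed
      then obtain a b c d e where i: "\<And>i. i < length qs \<Longrightarrow> qs ! i = (cl (a i), cl (b i), cl (c i), cl (d i)) \<and>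
          M (a i) (b i) (e i) (d i) \<and> c i \<in> carrier A \<and> m (qs ! i) = cl (e i)"
        by metis
      let ?m = "\<lambda>g. map g [0..<length qs]"
      have mm: "M (opr A f (?m a)) (opr A f (?m b)) (opr A f (?m e)) (opr A f (?m d))"
        using * i by (intro compatible4D[OF square_relD(1)[OF sq]]) auto
      have op: "opr (quot_algebra A p) f (?m (\<lambda>i. cl (g i))) = cl (opr A f (?m g))"
        if "\<And>i. i < length qs \<Longrightarrow> g i \<in> carrier A" for g
      proof -
        have "set (?m g) \<subseteq> carrier A" using that by auto
        then show ?thesis
          using alg_homD[OF quot_algebra_hom[OF A p], of f "?m g"] * by (simp add: cl_def o_def)
      qed
      have abde: "a i \<in> carrier A" "b i \<in> carrier A" "d i \<in> carrier A" "e i \<in> carrier A" if "i < length qs" for i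
        using i[OF that] car by blast+
      have "map (\<lambda>(f1, f2, f3, f4). f1) qs = ?m (\<lambda>i. cl (a i))" "map (\<lambda>(f1, f2, f3, f4). f2) qs = ?m (\<lambda>i. cl (b i))"
        "map (\<lambda>(f1, f2, f3, f4). f4) qs = ?m (\<lambda>i. cl (d i))"
        using i by (auto intro!: nth_equalityI)
      moreover have "m (qs ! i) = cl (e i)" if "i < length qs" for i using i[OF that] by blast
      then have "map m qs = ?m (\<lambda>i. cl (e i))" by (intro nth_equalityI) simp_all
      ultimately show "m (opr (quad_algebra T) f qs) = opr (ob1 T) f (map m qs)"
        using m_eq[OF mm] op[of a] op[of b] op[of d] op[of e] abde
        by (simp add: quad_algebra_def T_def)
    qed
  next
    fix Z1 Z2 Z3 Z4 assume "(Z1, Z2, Z3, Z4) \<in> quads T"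
    then obtain a b c d e where *: "Z3 = cl c" "M a b e d" "(a, c) \<in> y" "(c, d) \<in> x" "c \<in> carrier A"
      "m (Z1, Z2, Z3, Z4) = cl e"
      using val by blast
    have "(e, d) \<in> x" "(a, e) \<in> y" using Mx[OF square_relD(5)[OF sq *(2)]] My[OF *(2)] by auto
    then have "(e, c) \<in> x" "(e, c) \<in> y" using *(3,4) congruenceD(4,5)[OF x] congruenceD(4,5)[OF y] by metis+
    then show "leg T (m (Z1, Z2, Z3, Z4)) = leg T Z3" "leg' T (m (Z1, Z2, Z3, Z4)) = leg' T Z3"
      using * car[OF *(2)] leg class_eq[OF x] class_eq[OF y] by (simp_all add: T_def)
  next
    fix Z1 Z2 Z3 Z3' Z4
    show "m (Z1, Z2, Z3, Z4) = m (Z1, Z2, Z3', Z4)" by (simp add: m_def)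
  next
    fix Z1 Z3 Z4 assume q: "(Z1, Z1, Z3, Z4) \<in> quads T"
    obtain a c d where *: "a \<in> carrier A" "c \<in> carrier A" "d \<in> carrier A" "Z1 = cl a" "Z3 = cl c" "Z4 = cl d"
      using quadsE[OF q] by blast
    then have "(a, d) \<in> y" using q quads by blast
    then show "m (Z1, Z1, Z3, Z4) = Z4" using m_eq[OF col] * by simp
  next
    fix Z1 Z2 Z3 assume q: "(Z1, Z2, Z3, Z2) \<in> quads T"
    obtain a b c where *: "a \<in> carrier A" "b \<in> carrier A" "c \<in> carrier A" "Z1 = cl a" "Z2 = cl b" "Z3 = cl c"
      using quadsE[OF q] by blast
    then have "(a, b) \<in> x" using q quads by blast
    then show "m (Z1, Z2, Z3, Z2) = Z1" using m_eq[OF row] * by simp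
  next
    fix Z1 Z2 Z3 Z4 Z5 Z6 Z3' Z3''
    assume q: "(Z1, Z2, Z3, Z4) \<in> quads T" "(m (Z1, Z2, Z3, Z4), Z5, Z3', Z6) \<in> quads T"
      "(Z4, Z5, Z3'', Z6) \<in> quads T" "(Z1, Z2, Z3', m (Z4, Z5, Z3'', Z6)) \<in> quads T"
    have tr: "M a' b' c' d'" if "M a b c d" "cl a = cl a'" "cl b = cl b'" "cl c = cl c'" "cl d = cl d'"
      "{a', b', c', d'} \<subseteq> carrier A" for a b c d a' b' c' d'
      using saturatedD[OF M(2) that(1)] that cl_eq car[OF that(1)] by auto
    obtain a b d e where 1: "Z1 = cl a" "Z2 = cl b" "Z4 = cl d" "M a b e d" "m (Z1, Z2, Z3, Z4) = cl e"
      using val[OF q(1)] by blast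
    obtain e' b' d' g' where 2: "cl e = cl e'" "Z5 = cl b'" "Z6 = cl d'" "M e' b' g' d'" "m (cl e, Z5, Z3', Z6) = cl g'"
      using val[OF q(2)[unfolded 1(5)]] by blast
    obtain a'' b'' d'' h'' where 3: "Z4 = cl a''" "Z5 = cl b''" "Z6 = cl d''" "M a'' b'' h'' d''"
      "m (Z4, Z5, Z3'', Z6) = cl h''"
      using val[OF q(3)] by blast
    \<comment> \<open>Associativity by pasting: the square \<open>e b' g' d'\<close> and the mirror
      image of \<open>d b' h'' d'\<close> share the column \<open>b' d'\<close> and give
      \<open>e d g' h''\<close>. Placed below \<open>a b e d\<close> this yields
      \<open>a b g' h''\<close>, so \<open>g'\<close> represents both sides.\<close>
    have g: "M e b' g' d'" by (rule tr[OF 2(4)]) (use 2 1 car in auto)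
    have "M d b' h'' d'" by (rule tr[OF 3(4)]) (use 1 2 3 car in auto)
    then have "M e d g' h''" using comp_closedD(1)[OF M(3) g square_relD(4)[OF sq]] by blast
    then have "M a b g' h''" using comp_closedD(2)[OF M(3) 1(4)] by blast
    then have "m (Z1, Z2, Z3', cl h'') = cl g'" unfolding 1 by (rule m_eq)
    then show "m (m (Z1, Z2, Z3, Z4), Z5, Z3', Z6) = m (Z1, Z2, Z3', m (Z4, Z5, Z3'', Z6))"
      using 1 2 3 by simp
  qed
  then show ?thesis by blast
qed

text \<open>The factors \<open>x'\<close> and \<open>y'\<close> are only bounded by the joins, so
  monotonicity of the commutator is built in and the lemma applies directly to the square of one
  congruence below both joins.\<close>

lemma commutator_join:
  fixes A :: "('f, 'a) ualgebra"
  assumes E: "wf_identities \<sigma> E" and A: "in_variety \<sigma> E A" and "modular_algebra \<sigma> E' A"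
    and u: "congruence \<sigma> A u" and v: "congruence \<sigma> A v" and p: "congruence \<sigma> A p"
    and uv: "commutator \<sigma> E A u v \<subseteq> p"
    and x': "congruence \<sigma> A x'" "x' \<subseteq> (p \<union> u)\<^sup>+" and y': "congruence \<sigma> A y'" "y' \<subseteq> (p \<union> v)\<^sup>+"
  shows "commutator \<sigma> E A x' y' \<subseteq> p"
proof -
  interpret modular_algebra \<sigma> E' A by fact
  define x where "x = (p \<union> u)\<^sup>+"
  define y where "y = (p \<union> v)\<^sup>+"
  have x: "congruence \<sigma> A x" and y: "congruence \<sigma> A y"
    using congruence_join[OF algebra p u] congruence_join[OF algebra p v] by (simp_all add: x_def y_def)
  have px: "p \<subseteq> x" "u \<subseteq> x" "p \<subseteq> y" "v \<subseteq> y" by (auto simp: x_def y_def)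
  let ?N = "gen_square \<sigma> A u v"
  \<comment> \<open>The generated squares are centralizing modulo the commutator of \<open>u\<close>
    and \<open>v\<close>; this is lifted to \<open>p\<close>.\<close>
  have N: "centralizing \<sigma> A p ?N"
    by (rule centralizing_mono[OF centralizing_commutator[OF u v, of E] p congruence_commutator[OF algebra] uv])
  have N': "saturation p ?N a b c d \<Longrightarrow> (a, b) \<in> x \<and> (a, c) \<in> y" for a b c d
  proof -
    assume "saturation p ?N a b c d"
    then obtain a' b' c' d' where *: "?N a' b' c' d'" "(a', a) \<in> p" "(b', b) \<in> p" "(c', c) \<in> p"
      unfolding saturation_def by blast
    note s = gen_square_sides[OF u v *(1)]
    have "(a, a') \<in> p" using congruenceD(4)[OF p *(2)] .
    then have "(a, a') \<in> x" "(a', b') \<in> x" "(b', b) \<in> x" "(a, a') \<in> y" "(a', c') \<in> y" "(c', c) \<in> y"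
      using s *(3,4) px by auto
    then show ?thesis using congruenceD(5)[OF x] congruenceD(5)[OF y] by metis
  qed
  obtain M where M: "centralizing \<sigma> A p M" "saturated p M" "saturation p ?N \<le> M" "comp_closed M"
    and Mx: "\<forall>x. trans x \<longrightarrow> (\<forall>a b c d. saturation p ?N a b c d \<longrightarrow> (a, b) \<in> x) \<longrightarrow> (\<forall>a b c d. M a b c d \<longrightarrow> (a, b) \<in> x)"
    and My: "\<forall>y. trans y \<longrightarrow> (\<forall>a b c d. saturation p ?N a b c d \<longrightarrow> (a, c) \<in> y) \<longrightarrow> (\<forall>a b c d. M a b c d \<longrightarrow> (a, c) \<in> y)"
    by (rule comp_closure[OF centralizing_saturation[OF p N] p saturated_saturation[OF p]])
  have Mx: "(a, b) \<in> x" and My: "(a, c) \<in> y" if "M a b c d" for a b c d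
  proof -
    have "trans x" "trans y" by (simp_all add: x_def y_def)
    then show "(a, b) \<in> x" "(a, c) \<in> y" using Mx My N' that by blast+
  qed
  have sq: "square_rel \<sigma> A M" using M(1) by (simp add: centralizing_def)
  have NM: "M a b c d" if "?N a b c d" for a b c d
    using M(3) saturation_incr[OF square_rel_gen_square[OF u v] p that] by (simp add: le_fun_def)
  have pM: "M a b a b" "M a a b b" if "(a, b) \<in> p" for a b
  proof -
    have a: "(a, a) \<in> p" using congruenceD(1,3)[OF p] that by blast
    have m: "M a a a a" using square_relD(2)[OF sq congruenceD(1)[OF p that]] .
    show "M a b a b" "M a a b b" using saturatedD[OF M(2) m] a that by blast+
  qed
  \<comment> \<open>Induction over the links: those in \<open>p\<close> come from saturation, those
    in \<open>u\<close> are generators, and horizontal composition joins them.\<close>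
  have row: "M a b a b" if "(a, b) \<in> x" for a b
    using that unfolding x_def
  proof induction
    case (base b)
    then show ?case using pM(1) NM[OF gen_square.row] by blast
  next
    case (step b c)
    then have "M b c b c" using pM(1) NM[OF gen_square.row] by blast
    with step show ?case using comp_closedD(1)[OF M(4), of a b a b c c] by blast
  qed
  have col: "M a a b b" if "(a, b) \<in> y" for a b
    using that unfolding y_def
  proof induction
    case (base b)
    then show ?case using pM(2) NM[OF gen_square.col] by blast
  next
    case (step b c)
    then have "M b b c c" using pM(2) NM[OF gen_square.col] by blast
    with step show ?case using comp_closedD(2)[OF M(4), of a a b b c c] by blast
  qed
  define T where "T = \<lparr>ob0 = quot_algebra A x, ob1 = quot_algebra A p, ob0' = quot_algebra A y,
    leg = (\<lambda>Z. x `` Z), leg' = (\<lambda>Z. y `` Z)\<rparr>"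
  have "\<exists>m. pseudogroupoid_structure \<sigma> T m"
    unfolding T_def
  proof (rule quotient_pseudogroupoid[OF algebra p x y px(1,3) M(1,2,4) Mx My row col])
    fix a b c d assume s: "(a, b) \<in> x" "(a, c) \<in> y" "(c, d) \<in> x" "(b, d) \<in> y"
    show "\<exists>e. M a b e d"
      by (rule complete_square[OF x y p M(1,2,4) _ _ _ _ s])
        (erule Mx My row col | rule exI, assumption)+
  qed
  then obtain m where m: "pseudogroupoid_structure \<sigma> T m" ..
  have T: "span_in_variety \<sigma> E T"
    using in_variety_quot_algebra[OF E A] x y p quot_algebra_hom_quot[OF algebra p] px
    by (simp add: span_in_variety_def T_def)
  \<comment> \<open>Enlarging \<open>x'\<close> to \<open>x\<close> and \<open>y'\<close> to
    \<open>y\<close> induces maps between the outer quotients, so this test span also receives the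
    span of the smaller congruences.\<close>
  have \<phi>: "span_morphism \<sigma> (quot_span A x' y') T (\<lambda>Z. x `` Z) (\<lambda>a. p `` {a}) (\<lambda>Z. y `` Z)"
  proof -
    have "x' \<subseteq> x" "y' \<subseteq> y" using x' y' by (simp_all add: x_def y_def)
    then show ?thesis
      using quot_algebra_hom_quot[OF algebra x'(1) x] quot_algebra_hom_quot[OF algebra y'(1) y]
        quot_algebra_hom[OF algebra p] class_class[OF x'(1) x] class_class[OF y'(1) y]
        class_class[OF p x px(1)] class_class[OF p y px(3)]
      by (simp add: span_morphism_def quot_span_def T_def)
  qed
  show ?thesis
  proof (rule subrelI)
    fix a b assume ab: "(a, b) \<in> commutator \<sigma> E A x' y'"
    have "p `` {a} = p `` {b}" by (rule commutator_all_types[OF E algebra T m \<phi> ab])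
    moreover have "a \<in> carrier A" "b \<in> carrier A"
      using congruenceD(1,2)[OF congruence_commutator[OF algebra] ab] by blast+
    ultimately show "(a, b) \<in> p" using class_eq[OF p] by blast
  qed
qed

section \<open>Spectra of multiplicative lattices\<close>

context complete_multiplicative_lattice
begin

abbreviation basic_open :: "'a \<Rightarrow> 'a set" where
  "basic_open x \<equiv> Spec L - zariski_closed L x"

lemma basic_open_iff: "p \<in> basic_open x \<longleftrightarrow> p \<in> Spec L \<and> \<not> x \<sqsubseteq> p"
  by (auto simp: zariski_closed_def)

lemma SpecD:
  assumes "p \<in> Spec L"
  shows "p \<in> carrier L" "p \<noteq> \<top>"
    "\<lbrakk>x \<in> carrier L; y \<in> carrier L; lprod L x y \<sqsubseteq> p\<rbrakk> \<Longrightarrow> x \<sqsubseteq> p \<or> y \<sqsubseteq> p"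
  using assms by (auto simp: Spec_def prime_element_def)

lemma lprod_le:
  assumes "x \<in> carrier L" "y \<in> carrier L"
  shows "lprod L x y \<sqsubseteq> x" "lprod L x y \<sqsubseteq> y"
  using assms lprod_le_meet[OF assms] lprod_closed[OF assms] meet_left meet_right meet_closed le_trans
  by metis+

lemma Sup_le_iff:
  assumes "X \<subseteq> carrier L" "p \<in> carrier L"
  shows "\<Squnion>X \<sqsubseteq> p \<longleftrightarrow> (\<forall>x\<in>X. x \<sqsubseteq> p)"
proof
  assume "\<Squnion>X \<sqsubseteq> p"
  then show "\<forall>x\<in>X. x \<sqsubseteq> p"
    using le_trans[OF sup_upper[OF assms(1)] _ _ sup_closed[OF assms(1)] assms(2)] assms(1) by blast
qed (use assms in \<open>auto intro!: sup_least\<close>)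

lemma le_Inf_iff:
  assumes "X \<subseteq> carrier L" "p \<in> carrier L"
  shows "p \<sqsubseteq> \<Sqinter>X \<longleftrightarrow> (\<forall>x\<in>X. p \<sqsubseteq> x)"
proof
  assume "p \<sqsubseteq> \<Sqinter>X"
  then show "\<forall>x\<in>X. p \<sqsubseteq> x"
    using le_trans[OF _ inf_lower[OF assms(1)] assms(2) inf_closed[OF assms(1)]] assms(1) by blast
qed (use assms in \<open>auto intro!: inf_greatest\<close>)

text \<open>The generic point of an irreducible closed set \<open>C\<close> is its infimum:
  \<open>C\<close> lies in the closed set of \<open>x\<close> iff \<open>x\<close> is below that
  infimum, so irreducibility translates into primality, and \<open>C \<noteq> {}\<close> keeps the
  infimum away from the top.\<close>

lemma sober_zariski: "sober_space (zariski L)"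
  unfolding sober_space_def
proof (intro conjI allI impI)
  show "t0_space (zariski L)"
    unfolding t0_space_def topspace_zariski
  proof (intro ballI impI)
    fix p q assume *: "p \<in> Spec L" "q \<in> Spec L" "p \<noteq> q"
    then have pq: "p \<in> carrier L" "q \<in> carrier L" using SpecD by blast+
    then have "\<not> p \<sqsubseteq> q \<or> \<not> q \<sqsubseteq> p" using le_antisym *(3) by blast
    then have "\<exists>x\<in>{p, q}. p \<notin> basic_open x \<longleftrightarrow> q \<in> basic_open x"
      using * pq le_refl unfolding basic_open_iff by blast
    moreover have "openin (zariski L) (basic_open x)" if "x \<in> {p, q}" for x
      unfolding openin_zariski using that pq by blast
    ultimately show "\<exists>U. openin (zariski L) U \<and> (p \<notin> U \<longleftrightarrow> q \<in> U)" by blast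
  qed
next
  fix C assume C: "irreducible_closed (zariski L) C"
  then obtain a where a: "a \<in> carrier L" "C = zariski_closed L a"
    unfolding irreducible_closed_def closedin_zariski by blast
  have sub: "C \<subseteq> carrier L" using SpecD(1) unfolding a(2) zariski_closed_def by blast
  define p where "p = \<Sqinter>C"
  have p: "p \<in> carrier L" unfolding p_def by (rule inf_closed[OF sub])
  have V: "C \<subseteq> zariski_closed L x \<longleftrightarrow> x \<sqsubseteq> p" if "x \<in> carrier L" for x
    unfolding p_def le_Inf_iff[OF sub that] unfolding a(2) zariski_closed_def by blast
  have "prime_element L p"
    unfolding prime_element_def
  proof (intro conjI ballI impI)
    obtain q where q: "q \<in> C" using C unfolding irreducible_closed_def by blast
    then have "q \<in> Spec L" by (simp add: a(2) zariski_closed_def)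
    note q' = SpecD(1,2)[OF this]
    have "p \<sqsubseteq> q" unfolding p_def by (rule inf_lower[OF sub q])
    then show "p \<noteq> \<top>" using top_higher[OF q'(1)] le_antisym[OF _ _ q'(1)] q'(2) top_closed by blast
    fix x y assume xy: "x \<in> carrier L" "y \<in> carrier L" "lprod L x y \<sqsubseteq> p"
    then have "C \<subseteq> zariski_closed L x \<union> zariski_closed L y"
      using V[OF lprod_closed] zariski_closed_prod by simp
    then have "C = (C \<inter> zariski_closed L x) \<union> (C \<inter> zariski_closed L y)" by blast
    moreover have "closedin (zariski L) (C \<inter> zariski_closed L z)" if "z \<in> carrier L" for z
      using that a closedin_Int[of "zariski L"] closedin_zariski by metis
    ultimately have "C = C \<inter> zariski_closed L x \<or> C = C \<inter> zariski_closed L y"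
      using C xy unfolding irreducible_closed_def by metis
    then show "x \<sqsubseteq> p \<or> y \<sqsubseteq> p" using V xy by blast
  qed (rule p)
  then have pS: "p \<in> Spec L" by (simp add: Spec_def)
  have pC: "p \<in> C" using V[OF a(1)] pS unfolding a(2) zariski_closed_def by blast
  have "zariski L closure_of {p} = C"
  proof (rule closure_of_unique)
    show "closedin (zariski L) C" using C by (simp add: irreducible_closed_def)
    fix C' assume "{p} \<subseteq> C'" "closedin (zariski L) C'"
    then obtain x where "x \<in> carrier L" "C' = zariski_closed L x" "x \<sqsubseteq> p"
      unfolding closedin_zariski by (auto simp: zariski_closed_def)
    then show "C \<subseteq> C'" using V by blast
  qed (use pC in simp)
  then show "\<exists>p\<in>topspace (zariski L). C = zariski L closure_of {p}"
    using pS topspace_zariski by auto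
qed

text \<open>A substitute for powers when the multiplication need not be associative: the sequence
  decreases, and a prime above one member is above \<open>x\<close>.\<close>

primrec iter_square :: "'a \<Rightarrow> nat \<Rightarrow> 'a" where
  "iter_square x 0 = x"
| "iter_square x (Suc n) = lprod L (iter_square x n) (iter_square x n)"

lemma iter_square_closed: "x \<in> carrier L \<Longrightarrow> iter_square x n \<in> carrier L"
  by (induction n) (simp_all add: lprod_closed)

lemma iter_square_antimono:
  assumes "x \<in> carrier L" "n \<le> n'"
  shows "iter_square x n' \<sqsubseteq> iter_square x n"
  using assms(2)
proof (induction rule: dec_induct)
  case (step k)
  then show ?case
    using lprod_le(1)[OF iter_square_closed iter_square_closed, OF assms(1) assms(1), of k k] iter_square_closed[OF assms(1)]
      le_trans lprod_closed by (metis iter_square.simps(2))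
qed (use assms iter_square_closed in auto)

lemma iter_square_le_prime:
  assumes "p \<in> Spec L" "x \<in> carrier L" "iter_square x n \<sqsubseteq> p"
  shows "x \<sqsubseteq> p"
  using assms(3)
proof (induction n)
  case (Suc n)
  then show ?case using SpecD(3)[OF assms(1) iter_square_closed iter_square_closed, OF assms(2,2)] by simp blast
qed simp

text \<open>The set \<open>K\<close> plays the role of the compact elements. The last assumption is weaker than
  distributivity of the multiplication over finite joins, but suffices for an element which is maximal
  among those not above an iterated square of \<open>k\<close> to be prime.\<close>

context
  fixes K :: "'a set"
  assumes K: "K \<subseteq> carrier L"
    and compact: "\<And>k X. \<lbrakk>k \<in> K; X \<subseteq> carrier L; k \<sqsubseteq> \<Squnion>X\<rbrakk> \<Longrightarrow> \<exists>F\<subseteq>X. finite F \<and> k \<sqsubseteq> \<Squnion>F"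
    and generates: "\<And>x. x \<in> carrier L \<Longrightarrow> \<exists>X\<subseteq>K. x = \<Squnion>X"
    and top: "\<top> \<in> K"
    and prod: "\<And>k k'. \<lbrakk>k \<in> K; k' \<in> K\<rbrakk> \<Longrightarrow> lprod L k k' \<in> K"
    and square: "\<And>k x y p. \<lbrakk>k \<in> K; x \<in> carrier L; y \<in> carrier L; p \<in> carrier L; lprod L x y \<sqsubseteq> p;
      k \<sqsubseteq> p \<squnion> x; k \<sqsubseteq> p \<squnion> y\<rbrakk> \<Longrightarrow> lprod L k k \<sqsubseteq> p"
begin

lemma exists_prime:
  assumes a: "a \<in> carrier L" and k: "k \<in> K" and ka: "\<And>n. \<not> iter_square k n \<sqsubseteq> a"
  shows "\<exists>p\<in>Spec L. a \<sqsubseteq> p \<and> \<not> k \<sqsubseteq> p"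
proof -
  have kL: "k \<in> carrier L" using k K by blast
  note closed = iter_square_closed[OF kL]
  have kK: "iter_square k n \<in> K" for n by (induction n) (use k prod in auto)
  define S where "S = {p \<in> carrier L. a \<sqsubseteq> p \<and> (\<forall>n. \<not> iter_square k n \<sqsubseteq> p)}"
  have "\<exists>p\<in>S. \<forall>q\<in>S. p \<sqsubseteq> q \<longrightarrow> q = p"
  proof (rule predicate_Zorn)
    show "partial_order_on S (relation_of (\<sqsubseteq>) S)"
      by (rule partial_order_on_relation_ofI) (auto simp: S_def intro: le_trans le_antisym)
    fix C assume C: "C \<in> Chains (relation_of (\<sqsubseteq>) S)"
    then have CS: "C \<subseteq> S" by (rule Chains_relation_of)
    then have CL: "C \<subseteq> carrier L" by (auto simp: S_def)
    have ch: "p \<sqsubseteq> q \<or> q \<sqsubseteq> p" if "p \<in> C" "q \<in> C" for p q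
      using C that unfolding Chains_def relation_of_def by blast
    have fin: "\<exists>q\<in>C. \<forall>p\<in>F. p \<sqsubseteq> q" if "finite F" "F \<subseteq> C" "C \<noteq> {}" for F
      using that
    proof (induction F)
      case (insert p F)
      then obtain q where q: "q \<in> C" "\<forall>p\<in>F. p \<sqsubseteq> q" by blast
      show ?case
      proof (cases "p \<sqsubseteq> q")
        case False
        then have qp: "q \<sqsubseteq> p" "p \<in> C" using ch insert q by auto
        have "r \<sqsubseteq> p" if "r \<in> F" for r
        proof -
          have "r \<in> carrier L" "q \<in> carrier L" "p \<in> carrier L" using that q(1) qp(2) insert(4) CL by blast+
          then show ?thesis using le_trans[of r q p] q(2) that qp(1) by blast
        qed
        moreover have "p \<sqsubseteq> p" using le_refl qp(2) CL by blast
        ultimately show ?thesis using qp(2) by blast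
      qed (use q in blast)
    qed auto
    show "\<exists>u\<in>S. \<forall>p\<in>C. p \<sqsubseteq> u"
    proof (cases "C = {}")
      case True
      have "a \<in> S" using a ka le_refl by (simp add: S_def)
      then show ?thesis using True by blast
    next
      case False
      then obtain q where q: "q \<in> C" by blast
      have "a \<sqsubseteq> q" "q \<sqsubseteq> \<Squnion>C" using q CS sup_upper[OF CL q] by (auto simp: S_def)
      then have "a \<sqsubseteq> \<Squnion>C" using le_trans[of a q "\<Squnion>C"] a q CL sup_closed[OF CL] by auto
      \<comment> \<open>By compactness an iterated square below the supremum of the chain is below
        that of a finite part, hence below one member of the chain.\<close>
      moreover have "\<not> iter_square k n \<sqsubseteq> \<Squnion>C" for n
      proof
        assume "iter_square k n \<sqsubseteq> \<Squnion>C"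
        then obtain F where F: "F \<subseteq> C" "finite F" "iter_square k n \<sqsubseteq> \<Squnion>F" using compact[OF kK CL] by blast
        obtain r where r: "r \<in> C" "\<forall>p\<in>F. p \<sqsubseteq> r" using fin[OF F(2,1) False] by blast
        have FL: "F \<subseteq> carrier L" "r \<in> carrier L" using F(1) r(1) CL by auto
        then have "\<Squnion>F \<sqsubseteq> r" using Sup_le_iff r(2) by blast
        then have "iter_square k n \<sqsubseteq> r" using le_trans[OF F(3) _ closed sup_closed[OF FL(1)] FL(2)] by blast
        then show False using r(1) CS by (auto simp: S_def)
      qed
      ultimately have "\<Squnion>C \<in> S" using sup_closed[OF CL] by (simp add: S_def)
      then show ?thesis using sup_upper[OF CL] by blast
    qed
  qed
  then obtain p where pS: "p \<in> S" and max: "\<And>q. q \<in> S \<Longrightarrow> p \<sqsubseteq> q \<Longrightarrow> q = p" by blast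
  then have p: "p \<in> carrier L" "a \<sqsubseteq> p" "\<And>n. \<not> iter_square k n \<sqsubseteq> p" by (auto simp: S_def)
  have above: "\<exists>n. iter_square k n \<sqsubseteq> p \<squnion> x" if x: "x \<in> carrier L" "\<not> x \<sqsubseteq> p" for x
  proof (rule ccontr)
    assume "\<nexists>n. iter_square k n \<sqsubseteq> p \<squnion> x"
    moreover have j: "p \<sqsubseteq> p \<squnion> x" "x \<sqsubseteq> p \<squnion> x" "p \<squnion> x \<in> carrier L"
      using join_left[OF p(1) x(1)] join_right[OF p(1) x(1)] join_closed[OF p(1) x(1)] by auto
    moreover have "a \<sqsubseteq> p \<squnion> x" using le_trans[OF p(2) j(1) a p(1) j(3)] .
    ultimately have "p \<squnion> x \<in> S" by (simp add: S_def)
    then have "p \<squnion> x = p" using max j(1) by blast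
    then show False using j(2) x(2) by simp
  qed
  have "prime_element L p"
    unfolding prime_element_def
  proof (intro conjI ballI impI)
    show "p \<noteq> \<top>" using p(3)[of 0] top_higher[OF kL] by auto
    fix x y assume xy: "x \<in> carrier L" "y \<in> carrier L" "lprod L x y \<sqsubseteq> p"
    show "x \<sqsubseteq> p \<or> y \<sqsubseteq> p"
    proof (rule ccontr)
      assume "\<not> (x \<sqsubseteq> p \<or> y \<sqsubseteq> p)"
      then obtain n n' where n: "iter_square k n \<sqsubseteq> p \<squnion> x" "iter_square k n' \<sqsubseteq> p \<squnion> y"
        using above[OF xy(1)] above[OF xy(2)] by auto
      \<comment> \<open>With the larger index, one iterated square lies below both joins; its square
        is the next member of the sequence.\<close>
      let ?k = "iter_square k (max n n')"
      have "?k \<sqsubseteq> p \<squnion> x"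
        by (rule le_trans[OF iter_square_antimono[OF kL] n(1) closed closed join_closed[OF p(1) xy(1)]]) simp
      moreover have "?k \<sqsubseteq> p \<squnion> y"
        by (rule le_trans[OF iter_square_antimono[OF kL] n(2) closed closed join_closed[OF p(1) xy(2)]]) simp
      ultimately have "iter_square k (Suc (max n n')) \<sqsubseteq> p"
        using square[OF kK xy(1,2) p(1) xy(3)] by simp
      then show False using p(3) by blast
    qed
  qed (rule p(1))
  then show ?thesis using p(2) p(3)[of 0] by (auto simp: Spec_def)
qed

text \<open>A cover by basic open sets corresponds to a supremum. A prime above it and not above
  \<open>k\<close> would be an uncovered point, so some iterated square of \<open>k\<close> is below
  it. That element is again in \<open>K\<close>, hence below a finite part, and primes cannot
  distinguish it from \<open>k\<close>.\<close>

lemma compact_open_basic_open: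
  assumes k: "k \<in> K"
  shows "compact_open (zariski L) (basic_open k)"
proof -
  have kL: "k \<in> carrier L" using k K by blast
  have "compactin (zariski L) (basic_open k)"
    unfolding compactin_def topspace_zariski
  proof (intro conjI allI impI)
    fix \<U> assume U: "(\<forall>U\<in>\<U>. openin (zariski L) U) \<and> basic_open k \<subseteq> \<Union>\<U>"
    define X where "X = {x \<in> carrier L. basic_open x \<in> \<U>}"
    have XL: "X \<subseteq> carrier L" by (auto simp: X_def)
    have UX: "\<exists>x\<in>X. U = basic_open x" if "U \<in> \<U>" for U
    proof -
      have "openin (zariski L) U" using U that by blast
      then obtain x where "x \<in> carrier L" "U = basic_open x" unfolding openin_zariski by blast
      then show ?thesis using that by (auto simp: X_def)
    qed
    have "\<exists>n. iter_square k n \<sqsubseteq> \<Squnion>X"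
    proof (rule ccontr)
      assume "\<nexists>n. iter_square k n \<sqsubseteq> \<Squnion>X"
      then obtain p where p: "p \<in> Spec L" "\<Squnion>X \<sqsubseteq> p" "\<not> k \<sqsubseteq> p"
        using exists_prime[OF sup_closed[OF XL] k] by blast
      then have "p \<in> \<Union>\<U>" using U basic_open_iff[of p k] by blast
      then obtain x where x: "x \<in> X" "p \<in> basic_open x" using UX by blast
      then have "x \<sqsubseteq> p" using p(2) Sup_le_iff[OF XL SpecD(1)[OF p(1)]] by blast
      then show False using x(2) basic_open_iff[of p x] by blast
    qed
    then obtain n F where F: "F \<subseteq> X" "finite F" "iter_square k n \<sqsubseteq> \<Squnion>F"
    proof -
      have "iter_square k n \<in> K" for n by (induction n) (use k prod in auto)
      then show ?thesis using compact[OF _ XL] that \<open>\<exists>n. iter_square k n \<sqsubseteq> \<Squnion>X\<close> by blast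
    qed
    have FL: "F \<subseteq> carrier L" using F(1) XL by blast
    have "basic_open k \<subseteq> \<Union>(basic_open ` F)"
    proof
      fix p assume p: "p \<in> basic_open k"
      then have pS: "p \<in> Spec L" "\<not> k \<sqsubseteq> p" using basic_open_iff[of p k] by auto
      have "\<not> \<Squnion>F \<sqsubseteq> p"
        using iter_square_le_prime[OF pS(1) kL] pS(2) le_trans[OF F(3) _ iter_square_closed[OF kL] sup_closed[OF FL] SpecD(1)[OF pS(1)]]
        by blast
      then obtain x where "x \<in> F" "\<not> x \<sqsubseteq> p" using Sup_le_iff[OF FL SpecD(1)[OF pS(1)]] by blast
      then show "p \<in> \<Union>(basic_open ` F)" using pS(1) basic_open_iff[of p x] by blast
    qed
    then show "\<exists>\<F>. finite \<F> \<and> \<F> \<subseteq> \<U> \<and> basic_open k \<subseteq> \<Union>\<F>"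
      using F(1,2) by (intro exI[of _ "basic_open ` F"]) (auto simp: X_def)
  qed auto
  then show ?thesis using kL by (auto simp: compact_open_def openin_zariski)
qed

section \<open>Compact open sets of the spectrum\<close>

lemma basic_open_union:
  assumes "x \<in> carrier L"
  shows "\<exists>X\<subseteq>K. basic_open x = \<Union>(basic_open ` X)"
proof -
  obtain X where X: "X \<subseteq> K" "x = \<Squnion>X" using generates[OF assms] by blast
  have "p \<in> basic_open x \<longleftrightarrow> p \<in> \<Union>(basic_open ` X)" for p
    using Sup_le_iff[of X p] SpecD(1)[of p] X K unfolding UN_iff basic_open_iff by blast
  then show ?thesis using X(1) by blast
qed

lemma compact_open_iff:
  "compact_open (zariski L) U \<longleftrightarrow> (\<exists>F\<subseteq>K. finite F \<and> U = \<Union>(basic_open ` F))"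
proof
  assume U: "compact_open (zariski L) U"
  then obtain X where X: "X \<subseteq> K" "U = \<Union>(basic_open ` X)"
    using basic_open_union unfolding compact_open_def openin_zariski by metis
  have "\<forall>V\<in>basic_open ` X. openin (zariski L) V" using X(1) K unfolding openin_zariski by blast
  then obtain \<F> where "finite \<F>" "\<F> \<subseteq> basic_open ` X" "U \<subseteq> \<Union>\<F>"
    using U X(2) unfolding compact_open_def compactin_def by (metis order_refl)
  moreover then obtain F where "F \<subseteq> X" "finite F" "\<F> = basic_open ` F" by (meson finite_subset_image)
  ultimately show "\<exists>F\<subseteq>K. finite F \<and> U = \<Union>(basic_open ` F)"
    using X by (intro exI[of _ F]) auto
next
  assume "\<exists>F\<subseteq>K. finite F \<and> U = \<Union>(basic_open ` F)"
  then show "compact_open (zariski L) U"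
    using compact_open_basic_open unfolding compact_open_def
    by (blast intro: compactin_Union openin_Union)
qed

theorem spectral_zariski: "spectral_space (zariski L)"
  unfolding spectral_space_def
proof (intro conjI allI impI)
  have "basic_open \<top> = Spec L"
  proof -
    have "\<not> \<top> \<sqsubseteq> p" if "p \<in> Spec L" for p
      using SpecD(1,2)[OF that] le_antisym[OF top_higher _ _ top_closed, of p] by auto
    then show ?thesis by (auto simp: zariski_closed_def)
  qed
  then show "compact_space (zariski L)"
    using compact_open_basic_open[OF top] by (simp add: compact_space_def compact_open_def topspace_zariski)
  show "sober_space (zariski L)" by (rule sober_zariski)
  show "openin (zariski L) = arbitrary union_of compact_open (zariski L)"
  proof (intro ext iffI)
    fix U assume "openin (zariski L) U"
    then obtain X where X: "X \<subseteq> K" "U = \<Union>(basic_open ` X)"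
      using basic_open_union unfolding openin_zariski by metis
    then show "(arbitrary union_of compact_open (zariski L)) U"
      unfolding union_of_def arbitrary_def
      using compact_open_basic_open by (intro exI[of _ "basic_open ` X"]) auto
  next
    fix U assume "(arbitrary union_of compact_open (zariski L)) U"
    then show "openin (zariski L) U"
      unfolding union_of_def by (auto intro!: openin_Union simp: compact_open_def)
  qed
  fix U V assume "compact_open (zariski L) U \<and> compact_open (zariski L) V"
  then obtain F G where FG: "F \<subseteq> K" "finite F" "U = \<Union>(basic_open ` F)"
    "G \<subseteq> K" "finite G" "V = \<Union>(basic_open ` G)"
    unfolding compact_open_iff by blast
  \<comment> \<open>Basic open sets intersect in the basic open set of the product, so closure of
    \<open>K\<close> under products gives closure of the compact open sets under
    intersections.\<close>
  define H where "H = (\<lambda>(k, k'). lprod L k k') ` (F \<times> G)"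
  have "basic_open (lprod L k k') = basic_open k \<inter> basic_open k'" if "k \<in> F" "k' \<in> G" for k k'
    using zariski_closed_prod[of k k'] that FG(1,4) K by auto
  then have "U \<inter> V = \<Union>(basic_open ` H)" using FG by (fastforce simp: H_def)
  moreover have "H \<subseteq> K" "finite H" using FG prod by (auto simp: H_def)
  ultimately show "compact_open (zariski L) (U \<inter> V)" unfolding compact_open_iff by blast
qed

end

end

section \<open>Finitely generated congruences\<close>

lemma congruence_cong_gen:
  assumes "is_algebra \<sigma> A" "R \<subseteq> carrier A \<times> carrier A"
  shows "congruence \<sigma> A (cong_gen \<sigma> A R)"
  unfolding cong_gen_def using assms congruence_total by (intro congruence_Inter) auto

lemma cong_gen_incr: "R \<subseteq> cong_gen \<sigma> A R"
  unfolding cong_gen_def by blast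

lemma cong_gen_least: "\<lbrakk>congruence \<sigma> A \<theta>; R \<subseteq> \<theta>\<rbrakk> \<Longrightarrow> cong_gen \<sigma> A R \<subseteq> \<theta>"
  unfolding cong_gen_def by blast

lemma directed_finite_subset:
  assumes "finite P" "P \<subseteq> \<Union>\<D>" "\<D> \<noteq> {}"
    and dir: "\<And>x y. \<lbrakk>x \<in> \<D>; y \<in> \<D>\<rbrakk> \<Longrightarrow> \<exists>z\<in>\<D>. x \<subseteq> z \<and> y \<subseteq> z"
  shows "\<exists>d\<in>\<D>. P \<subseteq> d"
  using assms(1,2)
proof induction
  case empty
  then show ?case using assms(3) by blast
next
  case (insert a P)
  then obtain d e where de: "d \<in> \<D>" "P \<subseteq> d" "e \<in> \<D>" "a \<in> e" by auto
  obtain z where "z \<in> \<D>" "d \<subseteq> z" "e \<subseteq> z" using dir[OF de(1,3)] by blast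
  then show ?case using de(2,4) by (intro bexI[of _ z]) auto
qed

text \<open>Operations are finitary: the finitely many pairs of arguments already lie in a single
  member of the family.\<close>

lemma congruence_directed_Union:
  assumes c: "\<And>\<theta>. \<theta> \<in> \<D> \<Longrightarrow> congruence \<sigma> A \<theta>" and ne: "\<D> \<noteq> {}"
    and dir: "\<And>x y. \<lbrakk>x \<in> \<D>; y \<in> \<D>\<rbrakk> \<Longrightarrow> \<exists>z\<in>\<D>. x \<subseteq> z \<and> y \<subseteq> z"
  shows "congruence \<sigma> A (\<Union>\<D>)"
proof (rule congruenceI)
  show "\<Union>\<D> \<subseteq> carrier A \<times> carrier A" using c by (auto dest: congruenceD(1,2))
  show "(a, a) \<in> \<Union>\<D>" if "a \<in> carrier A" for a using ne congruenceD(3)[OF c that] by blast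
  show "(b, a) \<in> \<Union>\<D>" if "(a, b) \<in> \<Union>\<D>" for a b using that congruenceD(4)[OF c] by blast
  show "(a, d) \<in> \<Union>\<D>" if ab: "(a, b) \<in> \<Union>\<D>" "(b, d) \<in> \<Union>\<D>" for a b d
  proof -
    obtain \<theta> where "\<theta> \<in> \<D>" "{(a, b), (b, d)} \<subseteq> \<theta>"
      using directed_finite_subset[OF _ _ ne dir, of "{(a, b), (b, d)}"] ab by auto
    then show ?thesis using congruenceD(5)[OF c, of \<theta> a b d] by blast
  qed
  fix f xs ys
  assume f: "\<sigma> f = Some (length xs)" and l: "list_all2 (\<lambda>a b. (a, b) \<in> \<Union>\<D>) xs ys"
  have "set (zip xs ys) \<subseteq> \<Union>\<D>" using l by (auto simp: list_all2_iff)
  then obtain \<theta> where \<theta>: "\<theta> \<in> \<D>" "set (zip xs ys) \<subseteq> \<theta>"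
    using directed_finite_subset[OF _ _ ne dir, of "set (zip xs ys)"] by auto
  then have "list_all2 (\<lambda>a b. (a, b) \<in> \<theta>) xs ys" using l by (auto simp: list_all2_iff)
  then show "(opr A f xs, opr A f ys) \<in> \<Union>\<D>" using congruenceD(6)[OF c[OF \<theta>(1)] f] \<theta>(1) by blast
qed

theorem theorem10p2:
  fixes \<sigma> :: "'f signature" and E :: "'f identities" and A :: "('f, 'a) ualgebra"
  assumes "wf_identities \<sigma> E"
    and "in_variety \<sigma> E A"
    and a: "\<exists>E'. congruence_modular_variety \<sigma> E' \<and> in_variety \<sigma> E' A"
    and b: "fin_gen_congruence \<sigma> A (carrier A \<times> carrier A)"
    and c: "\<And>x y. \<lbrakk>fin_gen_congruence \<sigma> A x; fin_gen_congruence \<sigma> A y\<rbrakk> \<Longrightarrow>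
                    fin_gen_congruence \<sigma> A (commutator \<sigma> E A x y)"
  shows "spectral_space (zariski (Cong_mult \<sigma> E A))"
proof -
  let ?L = "Cong_mult \<sigma> E A"
  have alg: "is_algebra \<sigma> A" using assms(2) by (simp add: in_variety_def)
  obtain E' where E': "modular_algebra \<sigma> E' A"
    using a by (auto intro: modular_algebra.intro)
  interpret L: complete_multiplicative_lattice ?L
    by (rule complete_multiplicative_lattice_Cong[OF assms(1,2)])
  have L: "carrier ?L = {\<theta>. congruence \<sigma> A \<theta>}" "le ?L = (\<subseteq>)" "lprod ?L = commutator \<sigma> E A"
    by (simp_all add: Cong_mult_def)
  have Sup_congruence: "congruence \<sigma> A (\<Squnion>\<^bsub>?L\<^esub>X)" if "X \<subseteq> carrier ?L" for X
    using L.sup_closed[OF that] by (simp add: L(1))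
  have Sup_le: "\<Squnion>\<^bsub>?L\<^esub>X \<subseteq> \<theta> \<longleftrightarrow> (\<forall>x\<in>X. x \<subseteq> \<theta>)" if "X \<subseteq> carrier ?L" "congruence \<sigma> A \<theta>" for X \<theta>
    using L.Sup_le_iff[of X \<theta>] that by (simp add: L(1,2))
  have Sup_upper: "x \<subseteq> \<Squnion>\<^bsub>?L\<^esub>X" if "X \<subseteq> carrier ?L" "x \<in> X" for X x
    using L.sup_upper[OF that] by (simp add: L(2))
  have Sup_mono: "\<Squnion>\<^bsub>?L\<^esub>X \<subseteq> \<Squnion>\<^bsub>?L\<^esub>Y" if "X \<subseteq> Y" "Y \<subseteq> carrier ?L" for X Y
  proof -
    have "X \<subseteq> carrier ?L" using that by blast
    then show ?thesis using Sup_le[OF _ Sup_congruence[OF that(2)]] Sup_upper[OF that(2)] that(1) by blast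
  qed
  define K where "K = {k. fin_gen_congruence \<sigma> A k}"
  show ?thesis
  proof (rule L.spectral_zariski[of K])
    show "K \<subseteq> carrier ?L" by (auto simp: K_def fin_gen_congruence_def L(1))
    show "\<top>\<^bsub>?L\<^esub> \<in> K"
    proof -
      have "congruence \<sigma> A \<top>\<^bsub>?L\<^esub>" using L.top_closed by (simp add: L(1))
      then have "\<top>\<^bsub>?L\<^esub> \<subseteq> carrier A \<times> carrier A" using congruenceD(1,2) by fastforce
      moreover have "carrier A \<times> carrier A \<subseteq> \<top>\<^bsub>?L\<^esub>"
        using L.top_higher[of "carrier A \<times> carrier A"] congruence_total[OF alg] by (simp add: L(1,2))
      ultimately show ?thesis using b by (simp add: K_def)
    qed
    show "lprod ?L k k' \<in> K" if "k \<in> K" "k' \<in> K" for k k'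
      using c that by (simp add: K_def L(3))
  next
    fix k X assume k: "k \<in> K" and X: "X \<subseteq> carrier ?L" and kX: "k \<sqsubseteq>\<^bsub>?L\<^esub> \<Squnion>\<^bsub>?L\<^esub>X"
    obtain R where R: "finite R" "k = cong_gen \<sigma> A R" using k by (auto simp: K_def fin_gen_congruence_def)
    \<comment> \<open>Suprema of finite subsets of \<open>X\<close> form a directed family whose
      union is a congruence and so contains the supremum of \<open>X\<close>. The finite generating
      set of \<open>k\<close> then lies in one member.\<close>
    define \<D> where "\<D> = (\<lambda>F. \<Squnion>\<^bsub>?L\<^esub>F) ` {F. finite F \<and> F \<subseteq> X}"
    have ne: "\<D> \<noteq> {}" by (auto simp: \<D>_def)
    have cong: "congruence \<sigma> A \<theta>" if "\<theta> \<in> \<D>" for \<theta>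
      using that Sup_congruence X unfolding \<D>_def by blast
    have dir: "\<exists>z\<in>\<D>. x \<subseteq> z \<and> y \<subseteq> z" if xy: "x \<in> \<D>" "y \<in> \<D>" for x y
    proof -
      obtain F G where F: "finite F" "F \<subseteq> X" "x = \<Squnion>\<^bsub>?L\<^esub>F" "finite G" "G \<subseteq> X" "y = \<Squnion>\<^bsub>?L\<^esub>G"
        using xy unfolding \<D>_def by blast
      then have "F \<union> G \<subseteq> X" by blast
      then have "\<Squnion>\<^bsub>?L\<^esub>(F \<union> G) \<in> \<D>" using F unfolding \<D>_def by blast
      moreover have "x \<subseteq> \<Squnion>\<^bsub>?L\<^esub>(F \<union> G)"
        unfolding F(3) by (rule Sup_mono) (use F(2,5) X in blast)+
      moreover have "y \<subseteq> \<Squnion>\<^bsub>?L\<^esub>(F \<union> G)"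
        unfolding F(6) by (rule Sup_mono) (use F(2,5) X in blast)+
      ultimately show ?thesis by blast
    qed
    have "x \<subseteq> \<Union>\<D>" if "x \<in> X" for x
    proof -
      have "\<Squnion>\<^bsub>?L\<^esub>{x} \<in> \<D>" using that unfolding \<D>_def by blast
      then show ?thesis using Sup_upper[of "{x}" x] that X by blast
    qed
    then have "\<Squnion>\<^bsub>?L\<^esub>X \<subseteq> \<Union>\<D>" using Sup_le[OF X congruence_directed_Union[OF cong ne dir]] by blast
    then have "R \<subseteq> \<Union>\<D>" using cong_gen_incr[of R \<sigma> A] kX R(2) by (simp add: L(2))
    then obtain \<theta> where \<theta>: "\<theta> \<in> \<D>" "R \<subseteq> \<theta>" using directed_finite_subset[OF R(1) _ ne dir] by blast
    then have "k \<subseteq> \<theta>" unfolding R(2) by (intro cong_gen_least cong)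
    then show "\<exists>F\<subseteq>X. finite F \<and> k \<sqsubseteq>\<^bsub>?L\<^esub> \<Squnion>\<^bsub>?L\<^esub>F" using \<theta>(1) unfolding \<D>_def L(2) by blast
  next
    fix x assume "x \<in> carrier ?L"
    then have x: "congruence \<sigma> A x" by (simp add: L(1))
    have sub: "{ab} \<subseteq> carrier A \<times> carrier A" if "ab \<in> x" for ab
      using congruenceD(1,2)[OF x] that by (cases ab) blast
    \<comment> \<open>Every congruence is the supremum of the principal congruences below
      it.\<close>
    define X where "X = (\<lambda>ab. cong_gen \<sigma> A {ab}) ` x"
    have XK: "X \<subseteq> K"
      using sub congruence_cong_gen[OF alg sub] by (auto simp: X_def K_def fin_gen_congruence_def)
    then have XL: "X \<subseteq> carrier ?L" by (auto simp: K_def fin_gen_congruence_def L(1))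
    have "y \<subseteq> x" if "y \<in> X" for y
      using that cong_gen_least[OF x] by (auto simp: X_def)
    then have "\<Squnion>\<^bsub>?L\<^esub>X \<subseteq> x" using Sup_le[OF XL x] by blast
    moreover have "ab \<in> \<Squnion>\<^bsub>?L\<^esub>X" if "ab \<in> x" for ab
      using Sup_upper[OF XL, of "cong_gen \<sigma> A {ab}"] that cong_gen_incr[of "{ab}" \<sigma> A] by (auto simp: X_def)
    ultimately have "x = \<Squnion>\<^bsub>?L\<^esub>X" by blast
    then show "\<exists>X\<subseteq>K. x = \<Squnion>\<^bsub>?L\<^esub>X" using XK by blast
  next
    fix k x y p
    assume "k \<in> K" "x \<in> carrier ?L" "y \<in> carrier ?L" "p \<in> carrier ?L" and xy: "lprod ?L x y \<sqsubseteq>\<^bsub>?L\<^esub> p"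
      and k: "k \<sqsubseteq>\<^bsub>?L\<^esub> p \<squnion>\<^bsub>?L\<^esub> x" "k \<sqsubseteq>\<^bsub>?L\<^esub> p \<squnion>\<^bsub>?L\<^esub> y"
    then have cong: "congruence \<sigma> A k" "congruence \<sigma> A x" "congruence \<sigma> A y" "congruence \<sigma> A p"
      by (simp_all add: L(1) K_def fin_gen_congruence_def)
    have join: "p \<squnion>\<^bsub>?L\<^esub> z \<subseteq> (p \<union> z)\<^sup>+" if z: "congruence \<sigma> A z" for z
      using L.join_le[of p "(p \<union> z)\<^sup>+" z] congruence_join[OF alg cong(4) z] cong(4) z trancl_incr[of "p \<union> z"]
      by (simp add: L(1,2))
    have "k \<subseteq> (p \<union> x)\<^sup>+" "k \<subseteq> (p \<union> y)\<^sup>+"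
      using k join[OF cong(2)] join[OF cong(3)] unfolding L(2) by blast+
    \<comment> \<open>Both bounded factors of \<open>commutator_join\<close> are taken to be
      \<open>k\<close>.\<close>
    then show "lprod ?L k k \<sqsubseteq>\<^bsub>?L\<^esub> p"
      using commutator_join[OF assms(1,2) E' cong(2,3,4) _ cong(1) _ cong(1)] xy unfolding L(2,3) by blast
  qed
qed

end
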